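(* Let $M$ be a complete Riemannian $3$-manifold with sectional curvatures between $0$ and $1$. Then every minimal $2$-sphere immersed in $M$ has area at least $4\pi$.
   Context: Metrics and manifolds are smooth ($C^\infty$). A minimal $2$-sphere immersed in $M$ is an immersion of the $2$-sphere into $M$ whose mean curvature vanishes identically; its area is the area of the $2$-sphere for the metric induced by the immersion. *)

theory Defs
  imports "HOL-Analysis.Analysis"
begin

section \<open>Smooth maps between open subsets of Euclidean spaces\<close>

text \<open>Only meaningful for open \<open>S\<close>: the derivatives are taken in the full space.\<close>

primrec differentiable_upto ::
    "nat \<Rightarrow> 'a::real_normed_vector set \<Rightarrow> ('a \<Rightarrow> 'b::real_normed_vector) \<Rightarrow> bool" where
  "differentiable_upto 0 S f \<longleftrightarrow> continuous_on S f"
| "differentiable_upto (Suc k) S f \<longleftrightarrow>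
     (\<forall>x\<in>S. f differentiable (at x)) \<and>
     (\<forall>v. differentiable_upto k S (\<lambda>x. frechet_derivative f (at x) v))"

definition smooth_on :: "'a::real_normed_vector set \<Rightarrow> ('a \<Rightarrow> 'b::real_normed_vector) \<Rightarrow> bool" where
  "smooth_on S f \<longleftrightarrow> (\<forall>k. differentiable_upto k S f)"

definition pderiv_at :: "'n::finite \<Rightarrow> (real^'n \<Rightarrow> 'b::real_normed_vector) \<Rightarrow> real^'n \<Rightarrow> 'b" where
  "pderiv_at i F x = frechet_derivative F (at x) (axis i 1)"


section \<open>Smooth manifolds\<close>

text \<open>
  A chart is a pair of a coordinate domain and a coordinate map; outside its domain the
  map is irrelevant. A smooth structure is given by any (not necessarily maximal) smooth atlas.
\<close>

type_synonym ('a, 'n) chart = "'a set \<times> ('a \<Rightarrow> real^'n)"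

abbreviation chart_dom :: "('a, 'n::finite) chart \<Rightarrow> 'a set" where
  "chart_dom c \<equiv> fst c"

abbreviation coord :: "('a, 'n::finite) chart \<Rightarrow> 'a \<Rightarrow> real^'n" where
  "coord c \<equiv> snd c"

definition chart_img :: "('a, 'n::finite) chart \<Rightarrow> (real^'n) set" where
  "chart_img c = coord c ` chart_dom c"

definition chart_inv :: "('a, 'n::finite) chart \<Rightarrow> real^'n \<Rightarrow> 'a" where
  "chart_inv c = inv_into (chart_dom c) (coord c)"

definition is_chart :: "'a topology \<Rightarrow> ('a, 'n::finite) chart \<Rightarrow> bool" where
  "is_chart X c \<longleftrightarrow> openin X (chart_dom c) \<and> open (chart_img c) \<and>
     homeomorphic_map (subtopology X (chart_dom c)) (top_of_set (chart_img c)) (coord c)"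

definition local_rep ::
    "('a, 'm::finite) chart \<Rightarrow> ('b, 'n::finite) chart \<Rightarrow> ('a \<Rightarrow> 'b) \<Rightarrow> real^'m \<Rightarrow> real^'n" where
  "local_rep c d f = coord d \<circ> f \<circ> chart_inv c"

abbreviation transition ::
    "('a, 'n::finite) chart \<Rightarrow> ('a, 'n) chart \<Rightarrow> real^'n \<Rightarrow> real^'n" where
  "transition c d \<equiv> local_rep c d id"

definition smooth_manifold :: "'a topology \<Rightarrow> ('a, 'n::finite) chart set \<Rightarrow> bool" where
  "smooth_manifold X A \<longleftrightarrow>
     Hausdorff_space X \<and> second_countable X \<and>
     (\<forall>c\<in>A. is_chart X c) \<and> (\<Union>c\<in>A. chart_dom c) = topspace X \<and>
     (\<forall>c\<in>A. \<forall>d\<in>A. smooth_on (coord c ` (chart_dom c \<inter> chart_dom d)) (transition c d))"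

definition smooth_map ::
    "'a topology \<Rightarrow> ('a, 'm::finite) chart set \<Rightarrow> 'b topology \<Rightarrow> ('b, 'n::finite) chart set \<Rightarrow>
     ('a \<Rightarrow> 'b) \<Rightarrow> bool" where
  "smooth_map X A Y B f \<longleftrightarrow> continuous_map X Y f \<and>
     (\<forall>c\<in>A. \<forall>d\<in>B. smooth_on (coord c ` (chart_dom c \<inter> f -` chart_dom d)) (local_rep c d f))"

definition immersion ::
    "'a topology \<Rightarrow> ('a, 'm::finite) chart set \<Rightarrow> 'b topology \<Rightarrow> ('b, 'n::finite) chart set \<Rightarrow>
     ('a \<Rightarrow> 'b) \<Rightarrow> bool" where
  "immersion X A Y B f \<longleftrightarrow> smooth_map X A Y B f \<and>
     (\<forall>c\<in>A. \<forall>d\<in>B. \<forall>p \<in> chart_dom c \<inter> f -` chart_dom d.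
        inj (frechet_derivative (local_rep c d f) (at (coord c p))))"


section \<open>Riemannian metrics\<close>

text \<open>
  A covariant 2-tensor is given by its component matrices: \<open>g c x\<close> is the matrix
  of the tensor at the point with coordinates \<open>x\<close> in the chart \<open>c\<close>, and the matrices
  in different charts are related by the tensor transformation law.
\<close>

type_synonym ('a, 'n) metric = "('a, 'n) chart \<Rightarrow> real^'n \<Rightarrow> real^'n^'n"

definition ginner ::
    "('a, 'n::finite) metric \<Rightarrow> ('a, 'n) chart \<Rightarrow> real^'n \<Rightarrow> real^'n \<Rightarrow> real^'n \<Rightarrow> real" where
  "ginner g c x v w = v \<bullet> (g c x *v w)"

definition riemannian_metric :: "('a, 'n::finite) chart set \<Rightarrow> ('a, 'n) metric \<Rightarrow> bool" where
  "riemannian_metric A g \<longleftrightarrow>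
     (\<forall>c\<in>A. smooth_on (chart_img c) (g c) \<and>
        (\<forall>x\<in>chart_img c. transpose (g c x) = g c x \<and> (\<forall>v. v \<noteq> 0 \<longrightarrow> ginner g c x v v > 0))) \<and>
     (\<forall>c\<in>A. \<forall>d\<in>A. \<forall>p \<in> chart_dom c \<inter> chart_dom d. \<forall>v w.
        let D = frechet_derivative (transition c d) (at (coord c p))
        in ginner g c (coord c p) v w = ginner g d (coord d p) (D v) (D w))"

definition riemannian_manifold ::
    "'a topology \<Rightarrow> ('a, 'n::finite) chart set \<Rightarrow> ('a, 'n) metric \<Rightarrow> bool" where
  "riemannian_manifold X A g \<longleftrightarrow> smooth_manifold X A \<and> riemannian_metric A g"


section \<open>Levi-Civita connection, geodesics, curvature\<close>

text \<open>\<open>christoffel g c k i j x\<close> is \<open>\<Gamma>\<^sup>k\<^sub>i\<^sub>j\<close> at \<open>x\<close>.\<close>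

definition christoffel ::
    "('a, 'n::finite) metric \<Rightarrow> ('a, 'n) chart \<Rightarrow> 'n \<Rightarrow> 'n \<Rightarrow> 'n \<Rightarrow> real^'n \<Rightarrow> real" where
  "christoffel g c k i j x = (1/2) * (\<Sum>l\<in>UNIV. matrix_inv (g c x) $ k $ l *
     (pderiv_at i (\<lambda>y. g c y $ j $ l) x + pderiv_at j (\<lambda>y. g c y $ i $ l) x
      - pderiv_at l (\<lambda>y. g c y $ i $ j) x))"

text \<open>
  Geodesics defined on the whole real line: smooth curves satisfying
  \<open>x''\<^sup>k + \<Gamma>\<^sup>k\<^sub>i\<^sub>j x'\<^sup>i x'\<^sup>j = 0\<close> in every chart.
\<close>

definition complete_geodesic ::
    "'a topology \<Rightarrow> ('a, 'n::finite) chart set \<Rightarrow> ('a, 'n) metric \<Rightarrow> (real \<Rightarrow> 'a) \<Rightarrow> bool" where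
  "complete_geodesic X A g \<gamma> \<longleftrightarrow> continuous_map euclideanreal X \<gamma> \<and>
     (\<forall>c\<in>A. smooth_on (\<gamma> -` chart_dom c) (coord c \<circ> \<gamma>) \<and>
        (\<forall>t \<in> \<gamma> -` chart_dom c. \<forall>k.
           let x' = (\<lambda>s. vector_derivative (coord c \<circ> \<gamma>) (at s));
               x'' = vector_derivative x' (at t)
           in x'' $ k + (\<Sum>i\<in>UNIV. \<Sum>j\<in>UNIV.
                christoffel g c k i j (coord c (\<gamma> t)) * x' t $ i * x' t $ j) = 0))"

text \<open>
  Geodesic completeness: every initial point and velocity is realised by a geodesic
  defined for all times, i.e. the exponential map is defined on the whole tangent bundle.
\<close>

definition complete_riemannian_manifold ::
    "'a topology \<Rightarrow> ('a, 'n::finite) chart set \<Rightarrow> ('a, 'n) metric \<Rightarrow> bool" where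
  "complete_riemannian_manifold X A g \<longleftrightarrow> riemannian_manifold X A g \<and>
     (\<forall>c\<in>A. \<forall>p\<in>chart_dom c. \<forall>v. \<exists>\<gamma>. complete_geodesic X A g \<gamma> \<and> \<gamma> 0 = p \<and>
        vector_derivative (coord c \<circ> \<gamma>) (at 0) = v)"

text \<open>
  \<open>riemann_coeff g c l k i j\<close> is the component \<open>R\<^sup>l\<^sub>k\<^sub>i\<^sub>j\<close> with
  \<open>R(\<partial>\<^sub>i,\<partial>\<^sub>j)\<partial>\<^sub>k = R\<^sup>l\<^sub>k\<^sub>i\<^sub>j \<partial>\<^sub>l\<close>, for the convention
  \<open>R(X,Y)Z = \<nabla>\<^sub>X\<nabla>\<^sub>YZ - \<nabla>\<^sub>Y\<nabla>\<^sub>XZ - \<nabla>\<^bsub>[X,Y]\<^esub>Z\<close>.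
\<close>

definition riemann_coeff ::
    "('a, 'n::finite) metric \<Rightarrow> ('a, 'n) chart \<Rightarrow> 'n \<Rightarrow> 'n \<Rightarrow> 'n \<Rightarrow> 'n \<Rightarrow> real^'n \<Rightarrow> real" where
  "riemann_coeff g c l k i j x =
     pderiv_at i (christoffel g c l j k) x - pderiv_at j (christoffel g c l i k) x
     + (\<Sum>m\<in>UNIV. christoffel g c l i m x * christoffel g c m j k x
                - christoffel g c l j m x * christoffel g c m i k x)"

definition curvature_op ::
    "('a, 'n::finite) metric \<Rightarrow> ('a, 'n) chart \<Rightarrow> real^'n \<Rightarrow> real^'n \<Rightarrow> real^'n \<Rightarrow> real^'n \<Rightarrow> real^'n" where
  "curvature_op g c x v w z = (\<chi> l. \<Sum>k\<in>UNIV. \<Sum>i\<in>UNIV. \<Sum>j\<in>UNIV.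
     riemann_coeff g c l k i j x * z $ k * v $ i * w $ j)"

text \<open>The sectional curvature of the tangent plane spanned by \<open>v\<close> and \<open>w\<close>.\<close>

definition sectional_curvature ::
    "('a, 'n::finite) metric \<Rightarrow> ('a, 'n) chart \<Rightarrow> real^'n \<Rightarrow> real^'n \<Rightarrow> real^'n \<Rightarrow> real" where
  "sectional_curvature g c x v w =
     ginner g c x (curvature_op g c x v w w) v /
     (ginner g c x v v * ginner g c x w w - (ginner g c x v w)\<^sup>2)"

definition sectional_curvature_between ::
    "('a, 'n::finite) chart set \<Rightarrow> ('a, 'n) metric \<Rightarrow> real \<Rightarrow> real \<Rightarrow> bool" where
  "sectional_curvature_between A g a b \<longleftrightarrow>
     (\<forall>c\<in>A. \<forall>x\<in>chart_img c. \<forall>v w. v \<noteq> w \<and> independent {v, w} \<longrightarrow>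
        a \<le> sectional_curvature g c x v w \<and> sectional_curvature g c x v w \<le> b)"


section \<open>Induced metric and mean curvature of an immersion\<close>

text \<open>
  In the definitions below \<open>c\<close> is a chart of the source, \<open>d\<close> a chart of the target,
  and \<open>u\<close> are source coordinates of a point that \<open>f\<close> maps into the domain of \<open>d\<close>.
\<close>

definition first_fundamental_form ::
    "('b, 'n::finite) metric \<Rightarrow> ('a, 'm::finite) chart \<Rightarrow> ('b, 'n) chart \<Rightarrow> ('a \<Rightarrow> 'b) \<Rightarrow>
     real^'m \<Rightarrow> real^'m^'m" where
  "first_fundamental_form g c d f u = (\<chi> i j. ginner g d (local_rep c d f u)
     (pderiv_at i (local_rep c d f) u) (pderiv_at j (local_rep c d f) u))"

text \<open>The choice of the target chart is immaterial by the transformation law for \<open>g\<close>.\<close>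

definition induced_metric ::
    "('b, 'n::finite) chart set \<Rightarrow> ('b, 'n) metric \<Rightarrow> ('a \<Rightarrow> 'b) \<Rightarrow> ('a, 'm::finite) metric" where
  "induced_metric B g f c u =
     first_fundamental_form g c (SOME d. d \<in> B \<and> f (chart_inv c u) \<in> chart_dom d) f u"

definition normal_part ::
    "('b, 'n::finite) metric \<Rightarrow> ('a, 'm::finite) chart \<Rightarrow> ('b, 'n) chart \<Rightarrow> ('a \<Rightarrow> 'b) \<Rightarrow>
     real^'m \<Rightarrow> real^'n \<Rightarrow> real^'n" where
  "normal_part g c d f u v = v - (\<Sum>k\<in>UNIV. \<Sum>l\<in>UNIV.
     (matrix_inv (first_fundamental_form g c d f u) $ k $ l *
      ginner g d (local_rep c d f u) v (pderiv_at k (local_rep c d f) u))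
       *\<^sub>R pderiv_at l (local_rep c d f) u)"

text \<open>The ambient covariant derivative of \<open>\<partial>\<^sub>jF\<close> in direction \<open>\<partial>\<^sub>iF\<close>, where \<open>F\<close> is \<open>f\<close> in coordinates.\<close>

definition ambient_deriv ::
    "('b, 'n::finite) metric \<Rightarrow> ('a, 'm::finite) chart \<Rightarrow> ('b, 'n) chart \<Rightarrow> ('a \<Rightarrow> 'b) \<Rightarrow>
     'm \<Rightarrow> 'm \<Rightarrow> real^'m \<Rightarrow> real^'n" where
  "ambient_deriv g c d f i j u = (let F = local_rep c d f in
     pderiv_at i (pderiv_at j F) u + (\<chi> k. \<Sum>a\<in>UNIV. \<Sum>b\<in>UNIV.
       christoffel g d k a b (F u) * pderiv_at i F u $ a * pderiv_at j F u $ b))"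

definition second_fundamental_form ::
    "('b, 'n::finite) metric \<Rightarrow> ('a, 'm::finite) chart \<Rightarrow> ('b, 'n) chart \<Rightarrow> ('a \<Rightarrow> 'b) \<Rightarrow>
     'm \<Rightarrow> 'm \<Rightarrow> real^'m \<Rightarrow> real^'n" where
  "second_fundamental_form g c d f i j u = normal_part g c d f u (ambient_deriv g c d f i j u)"

definition mean_curvature ::
    "('b, 'n::finite) metric \<Rightarrow> ('a, 'm::finite) chart \<Rightarrow> ('b, 'n) chart \<Rightarrow> ('a \<Rightarrow> 'b) \<Rightarrow>
     real^'m \<Rightarrow> real^'n" where
  "mean_curvature g c d f u = (1 / real CARD('m)) *\<^sub>R (\<Sum>i\<in>UNIV. \<Sum>j\<in>UNIV.
     matrix_inv (first_fundamental_form g c d f u) $ i $ j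
       *\<^sub>R second_fundamental_form g c d f i j u)"

definition minimal_immersion ::
    "'a topology \<Rightarrow> ('a, 'm::finite) chart set \<Rightarrow> 'b topology \<Rightarrow> ('b, 'n::finite) chart set \<Rightarrow>
     ('b, 'n) metric \<Rightarrow> ('a \<Rightarrow> 'b) \<Rightarrow> bool" where
  "minimal_immersion X A Y B g f \<longleftrightarrow> immersion X A Y B f \<and>
     (\<forall>c\<in>A. \<forall>d\<in>B. \<forall>p \<in> chart_dom c \<inter> f -` chart_dom d.
        mean_curvature g c d f (coord c p) = 0)"


section \<open>Riemannian volume\<close>

text \<open>
  The total volume: a Borel set \<open>B\<close> of coordinates in the chart \<open>c\<close> has volume
  \<open>\<integral>\<^sub>B sqrt (det h)\<close>, and the manifold is exhausted by finite disjoint unions of such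
  pieces, since it is a countable disjoint union of them.
\<close>

definition riemannian_volume ::
    "('a, 'n::finite) chart set \<Rightarrow> ('a, 'n) metric \<Rightarrow> ennreal" where
  "riemannian_volume A h =
     (SUP P \<in> {P. finite P \<and> (\<forall>(c, B)\<in>P. c \<in> A \<and> B \<in> sets borel \<and> B \<subseteq> chart_img c) \<and>
                  disjoint_family_on (\<lambda>(c, B). chart_inv c ` B) P}.
        \<Sum>(c, B)\<in>P. \<integral>\<^sup>+u\<in>B. ennreal (sqrt (det (h c u))) \<partial>lborel)"


section \<open>The 2-sphere\<close>

abbreviation sphere2 :: "(real^3) topology" where
  "sphere2 \<equiv> top_of_set (sphere 0 1)"

text \<open>Stereographic projection from the pole \<open>(0, 0, s)\<close>, where \<open>s = 1\<close> or \<open>s = -1\<close>.\<close>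

definition stereographic_chart :: "real \<Rightarrow> (real^3, 2) chart" where
  "stereographic_chart s =
     (sphere 0 1 - {axis 3 s},
      \<lambda>p. vector [p $ 1 / (1 - s * p $ 3), p $ 2 / (1 - s * p $ 3)])"

definition sphere2_atlas :: "(real^3, 2) chart set" where
  "sphere2_atlas = {stereographic_chart 1, stereographic_chart (-1)}"

end

(* By the Gauss equation a minimal surface has Gauss curvature K at most the ambient sectional
   curvature of its tangent plane, hence K <= 1, and Gauss-Bonnet gives 4 pi = int K dA <= area.
   For Gauss-Bonnet the sphere is cut along the equator into two unit disks in the stereographic
   charts. On a disk without its centre, K dA is the exterior derivative of the connection form
   of the frame that Gram-Schmidt makes from the polar coordinate fields; the integral of this
   form over small circles around the centre tends to 2 pi. The transition between the charts is
   r -> 1/r at the same angle, so the two integrals over the equator cancel. *)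

theory Submission
  imports Defs
begin

section \<open>Calculus of smooth maps\<close>

text \<open>The obstacle is that Christoffel symbols, second derivatives and mean curvature exist
  only chart by chart in the target, while Gauss-Bonnet integrates over a whole disk. The bridge:
  the connection form depends only on the metric coefficients \<open>E\<close>, \<open>F\<close>,
  \<open>G\<close> and their first derivatives (\<open>conn1\<close>, \<open>conn2\<close>). These
  come from the induced metric, which is globally defined, so an inequality proved near a point in
  any target chart is about one global form. Gauss curvature itself is never defined; its product
  with the area density appears as \<open>dird b conn1 - dird a conn2\<close>. Polar coordinates
  give a frame for an arbitrary metric without isothermal coordinates, at the price of degeneracy at
  \<open>r = 0\<close>. As \<open>hF\<close> and \<open>hG\<close> carry factors \<open>r\<close>
  and \<open>r^2\<close>, the angular component still extends continuously to \<open>r = 0\<close>;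
  there it is the angular speed of a vector turning once, whence 2 pi for every inner product. The
  cancellation on the equator is a sign: inversion reverses the radial field, hence the first frame
  vector, and keeps the second, so the form \<open><D e1, e2>\<close> changes sign on the common
  tangent direction.\<close>

definition dird :: "'a::real_normed_vector \<Rightarrow> ('a \<Rightarrow> 'b::real_normed_vector) \<Rightarrow> 'a \<Rightarrow> 'b" where
  "dird v f x = frechet_derivative f (at x) v"

lemma pderiv_at_eq_dird: "pderiv_at i F = dird (axis i 1) F"
  by (simp add: pderiv_at_def dird_def fun_eq_iff)

lemma dird_eqI: "(f has_derivative f') (at x) \<Longrightarrow> dird v f x = f' v"
  unfolding dird_def using frechet_derivative_at by metis

lemma dird_works: "f differentiable (at x) \<Longrightarrow> (f has_derivative (\<lambda>v. dird v f x)) (at x)"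
  unfolding dird_def by (simp add: frechet_derivative_works[symmetric] eta_contract_eq)

lemma linear_dird: "f differentiable (at x) \<Longrightarrow> linear (\<lambda>v. dird v f x)"
  using dird_works has_derivative_linear by blast

lemma dird_cong_open:
  assumes "open S" "x \<in> S" "\<And>y. y \<in> S \<Longrightarrow> f y = g y"
  shows "dird v f x = dird v g x"
proof (cases "f differentiable (at x)")
  case True
  then show ?thesis
    unfolding dird_def using frechet_derivative_transform_within_open[OF True assms(1,2)] assms(3) by metis
next
  case False
  \<comment> \<open>Without differentiability, \<open>frechet_derivative\<close> is an arbitrary
    choice from its defining predicate. The predicates of \<open>f\<close> and \<open>g\<close>
    coincide, hence so do the choices, and the congruence needs no differentiability.\<close>
  have eq: "(f has_derivative D) (at x) \<longleftrightarrow> (g has_derivative D) (at x)" for D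
    using has_derivative_transform_within_open[OF _ assms(1,2)] assms(3) by metis
  show ?thesis unfolding dird_def frechet_derivative_def eq ..
qed

lemma differentiable_cong_open:
  assumes "open S" "x \<in> S" "\<And>y. y \<in> S \<Longrightarrow> f y = g y"
  shows "f differentiable (at x) \<longleftrightarrow> g differentiable (at x)"
  unfolding differentiable_def
  using has_derivative_transform_within_open[OF _ assms(1,2)] assms(3) by metis

lemma differentiable_upto_Suc:
  "differentiable_upto (Suc k) S f \<longleftrightarrow>
     (\<forall>x\<in>S. f differentiable (at x)) \<and> (\<forall>v. differentiable_upto k S (dird v f))"
  by (simp add: dird_def[abs_def])

declare differentiable_upto.simps(2) [simp del]

lemma differentiable_upto_SucD: "differentiable_upto (Suc k) S f \<Longrightarrow> differentiable_upto k S f"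
proof (induction k arbitrary: f)
  case 0
  then show ?case
    by (auto simp: differentiable_upto_Suc intro!: continuous_at_imp_continuous_on
        differentiable_imp_continuous_within)
next
  case (Suc k)
  then show ?case
    by (subst differentiable_upto_Suc) (auto simp: differentiable_upto_Suc[of "Suc k"])
qed

lemma differentiable_upto_subset: "differentiable_upto k S f \<Longrightarrow> T \<subseteq> S \<Longrightarrow> differentiable_upto k T f"
  by (induction k arbitrary: f) (auto simp: differentiable_upto_Suc intro: continuous_on_subset)

lemma differentiable_upto_cong:
  assumes "open S" "\<And>x. x \<in> S \<Longrightarrow> f x = g x" "differentiable_upto k S f"
  shows "differentiable_upto k S g"
  using assms(2,3)
proof (induction k arbitrary: f g)
  case 0
  then show ?case by (auto cong: continuous_on_cong)
next
  case (Suc k)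
  have "differentiable_upto k S (dird v g)" for v
    by (rule Suc.IH[of "dird v f"])
      (use Suc.prems assms(1) in \<open>auto simp: differentiable_upto_Suc intro: dird_cong_open\<close>)
  moreover have "g differentiable (at x)" if "x \<in> S" for x
    using Suc.prems differentiable_cong_open[OF assms(1) that, of f g] that
    by (auto simp: differentiable_upto_Suc)
  ultimately show ?case by (simp add: differentiable_upto_Suc)
qed

lemma differentiable_upto_local:
  assumes "\<And>x. x \<in> S \<Longrightarrow> \<exists>T. open T \<and> x \<in> T \<and> differentiable_upto k T f"
  shows "differentiable_upto k S f"
  using assms
proof (induction k arbitrary: f)
  case 0
  have "continuous (at x) f" if "x \<in> S" for x
    using 0[OF that] by (auto simp: continuous_on_eq_continuous_at)
  then show ?case by (simp add: continuous_at_imp_continuous_on)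
next
  case (Suc k)
  show ?case
    unfolding differentiable_upto_Suc
  proof (intro conjI ballI allI)
    show "f differentiable (at x)" if "x \<in> S" for x
      using Suc.prems[OF that] by (auto simp: differentiable_upto_Suc)
    show "differentiable_upto k S (dird v f)" for v
      by (rule Suc.IH) (use Suc.prems in \<open>fastforce simp: differentiable_upto_Suc\<close>)
  qed
qed

lemma dird_const [simp]: "dird v (\<lambda>x. c) x = 0"
  by (rule dird_eqI) (rule has_derivative_const)

lemma differentiable_upto_const: "differentiable_upto k S (\<lambda>x. c)"
proof (induction k arbitrary: c)
  case (Suc k)
  have "dird v (\<lambda>x::'a. c) = (\<lambda>x. 0)" for v by auto
  then show ?case using Suc by (simp add: differentiable_upto_Suc)
qed auto

lemma differentiable_upto_add:
  assumes "open S" "differentiable_upto k S f" "differentiable_upto k S g"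
  shows "differentiable_upto k S (\<lambda>x. f x + g x)"
  using assms(2,3)
proof (induction k arbitrary: f g)
  case 0
  then show ?case by (auto intro: continuous_on_add)
next
  case (Suc k)
  have d: "f differentiable (at x)" "g differentiable (at x)" if "x \<in> S" for x
    using Suc.prems that by (auto simp: differentiable_upto_Suc)
  have "differentiable_upto k S (dird v (\<lambda>x. f x + g x))" for v
  proof (rule differentiable_upto_cong[OF assms(1)])
    show "differentiable_upto k S (\<lambda>x. dird v f x + dird v g x)"
      by (rule Suc.IH) (use Suc.prems in \<open>auto simp: differentiable_upto_Suc\<close>)
    show "dird v f x + dird v g x = dird v (\<lambda>x. f x + g x) x" if "x \<in> S" for x
      by (rule sym, rule dird_eqI) (intro has_derivative_add dird_works d that)
  qed
  then show ?case using d by (auto simp: differentiable_upto_Suc intro: differentiable_add)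
qed

lemma differentiable_upto_linear:
  assumes "bounded_linear L" "open S" "differentiable_upto k S f"
  shows "differentiable_upto k S (\<lambda>x. L (f x))"
  using assms(3)
proof (induction k arbitrary: f)
  case 0
  then show ?case using assms(1) by (auto intro: bounded_linear.continuous_on)
next
  case (Suc k)
  have d: "((\<lambda>x. L (f x)) has_derivative (\<lambda>v. L (dird v f x))) (at x)" if "x \<in> S" for x
    by (rule bounded_linear.has_derivative[OF assms(1)], rule dird_works)
      (use Suc.prems that in \<open>auto simp: differentiable_upto_Suc\<close>)
  have "differentiable_upto k S (dird v (\<lambda>x. L (f x)))" for v
  proof (rule differentiable_upto_cong[OF assms(2)])
    show "differentiable_upto k S (\<lambda>x. L (dird v f x))"
      by (rule Suc.IH) (use Suc.prems in \<open>auto simp: differentiable_upto_Suc\<close>)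
    show "L (dird v f x) = dird v (\<lambda>x. L (f x)) x" if "x \<in> S" for x
      by (rule sym, rule dird_eqI) (rule d that)+
  qed
  then show ?case using d by (auto simp: differentiable_upto_Suc intro: differentiableI)
qed

text \<open>One induction over the product rule serves all products that occur: of reals, scalar,
  inner, and matrix with vector.\<close>

lemma differentiable_upto_bilinear:
  assumes "bounded_bilinear bop" "open S" "differentiable_upto k S f" "differentiable_upto k S g"
  shows "differentiable_upto k S (\<lambda>x. bop (f x) (g x))"
  using assms(3,4)
proof (induction k arbitrary: f g)
  case 0
  then show ?case using assms(1) by (auto intro: bounded_bilinear.continuous_on)
next
  case (Suc k)
  note fg = Suc.prems[THEN differentiable_upto_SucD]
  have d: "((\<lambda>x. bop (f x) (g x)) has_derivative (\<lambda>v. bop (f x) (dird v g x) + bop (dird v f x) (g x))) (at x)"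
    if "x \<in> S" for x
    by (rule bounded_bilinear.FDERIV[OF assms(1)]; rule dird_works)
      (use Suc.prems that in \<open>auto simp: differentiable_upto_Suc\<close>)
  have "differentiable_upto k S (dird v (\<lambda>x. bop (f x) (g x)))" for v
  proof (rule differentiable_upto_cong[OF assms(2)])
    show "differentiable_upto k S (\<lambda>x. bop (f x) (dird v g x) + bop (dird v f x) (g x))"
      by (intro differentiable_upto_add assms(2); rule Suc.IH)
        (use Suc.prems fg in \<open>auto simp: differentiable_upto_Suc\<close>)
    show "bop (f x) (dird v g x) + bop (dird v f x) (g x) = dird v (\<lambda>x. bop (f x) (g x)) x"
      if "x \<in> S" for x
      by (rule sym, rule dird_eqI) (rule d that)+
  qed
  then show ?case using d by (auto simp: differentiable_upto_Suc intro: differentiableI)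
qed

lemma differentiable_upto_sum:
  assumes "open S" "\<And>i. i \<in> I \<Longrightarrow> differentiable_upto k S (f i)"
  shows "differentiable_upto k S (\<lambda>x. \<Sum>i\<in>I. f i x)"
  using assms(2)
  by (induction I rule: infinite_finite_induct)
    (auto intro!: differentiable_upto_const differentiable_upto_add assms(1))

lemma linear_euclidean_expansion:
  fixes v :: "'a::euclidean_space"
  assumes "linear L" shows "L v = (\<Sum>b\<in>Basis. (v \<bullet> b) *\<^sub>R L b)"
  using linear_sum[OF assms, of "\<lambda>b. (v \<bullet> b) *\<^sub>R b" Basis] linear_scale[OF assms]
  by (simp add: euclidean_representation)

lemma dird_compose:
  assumes "g differentiable (at x)" "f differentiable (at (g x))"
  shows "dird v (\<lambda>x. f (g x)) x = dird (dird v g x) f (g x)"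
  by (rule dird_eqI) (rule has_derivative_compose[OF dird_works[OF assms(1)] dird_works[OF assms(2)]])

text \<open>The chain rule differentiates \<open>f\<close> in the direction
  \<open>dird v g x\<close>, which varies with \<open>x\<close>, so the induction hypothesis does
  not apply to it directly. Expanding this direction in the standard basis leaves the functions
  \<open>dird b f\<close> with \<open>b\<close> fixed; hence the Euclidean space in the
  middle.\<close>

lemma differentiable_upto_compose:
  fixes g :: "'a::real_normed_vector \<Rightarrow> 'b::euclidean_space"
  assumes "open S" "open T" "g ` S \<subseteq> T" "differentiable_upto k T f" "differentiable_upto k S g"
  shows "differentiable_upto k S (\<lambda>x. f (g x))"
  using assms(4,5)
proof (induction k arbitrary: f)
  case 0
  then show ?case using assms(3) by (auto intro: continuous_on_compose2)
next
  case (Suc k)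
  have d: "g differentiable (at x)" "f differentiable (at (g x))" if "x \<in> S" for x
    using Suc.prems that assms(3) by (auto simp: differentiable_upto_Suc)
  have "differentiable_upto k S (dird v (\<lambda>x. f (g x)))" for v
  proof (rule differentiable_upto_cong[OF assms(1)])
    show "differentiable_upto k S (\<lambda>x. \<Sum>b\<in>Basis. (dird v g x \<bullet> b) *\<^sub>R dird b f (g x))"
    proof (intro differentiable_upto_sum assms(1)
        differentiable_upto_bilinear[OF bounded_bilinear_scaleR]
        differentiable_upto_bilinear[OF bounded_bilinear_inner] differentiable_upto_const)
      show "differentiable_upto k S (dird v g)"
        using Suc.prems by (auto simp: differentiable_upto_Suc)
      show "differentiable_upto k S (\<lambda>x. dird b f (g x))" for b
        using Suc.prems differentiable_upto_SucD by (intro Suc.IH) (auto simp: differentiable_upto_Suc)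
    qed
    show "(\<Sum>b\<in>Basis. (dird v g x \<bullet> b) *\<^sub>R dird b f (g x)) = dird v (\<lambda>x. f (g x)) x"
      if "x \<in> S" for x
      unfolding dird_compose[OF d[OF that], of v]
      by (rule linear_euclidean_expansion[OF linear_dird[OF d(2)[OF that]], symmetric])
  qed
  moreover have "(\<lambda>x. f (g x)) differentiable (at x)" if "x \<in> S" for x
    using differentiable_chain_at[OF d[OF that]] by (simp add: o_def)
  ultimately show ?case by (simp add: differentiable_upto_Suc)
qed

lemma differentiable_upto_real:
  fixes f :: "real \<Rightarrow> real"
  assumes "open S" "\<And>x. x \<in> S \<Longrightarrow> (f has_real_derivative f' x) (at x)"
    "differentiable_upto k S f'"
  shows "differentiable_upto (Suc k) S f"
proof -
  have d: "(f has_derivative (\<lambda>v. f' x * v)) (at x)" if "x \<in> S" for x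
    using assms(2)[OF that] by (simp add: has_field_derivative_def)
  have "differentiable_upto k S (dird v f)" for v
  proof (rule differentiable_upto_cong[OF assms(1)])
    show "differentiable_upto k S (\<lambda>x. f' x * v)"
      by (intro differentiable_upto_bilinear[OF bounded_bilinear_mult] assms differentiable_upto_const)
    show "f' x * v = dird v f x" if "x \<in> S" for x
      using dird_eqI[OF d[OF that]] by simp
  qed
  then show ?thesis using d by (auto simp: differentiable_upto_Suc intro: differentiableI)
qed

text \<open>General in the exponent because differentiation lowers it by one. Square roots and
  reciprocals are the exponents 1/2 and -1.\<close>

lemma differentiable_upto_powr: "differentiable_upto k {0<..} (\<lambda>x::real. x powr a)"
proof (induction k arbitrary: a)
  case 0
  then show ?case by (auto intro!: continuous_intros)
next
  case (Suc k)
  show ?case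
  proof (rule differentiable_upto_real)
    show "((\<lambda>x. x powr a) has_real_derivative a * x powr (a - 1)) (at x)" if "x \<in> {0<..}" for x
      using that by (auto intro: has_real_derivative_powr)
  qed (use Suc in \<open>auto intro!: differentiable_upto_bilinear[OF bounded_bilinear_mult] differentiable_upto_const\<close>)
qed

lemma differentiable_upto_sin_cos: "differentiable_upto k UNIV (sin :: real \<Rightarrow> real) \<and>
    differentiable_upto k UNIV (cos :: real \<Rightarrow> real)"
proof (induction k)
  case 0
  then show ?case by (auto intro!: continuous_intros)
next
  case (Suc k)
  have "differentiable_upto k UNIV (\<lambda>x::real. - sin x)"
    using Suc by (intro differentiable_upto_linear[of "\<lambda>x. - x"] bounded_linear_minus bounded_linear_ident) auto
  then show ?case
    using Suc DERIV_sin DERIV_cos differentiable_upto_real[of UNIV sin cos k]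
      differentiable_upto_real[of UNIV cos "\<lambda>x. - sin x" k] by auto
qed

section \<open>Closure properties of smooth maps\<close>

lemma smooth_on_imp_upto: "smooth_on S f \<Longrightarrow> differentiable_upto k S f"
  by (simp add: smooth_on_def)

lemma smooth_on_cong: "open S \<Longrightarrow> (\<And>x. x \<in> S \<Longrightarrow> f x = g x) \<Longrightarrow> smooth_on S f \<Longrightarrow> smooth_on S g"
  using differentiable_upto_cong unfolding smooth_on_def by blast

lemma smooth_on_subset: "smooth_on S f \<Longrightarrow> T \<subseteq> S \<Longrightarrow> smooth_on T f"
  using differentiable_upto_subset unfolding smooth_on_def by blast

lemma smooth_on_local:
  assumes "\<And>x. x \<in> S \<Longrightarrow> \<exists>T. open T \<and> x \<in> T \<and> smooth_on T f"
  shows "smooth_on S f"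
  unfolding smooth_on_def
proof
  fix k show "differentiable_upto k S f"
    by (rule differentiable_upto_local) (use assms in \<open>fastforce simp: smooth_on_def\<close>)
qed

lemma smooth_on_const: "smooth_on S (\<lambda>x. c)"
  by (simp add: smooth_on_def differentiable_upto_const)

lemma smooth_on_add: "open S \<Longrightarrow> smooth_on S f \<Longrightarrow> smooth_on S g \<Longrightarrow> smooth_on S (\<lambda>x. f x + g x)"
  by (simp add: smooth_on_def differentiable_upto_add)

lemma smooth_on_linear: "bounded_linear L \<Longrightarrow> open S \<Longrightarrow> smooth_on S f \<Longrightarrow> smooth_on S (\<lambda>x. L (f x))"
  by (simp add: smooth_on_def differentiable_upto_linear)

lemma smooth_on_bilinear:
  "bounded_bilinear bop \<Longrightarrow> open S \<Longrightarrow> smooth_on S f \<Longrightarrow> smooth_on S g \<Longrightarrow> smooth_on S (\<lambda>x. bop (f x) (g x))"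
  by (simp add: smooth_on_def differentiable_upto_bilinear)

lemmas smooth_on_mult = smooth_on_bilinear[OF bounded_bilinear_mult]
lemmas smooth_on_scaleR = smooth_on_bilinear[OF bounded_bilinear_scaleR]
lemmas smooth_on_inner = smooth_on_bilinear[OF bounded_bilinear_inner]

lemma smooth_on_minus: "open S \<Longrightarrow> smooth_on S f \<Longrightarrow> smooth_on S (\<lambda>x. - f x)"
  by (rule smooth_on_linear[OF bounded_linear_minus[OF bounded_linear_ident]])

lemma smooth_on_diff: "open S \<Longrightarrow> smooth_on S f \<Longrightarrow> smooth_on S g \<Longrightarrow> smooth_on S (\<lambda>x. f x - g x)"
  using smooth_on_add[OF _ _ smooth_on_minus, of S f g] by simp

lemma smooth_on_sum:
  "open S \<Longrightarrow> (\<And>i. i \<in> I \<Longrightarrow> smooth_on S (f i)) \<Longrightarrow> smooth_on S (\<lambda>x. \<Sum>i\<in>I. f i x)"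
  by (simp add: smooth_on_def differentiable_upto_sum)

lemma smooth_on_prod:
  fixes f :: "'i \<Rightarrow> 'a::real_normed_vector \<Rightarrow> real"
  assumes "open S" "\<And>i. i \<in> I \<Longrightarrow> smooth_on S (f i)"
  shows "smooth_on S (\<lambda>x. \<Prod>i\<in>I. f i x)"
  using assms(2)
  by (induction I rule: infinite_finite_induct) (auto intro!: smooth_on_const smooth_on_mult assms(1))

lemma smooth_on_compose:
  fixes g :: "'a::real_normed_vector \<Rightarrow> 'b::euclidean_space"
  shows "open S \<Longrightarrow> open T \<Longrightarrow> g ` S \<subseteq> T \<Longrightarrow> smooth_on T f \<Longrightarrow> smooth_on S g \<Longrightarrow> smooth_on S (\<lambda>x. f (g x))"
  by (simp add: smooth_on_def differentiable_upto_compose)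

lemma smooth_on_dird: "smooth_on S f \<Longrightarrow> smooth_on S (dird v f)"
  unfolding smooth_on_def using differentiable_upto_Suc by blast

lemma smooth_on_differentiable: "smooth_on S f \<Longrightarrow> x \<in> S \<Longrightarrow> f differentiable (at x)"
  unfolding smooth_on_def using differentiable_upto_Suc by blast

lemma smooth_on_continuous: "smooth_on S f \<Longrightarrow> continuous_on S f"
  unfolding smooth_on_def by (metis differentiable_upto.simps(1))

lemma smooth_on_has_derivative:
  "smooth_on S f \<Longrightarrow> x \<in> S \<Longrightarrow> (f has_derivative (\<lambda>v. dird v f x)) (at x)"
  using dird_works smooth_on_differentiable by blast

lemma dird_bounded_linear:
  assumes "bounded_linear L" shows "dird v L = (\<lambda>x. L v)"
  using dird_eqI[OF bounded_linear.has_derivative[OF assms has_derivative_ident]] by auto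

lemma smooth_on_bounded_linear:
  assumes "bounded_linear L" shows "smooth_on S L"
  unfolding smooth_on_def
proof
  fix k show "differentiable_upto k S L"
    by (cases k) (use assms in \<open>auto simp: differentiable_upto_Suc dird_bounded_linear
        differentiable_upto_const bounded_linear_imp_differentiable
        intro: linear_continuous_on\<close>)
qed

lemma smooth_on_powr:
  assumes "open S" "smooth_on S f" "\<And>x. x \<in> S \<Longrightarrow> f x > (0::real)"
  shows "smooth_on S (\<lambda>x. f x powr a)"
  by (rule smooth_on_compose[where T="{0<..}"])
    (use assms in \<open>auto simp: smooth_on_def differentiable_upto_powr\<close>)

lemma smooth_on_sqrt:
  assumes "open S" "smooth_on S f" "\<And>x. x \<in> S \<Longrightarrow> f x > (0::real)"
  shows "smooth_on S (\<lambda>x. sqrt (f x))"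
  by (rule smooth_on_cong[OF assms(1) _ smooth_on_powr[OF assms, of "1/2"]])
    (use assms(3) in \<open>auto simp: powr_half_sqrt less_imp_le\<close>)

lemma smooth_on_inverse:
  assumes "open S" "smooth_on S f" "\<And>x. x \<in> S \<Longrightarrow> f x > (0::real)"
  shows "smooth_on S (\<lambda>x. inverse (f x))"
  by (rule smooth_on_cong[OF assms(1) _ smooth_on_powr[OF assms, of "-1"]])
    (use assms(3) in \<open>auto simp: powr_minus less_imp_le\<close>)

lemma smooth_on_divide:
  assumes "open S" "smooth_on S g" "smooth_on S f" "\<And>x. x \<in> S \<Longrightarrow> f x > (0::real)"
  shows "smooth_on S (\<lambda>x. g x / f x)"
  using smooth_on_mult[OF assms(1,2) smooth_on_inverse[OF assms(1,3,4)]]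
  by (simp add: divide_inverse)

lemma smooth_on_vec_nth: "open S \<Longrightarrow> smooth_on S f \<Longrightarrow> smooth_on S (\<lambda>x. f x $ i)"
  by (rule smooth_on_linear[OF bounded_linear_vec_nth])

lemma smooth_on_vec:
  fixes f :: "'i::finite \<Rightarrow> 'a::real_normed_vector \<Rightarrow> 'b::euclidean_space"
  assumes "open S" "\<And>i. smooth_on S (f i)"
  shows "smooth_on S (\<lambda>x. \<chi> i. f i x)"
proof -
  have "(\<chi> i. f i x) = (\<Sum>i\<in>UNIV. axis i (f i x))" for x
    by (simp add: vec_eq_iff axis_def if_distrib cong: if_cong)
  moreover have "smooth_on S (\<lambda>x. axis i (f i x))" for i
    by (rule smooth_on_linear[OF _ assms])
      (intro linear_conv_bounded_linear[THEN iffD1] linearI, auto simp: axis_def vec_eq_iff)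
  ultimately show ?thesis using smooth_on_sum[OF assms(1), of UNIV "\<lambda>i x. axis i (f i x)"] by simp
qed

text \<open>The mean value theorem twice: for the increment by \<open>h w\<close> as a function
  along \<open>v\<close>, then for \<open>dird v f\<close> along \<open>w\<close>. The second
  difference is symmetric in \<open>v\<close> and \<open>w\<close>, so exchanging them produces the
  other mixed derivative at another nearby point.\<close>

lemma second_difference_mvt:
  fixes f :: "'a::real_normed_vector \<Rightarrow> real"
  assumes "open S" "differentiable_upto 2 S f" "h > 0"
    and S: "cball x (h * (norm v + norm w)) \<subseteq> S"
  shows "\<exists>y \<in> cball x (h * (norm v + norm w)).
    f (x + h *\<^sub>R v + h *\<^sub>R w) - f (x + h *\<^sub>R v) - f (x + h *\<^sub>R w) + f x = h\<^sup>2 * dird w (dird v f) y"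
proof -
  have in_ball: "x + s *\<^sub>R v + t *\<^sub>R w \<in> cball x (h * (norm v + norm w))"
    if "0 \<le> s" "s \<le> h" "0 \<le> t" "t \<le> h" for s t
  proof -
    have "norm (s *\<^sub>R v + t *\<^sub>R w) \<le> s * norm v + t * norm w"
      using norm_triangle_ineq[of "s *\<^sub>R v" "t *\<^sub>R w"] that by simp
    also have "\<dots> \<le> h * norm v + h * norm w"
      by (intro add_mono mult_right_mono that) auto
    finally show ?thesis
      by (simp add: dist_norm algebra_simps norm_minus_commute)
  qed
  note inS = subsetD[OF S in_ball]
  have df: "f differentiable (at y)" "dird v f differentiable (at y)" if "y \<in> S" for y
    using assms(2) that by (auto simp: numeral_2_eq_2 differentiable_upto_Suc)
  have along: "((\<lambda>s. F (p + s *\<^sub>R u)) has_real_derivative dird u F (p + s *\<^sub>R u)) (at s)"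
    if "F differentiable (at (p + s *\<^sub>R u))" for F :: "'a \<Rightarrow> real" and p u s
  proof -
    have "((\<lambda>s. p + s *\<^sub>R u) has_derivative (\<lambda>s. s *\<^sub>R u)) (at s)"
      by (auto intro!: derivative_eq_intros)
    from has_derivative_compose[OF this dird_works[OF that]]
    show ?thesis
      using linear_scale[OF linear_dird[OF that]]
      by (simp add: has_field_derivative_def mult_commute_abs)
  qed
  define k where "k s = f ((x + h *\<^sub>R w) + s *\<^sub>R v) - f (x + s *\<^sub>R v)" for s
  have "\<exists>z>0. z < h \<and> k h - k 0 = (h - 0) * (dird v f (x + h *\<^sub>R w + z *\<^sub>R v) - dird v f (x + z *\<^sub>R v))"
  proof (rule MVT2[OF \<open>h > 0\<close>])
    fix s assume "0 \<le> s" "s \<le> h"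
    then show "(k has_real_derivative dird v f (x + h *\<^sub>R w + s *\<^sub>R v) - dird v f (x + s *\<^sub>R v)) (at s)"
      unfolding k_def using inS[of s h] inS[of s 0] \<open>h > 0\<close>
      by (intro DERIV_diff along df) (simp_all add: algebra_simps)
  qed
  then obtain z where z: "0 < z" "z < h"
    "k h - k 0 = h * (dird v f (x + h *\<^sub>R w + z *\<^sub>R v) - dird v f (x + z *\<^sub>R v))" by auto
  have "\<exists>t>0. t < h \<and> dird v f ((x + z *\<^sub>R v) + h *\<^sub>R w) - dird v f ((x + z *\<^sub>R v) + 0 *\<^sub>R w)
      = (h - 0) * dird w (dird v f) ((x + z *\<^sub>R v) + t *\<^sub>R w)"
    by (rule MVT2[OF \<open>h > 0\<close>]) (use inS z in \<open>auto intro!: along df\<close>)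
  then obtain t where t: "0 < t" "t < h"
    "dird v f (x + h *\<^sub>R w + z *\<^sub>R v) - dird v f (x + z *\<^sub>R v) = h * dird w (dird v f) ((x + z *\<^sub>R v) + t *\<^sub>R w)"
    by (auto simp: algebra_simps)
  show ?thesis
  proof (rule bexI[of _ "(x + z *\<^sub>R v) + t *\<^sub>R w"])
    show "f (x + h *\<^sub>R v + h *\<^sub>R w) - f (x + h *\<^sub>R v) - f (x + h *\<^sub>R w) + f x
        = h\<^sup>2 * dird w (dird v f) (x + z *\<^sub>R v + t *\<^sub>R w)"
      using z(3) t(3) by (simp add: k_def power2_eq_square algebra_simps)
  qed (use in_ball z t in auto)
qed

lemma dird_commute_real:
  fixes f :: "'a::real_normed_vector \<Rightarrow> real"
  assumes "open S" "differentiable_upto 2 S f" "x \<in> S"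
  shows "dird w (dird v f) x = dird v (dird w f) x"
proof (rule ccontr)
  assume ne: "dird w (dird v f) x \<noteq> dird v (dird w f) x"
  \<comment> \<open>Half the gap: two errors below \<open>e\<close> cannot bridge it.\<close>
  define e where "e = \<bar>dird w (dird v f) x - dird v (dird w f) x\<bar> / 2"
  have "e > 0" using ne by (simp add: e_def)
  have cont: "continuous (at x) (dird w (dird v f))" "continuous (at x) (dird v (dird w f))"
    using assms by (auto simp: numeral_2_eq_2 differentiable_upto_Suc continuous_on_eq_continuous_at)
  obtain d1 where d1: "d1 > 0" "\<And>y. dist y x < d1 \<Longrightarrow> dist (dird w (dird v f) y) (dird w (dird v f) x) < e"
    using cont(1) \<open>e > 0\<close> unfolding continuous_at_eps_delta by (metis dist_commute)
  obtain d2 where d2: "d2 > 0" "\<And>y. dist y x < d2 \<Longrightarrow> dist (dird v (dird w f) y) (dird v (dird w f) x) < e"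
    using cont(2) \<open>e > 0\<close> unfolding continuous_at_eps_delta by (metis dist_commute)
  obtain d3 where d3: "d3 > 0" "cball x d3 \<subseteq> S" using assms open_contains_cball by blast
  define m where "m = Min {d1 / 2, d2 / 2, d3}"
  \<comment> \<open>The summand 1 keeps the denominator positive when \<open>v\<close> and
    \<open>w\<close> both vanish.\<close>
  define h where "h = m / (norm v + norm w + 1)"
  have "m > 0" using d1 d2 d3 by (simp add: m_def)
  have "h > 0" unfolding h_def by (intro divide_pos_pos \<open>m > 0\<close>) (use norm_ge_zero[of v] norm_ge_zero[of w] in linarith)
  have "h * (norm v + norm w) \<le> h * (norm v + norm w + 1)" using \<open>h > 0\<close> by (intro mult_left_mono) auto
  also have "\<dots> = m" using norm_ge_zero[of v] norm_ge_zero[of w] by (simp add: h_def add_nonneg_eq_0_iff)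
  finally have hm: "h * (norm v + norm w) \<le> m" .
  have m: "m < d1" "m < d2" "m \<le> d3" using d1 d2 by (auto simp: m_def min_def)
  have S: "cball x (h * (norm v + norm w)) \<subseteq> S" "cball x (h * (norm w + norm v)) \<subseteq> S"
    using d3(2) hm m(3) subset_cball[of "h * (norm v + norm w)" d3 x] by (auto simp: add.commute)
  from second_difference_mvt[OF assms(1,2) \<open>h > 0\<close> S(1)] obtain y where
    y: "dist y x \<le> m" "f (x + h *\<^sub>R v + h *\<^sub>R w) - f (x + h *\<^sub>R v) - f (x + h *\<^sub>R w) + f x = h\<^sup>2 * dird w (dird v f) y"
    using hm by (metis dist_commute mem_cball order_trans)
  from second_difference_mvt[OF assms(1,2) \<open>h > 0\<close> S(2)] obtain z where
    z: "dist z x \<le> m" "f (x + h *\<^sub>R w + h *\<^sub>R v) - f (x + h *\<^sub>R w) - f (x + h *\<^sub>R v) + f x = h\<^sup>2 * dird v (dird w f) z"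
    using hm by (metis add.commute[of "norm w"] dist_commute mem_cball order_trans)
  have "h\<^sup>2 * dird w (dird v f) y = h\<^sup>2 * dird v (dird w f) z"
    unfolding y(2)[symmetric] z(2)[symmetric] by (simp add: algebra_simps)
  then have "dird w (dird v f) y = dird v (dird w f) z" using \<open>h > 0\<close> by simp
  moreover have "dist (dird w (dird v f) y) (dird w (dird v f) x) < e" using d1 y m by auto
  moreover have "dist (dird v (dird w f) z) (dird v (dird w f) x) < e" using d2 z m by auto
  ultimately show False unfolding e_def dist_real_def by (auto simp: abs_if split: if_splits)
qed

lemma dird_linear:
  assumes "bounded_linear L" "f differentiable (at x)"
  shows "dird v (\<lambda>x. L (f x)) x = L (dird v f x)"
  by (rule dird_eqI) (rule bounded_linear.has_derivative[OF assms(1) dird_works[OF assms(2)]])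

lemma dird_commute:
  fixes f :: "'a::real_normed_vector \<Rightarrow> 'b::euclidean_space"
  assumes "open S" "smooth_on S f" "x \<in> S"
  shows "dird w (dird v f) x = dird v (dird w f) x"
proof (rule euclidean_eqI)
  fix b :: 'b assume "b \<in> Basis"
  let ?L = "\<lambda>y::'b. y \<bullet> b"
  have L: "bounded_linear ?L" by (rule bounded_linear_inner_left)
  have 1: "dird v (\<lambda>x. ?L (f x)) y = ?L (dird v f y)" if "y \<in> S" for y v
    by (rule dird_linear[OF L]) (use assms(2) that smooth_on_differentiable in blast)
  have 2: "dird w (dird v (\<lambda>x. ?L (f x))) x = ?L (dird w (dird v f) x)" for v w
  proof -
    have "dird w (dird v (\<lambda>x. ?L (f x))) x = dird w (\<lambda>x. ?L (dird v f x)) x"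
      by (rule dird_cong_open[OF assms(1,3)]) (rule 1)
    also have "\<dots> = ?L (dird w (dird v f) x)"
      by (rule dird_linear[OF L]) (use assms smooth_on_dird smooth_on_differentiable in blast)
    finally show ?thesis .
  qed
  have "dird w (dird v (\<lambda>x. ?L (f x))) x = dird v (dird w (\<lambda>x. ?L (f x))) x"
    by (rule dird_commute_real[OF assms(1) smooth_on_imp_upto[OF smooth_on_linear[OF L assms(1,2)]] assms(3)])
  then show "dird w (dird v f) x \<bullet> b = dird v (dird w f) x \<bullet> b" unfolding 2 .
qed

section \<open>The Levi-Civita connection along a map\<close>

lemma bounded_bilinear_matrix_vector:
  "bounded_bilinear ((*v) :: real^'n^'m \<Rightarrow> real^'n \<Rightarrow> real^'m)"
  unfolding bilinear_conv_bounded_bilinear[symmetric] bilinear_def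
  by (auto intro!: linearI simp: matrix_vector_right_distrib matrix_vector_mult_add_rdistrib
      scaleR_matrix_vector_assoc[symmetric] matrix_vector_mult_scaleR)

lemma sum_swap3: "(\<Sum>a\<in>A. \<Sum>b\<in>B. \<Sum>c\<in>C. f a b c) = (\<Sum>c\<in>C. \<Sum>a\<in>A. \<Sum>b\<in>B. f a b c)"
proof -
  have "(\<Sum>a\<in>A. \<Sum>b\<in>B. \<Sum>c\<in>C. f a b c) = (\<Sum>a\<in>A. \<Sum>c\<in>C. \<Sum>b\<in>B. f a b c)"
    by (rule sum.cong[OF refl], rule sum.swap)
  also have "\<dots> = (\<Sum>c\<in>C. \<Sum>a\<in>A. \<Sum>b\<in>B. f a b c)" by (rule sum.swap)
  finally show ?thesis .
qed

lemma smooth_on_det: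
  fixes A :: "'b::real_normed_vector \<Rightarrow> real^'m^'m"
  assumes "open S" "\<And>i j. smooth_on S (\<lambda>x. A x $ i $ j)"
  shows "smooth_on S (\<lambda>x. det (A x))"
  unfolding det_def
  by (intro smooth_on_sum smooth_on_mult smooth_on_prod smooth_on_const assms)

locale metric_chart =
  fixes g :: "('a, 'n::finite) metric" and c :: "('a, 'n) chart" and U :: "(real^'n) set"
  assumes open_U: "open U" and smooth_g: "smooth_on U (g c)"
    and sym_g: "x \<in> U \<Longrightarrow> transpose (g c x) = g c x"
    and pos_g: "x \<in> U \<Longrightarrow> v \<noteq> 0 \<Longrightarrow> ginner g c x v v > 0"
begin

definition Gam :: "real^'n \<Rightarrow> real^'n \<Rightarrow> real^'n \<Rightarrow> real^'n" where
  "Gam x v w = (\<chi> k. \<Sum>a\<in>UNIV. \<Sum>b\<in>UNIV. christoffel g c k a b x * v $ a * w $ b)"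

text \<open>The derivative of the metric as a trilinear form, direction of differentiation first.
  With \<open>Gam\<close> and \<open>dg\<close> the calculations run on vectors instead of
  indices.\<close>

definition dg :: "real^'n \<Rightarrow> real^'n \<Rightarrow> real^'n \<Rightarrow> real^'n \<Rightarrow> real" where
  "dg x v w z = w \<bullet> (dird v (g c) x *v z)"

lemma ginner_commute: "x \<in> U \<Longrightarrow> ginner g c x v w = ginner g c x w v"
  unfolding ginner_def using sym_g[of x] by (metis dot_lmul_matrix inner_commute transpose_matrix_vector)

lemma ginner_linear [simp]:
  "ginner g c x (v + v') w = ginner g c x v w + ginner g c x v' w"
  "ginner g c x (v - v') w = ginner g c x v w - ginner g c x v' w"
  "ginner g c x (r *\<^sub>R v) w = r * ginner g c x v w"
  "ginner g c x v (w + w') = ginner g c x v w + ginner g c x v w'"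
  "ginner g c x v (w - w') = ginner g c x v w - ginner g c x v w'"
  "ginner g c x v (r *\<^sub>R w) = r * ginner g c x v w"
  "ginner g c x 0 w = 0" "ginner g c x v 0 = 0"
  by (auto simp: ginner_def inner_add_left inner_diff_left inner_add_right inner_diff_right
      matrix_vector_right_distrib matrix_vector_mult_diff_distrib matrix_vector_mult_scaleR)

lemma Gam_linear [simp]:
  "Gam x (v + v') w = Gam x v w + Gam x v' w"
  "Gam x v (w + w') = Gam x v w + Gam x v w'"
  "Gam x (r *\<^sub>R v) w = r *\<^sub>R Gam x v w"
  "Gam x v (r *\<^sub>R w) = r *\<^sub>R Gam x v w"
  by (simp_all add: Gam_def vec_eq_iff distrib_left distrib_right sum.distrib sum_distrib_left mult_ac)

lemma differentiable_g: "x \<in> U \<Longrightarrow> g c differentiable (at x)"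
  using smooth_g smooth_on_differentiable by blast

lemma pderiv_at_g:
  assumes "x \<in> U"
  shows "pderiv_at i (\<lambda>y. g c y $ j $ l) x = dird (axis i 1) (g c) x $ j $ l"
proof -
  have "bounded_linear (\<lambda>m::real^'n^'n. m $ j $ l)"
    using bounded_linear_compose[OF bounded_linear_vec_nth bounded_linear_vec_nth] .
  then show ?thesis
    unfolding pderiv_at_eq_dird by (rule dird_linear[OF _ differentiable_g[OF assms]])
qed

lemma sym_g_nth: "x \<in> U \<Longrightarrow> g c x $ i $ j = g c x $ j $ i"
  using arg_cong[OF sym_g, of x "\<lambda>m. m $ j $ i"] by (simp add: transpose_def)

lemma dird_g_sym:
  assumes "x \<in> U" shows "dird v (g c) x $ i $ j = dird v (g c) x $ j $ i"
proof -
  have L: "bounded_linear (\<lambda>m::real^'n^'n. m $ j $ l)" for j l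
    using bounded_linear_compose[OF bounded_linear_vec_nth bounded_linear_vec_nth] .
  have "dird v (\<lambda>y. g c y $ i $ j) x = dird v (\<lambda>y. g c y $ j $ i) x"
    by (rule dird_cong_open[OF open_U assms]) (rule sym_g_nth)
  then show ?thesis using dird_linear[OF L differentiable_g[OF assms]] by simp
qed

lemma dg_expand:
  assumes "x \<in> U"
  shows "dg x v w z = (\<Sum>a\<in>UNIV. \<Sum>b\<in>UNIV. \<Sum>m\<in>UNIV. v $ a * w $ b * z $ m * dird (axis a 1) (g c) x $ b $ m)"
proof -
  have "dird v (g c) x = (\<Sum>a\<in>UNIV. v $ a *\<^sub>R dird (axis a 1) (g c) x)"
    using linear_sum[OF linear_dird[OF differentiable_g[OF assms]], of "\<lambda>a. v $ a *\<^sub>R axis a 1" UNIV]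
      linear_scale[OF linear_dird[OF differentiable_g[OF assms]]] basis_expansion[of v]
    by (simp add: scalar_mult_eq_scaleR)
  then have "dg x v w z = (\<Sum>b\<in>UNIV. \<Sum>m\<in>UNIV. \<Sum>a\<in>UNIV. v $ a * w $ b * z $ m * dird (axis a 1) (g c) x $ b $ m)"
    by (simp add: dg_def inner_vec_def matrix_vector_mult_def sum_distrib_left sum_distrib_right mult_ac)
  also have "\<dots> = (\<Sum>a\<in>UNIV. \<Sum>b\<in>UNIV. \<Sum>m\<in>UNIV. v $ a * w $ b * z $ m * dird (axis a 1) (g c) x $ b $ m)"
    by (rule sum_swap3)
  finally show ?thesis .
qed

lemma dg_sym: "x \<in> U \<Longrightarrow> dg x v w z = dg x v z w"
  unfolding dg_def inner_vec_def matrix_vector_mult_def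
  by (simp add: sum_distrib_left, subst sum.swap) (simp add: mult_ac dird_g_sym[of x])

lemma g_invertible:
  assumes "x \<in> U"
  shows "invertible (g c x)" "det (g c x) \<noteq> 0" "matrix_inv (g c x) ** g c x = mat 1"
    "g c x ** matrix_inv (g c x) = mat 1"
proof -
  have "v = 0" if "g c x *v v = 0" for v
    using pos_g[OF assms, of v] that by (auto simp: ginner_def)
  then obtain B where "B ** g c x = mat 1"
    using matrix_left_invertible_ker[of "g c x"] by blast
  then have B: "g c x ** B = mat 1 \<and> B ** g c x = mat 1" by (simp add: matrix_left_right_inverse)
  then show "invertible (g c x)" by (auto simp: invertible_def)
  then show "det (g c x) \<noteq> 0" by (simp add: invertible_det_nz)
  show "matrix_inv (g c x) ** g c x = mat 1" "g c x ** matrix_inv (g c x) = mat 1"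
    using someI[of "\<lambda>B. g c x ** B = mat 1 \<and> B ** g c x = mat 1", OF B] by (auto simp: matrix_inv_def)
qed

text \<open>Koszul's formula for coordinate fields: lowering the index cancels the inverse matrix in
  the Christoffel symbols.\<close>

lemma ginner_Gam:
  assumes "x \<in> U"
  shows "ginner g c x (Gam x v w) z = (dg x v w z + dg x w v z - dg x z v w) / 2"
proof -
  define T where "T a b m = dird (axis a 1) (g c) x $ b $ m" for a b m
  \<comment> \<open>The Christoffel symbols of the first kind, contracted with \<open>v\<close> and
    \<open>w\<close>.\<close>
  define K :: "real^'n" where
    "K = (\<chi> m. (\<Sum>a\<in>UNIV. \<Sum>b\<in>UNIV. (1/2) * (T a b m + T b a m - T m a b) * v $ a * w $ b))"
  have "Gam x v w = matrix_inv (g c x) *v K"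
  proof -
    have "Gam x v w $ k = (\<Sum>a\<in>UNIV. \<Sum>b\<in>UNIV. \<Sum>l\<in>UNIV. matrix_inv (g c x) $ k $ l *
        ((1/2) * (T a b l + T b a l - T l a b) * v $ a * w $ b))" for k
      unfolding Gam_def christoffel_def pderiv_at_g[OF assms] T_def[symmetric]
      by (simp add: sum_distrib_left sum_distrib_right mult_ac)
    also have "\<dots> k = (\<Sum>l\<in>UNIV. \<Sum>a\<in>UNIV. \<Sum>b\<in>UNIV. matrix_inv (g c x) $ k $ l *
        ((1/2) * (T a b l + T b a l - T l a b) * v $ a * w $ b))" for k
      by (rule sum_swap3)
    also have "\<dots> k = (matrix_inv (g c x) *v K) $ k" for k
      by (simp add: K_def matrix_vector_mult_def sum_distrib_left)
    finally show ?thesis by (simp add: vec_eq_iff)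
  qed
  then have "g c x *v Gam x v w = K"
    by (simp add: matrix_vector_mul_assoc g_invertible[OF assms])
  then have "ginner g c x (Gam x v w) z = z \<bullet> K"
    by (simp add: ginner_commute[OF assms, of "Gam x v w"] ginner_def[of g c x z])
  also have "\<dots> = (\<Sum>m\<in>UNIV. \<Sum>a\<in>UNIV. \<Sum>b\<in>UNIV. (1/2) * (T a b m + T b a m - T m a b) * v $ a * w $ b * z $ m)"
    by (simp add: K_def inner_vec_def sum_distrib_left mult_ac)
  also have "\<dots> = (1/2) * ((\<Sum>m\<in>UNIV. \<Sum>a\<in>UNIV. \<Sum>b\<in>UNIV. v $ a * w $ b * z $ m * T a b m)
     + (\<Sum>m\<in>UNIV. \<Sum>a\<in>UNIV. \<Sum>b\<in>UNIV. v $ a * w $ b * z $ m * T b a m)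
     - (\<Sum>m\<in>UNIV. \<Sum>a\<in>UNIV. \<Sum>b\<in>UNIV. v $ a * w $ b * z $ m * T m a b))"
    unfolding sum_distrib_left sum.distrib[symmetric] sum_subtractf[symmetric]
    by (intro sum.cong refl) (simp add: algebra_simps)
  also have "(\<Sum>m\<in>UNIV. \<Sum>a\<in>UNIV. \<Sum>b\<in>UNIV. v $ a * w $ b * z $ m * T a b m) = dg x v w z"
    unfolding dg_expand[OF assms] T_def by (rule sum_swap3[symmetric])
  also have "(\<Sum>m\<in>UNIV. \<Sum>a\<in>UNIV. \<Sum>b\<in>UNIV. v $ a * w $ b * z $ m * T b a m) = dg x w v z"
  proof -
    have "dg x w v z = (\<Sum>m\<in>UNIV. \<Sum>a\<in>UNIV. \<Sum>b\<in>UNIV. w $ a * v $ b * z $ m * T a b m)"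
      unfolding dg_expand[OF assms] T_def by (rule sum_swap3)
    also have "\<dots> = (\<Sum>m\<in>UNIV. \<Sum>b\<in>UNIV. \<Sum>a\<in>UNIV. w $ a * v $ b * z $ m * T a b m)"
      by (rule sum.cong[OF refl], rule sum.swap)
    finally show ?thesis by (simp add: mult_ac)
  qed
  also have "(\<Sum>m\<in>UNIV. \<Sum>a\<in>UNIV. \<Sum>b\<in>UNIV. v $ a * w $ b * z $ m * T m a b) = dg x z v w"
    unfolding dg_expand[OF assms] T_def by (simp add: mult_ac)
  finally show ?thesis by simp
qed

text \<open>Compatibility of the connection with the metric. In the sum of two Koszul formulas the
  derivatives in the directions \<open>w\<close> and \<open>z\<close> cancel.\<close>

lemma ginner_Gam_compat:
  assumes "x \<in> U"
  shows "dg x v w z = ginner g c x (Gam x v w) z + ginner g c x w (Gam x v z)"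
  unfolding ginner_commute[OF assms, of w] ginner_Gam[OF assms]
  using dg_sym[OF assms] by (simp add: field_simps)

lemma christoffel_sym:
  assumes "x \<in> U" shows "christoffel g c k i j x = christoffel g c k j i x"
proof -
  have "pderiv_at l (\<lambda>y. g c y $ i $ j) x = pderiv_at l (\<lambda>y. g c y $ j $ i) x" for l
    unfolding pderiv_at_g[OF assms] by (rule dird_g_sym[OF assms])
  then show ?thesis by (simp add: christoffel_def add_ac)
qed

lemma Gam_sym: "x \<in> U \<Longrightarrow> Gam x v w = Gam x w v"
  by (simp add: Gam_def vec_eq_iff christoffel_sym[of x] mult_ac)
     (subst sum.swap, simp add: christoffel_sym[of x] mult_ac)

lemma smooth_g_nth: "smooth_on U (\<lambda>x. g c x $ i $ j)"
  by (intro smooth_on_vec_nth open_U smooth_g)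

text \<open>Exhibits the entries of the inverse as rational functions of the entries of the metric,
  which is how their smoothness is obtained.\<close>

lemma matrix_inv_cramer:
  assumes "x \<in> U"
  shows "matrix_inv (g c x) $ k $ l = det (\<chi> i j. if j = k then axis l 1 $ i else g c x $ i $ j) / det (g c x)"
proof -
  have "g c x *v (matrix_inv (g c x) *v axis l 1) = axis l 1"
    by (simp add: matrix_vector_mul_assoc g_invertible[OF assms])
  then have "matrix_inv (g c x) *v axis l 1 = (\<chi> k. det (\<chi> i j. if j = k then axis l 1 $ i else g c x $ i $ j) / det (g c x))"
    using cramer[OF g_invertible(2)[OF assms]] by blast
  then have "(matrix_inv (g c x) *v axis l 1) $ k = det (\<chi> i j. if j = k then axis l 1 $ i else g c x $ i $ j) / det (g c x)"
    by simp
  then show ?thesis by (simp add: matrix_vector_mult_def axis_def if_distrib cong: if_cong)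
qed

lemma smooth_matrix_inv: "smooth_on U (\<lambda>x. matrix_inv (g c x) $ k $ l)"
proof -
  have "smooth_on U (\<lambda>x. det (\<chi> i j. if j = k then axis l 1 $ i else g c x $ i $ j))"
  proof (rule smooth_on_det[OF open_U])
    show "smooth_on U (\<lambda>x. (\<chi> i j. if j = k then axis l 1 $ i else g c x $ i $ j) $ i $ j)" for i j
      by (cases "j = k") (auto intro: smooth_on_const smooth_g_nth)
  qed
  \<comment> \<open>\<open>smooth_on_inverse\<close> asks for a positive function, and of the
    determinant only non-vanishing has been shown; so \<open>1 / det\<close> is treated as
    \<open>det / det^2\<close>.\<close>
  moreover have "smooth_on U (\<lambda>x. inverse (det (g c x) * det (g c x)))"
    using g_invertible(2) by (intro smooth_on_inverse smooth_on_mult smooth_on_det open_U smooth_g_nth)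
      (auto simp: zero_less_mult_iff linorder_neq_iff)
  ultimately have s: "smooth_on U (\<lambda>x. det (\<chi> i j. if j = k then axis l 1 $ i else g c x $ i $ j) *
      (det (g c x) * inverse (det (g c x) * det (g c x))))"
    using smooth_on_mult[OF open_U _ smooth_on_mult[OF open_U smooth_on_det[OF open_U smooth_g_nth]]] by blast
  show ?thesis
    by (rule smooth_on_cong[OF open_U _ s])
      (simp add: matrix_inv_cramer g_invertible(2) field_simps)
qed

lemma smooth_christoffel: "smooth_on U (christoffel g c k i j)"
  unfolding christoffel_def[abs_def] pderiv_at_eq_dird
  by (intro smooth_on_mult smooth_on_const smooth_on_sum smooth_on_diff smooth_on_add open_U
      smooth_matrix_inv smooth_on_dird smooth_g_nth)

lemma differentiable_christoffel: "x \<in> U \<Longrightarrow> christoffel g c k i j differentiable (at x)"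
  using smooth_christoffel smooth_on_differentiable by blast

section \<open>Covariant differentiation along a map, and its commutator\<close>

definition dGam :: "real^'n \<Rightarrow> real^'n \<Rightarrow> real^'n \<Rightarrow> real^'n \<Rightarrow> real^'n" where
  "dGam x u v w = (\<chi> k. \<Sum>a\<in>UNIV. \<Sum>b\<in>UNIV. dird u (christoffel g c k a b) x * v $ a * w $ b)"

text \<open>The pull-back of the Levi-Civita connection by \<Phi>: \<open>W\<close> is a vector
  field along \<Phi>, so neither \<Phi> nor its differential has to be injective, and
  \<open>W\<close> need not extend to the target.\<close>

definition covd ::
    "('b::real_normed_vector \<Rightarrow> real^'n) \<Rightarrow> 'b \<Rightarrow> ('b \<Rightarrow> real^'n) \<Rightarrow> 'b \<Rightarrow> real^'n" where
  "covd \<Phi> a W x = dird a W x + Gam (\<Phi> x) (dird a \<Phi> x) (W x)"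

lemma dird_ginner:
  assumes "\<Phi> x \<in> U" "\<Phi> differentiable (at x)" "W differentiable (at x)" "Z differentiable (at x)"
  shows "dird a (\<lambda>x. ginner g c (\<Phi> x) (W x) (Z x)) x =
    ginner g c (\<Phi> x) (covd \<Phi> a W x) (Z x) + ginner g c (\<Phi> x) (W x) (covd \<Phi> a Z x)"
proof -
  note dW = dird_works[OF assms(3)] and dZ = dird_works[OF assms(4)]
  have dP: "((\<lambda>x. g c (\<Phi> x)) has_derivative (\<lambda>v. dird (dird v \<Phi> x) (g c) (\<Phi> x))) (at x)"
    by (rule has_derivative_compose[OF dird_works[OF assms(2)] dird_works[OF differentiable_g[OF assms(1)]]])
  have "dird a (\<lambda>x. ginner g c (\<Phi> x) (W x) (Z x)) x =
      W x \<bullet> (g c (\<Phi> x) *v dird a Z x + dird (dird a \<Phi> x) (g c) (\<Phi> x) *v Z x) + dird a W x \<bullet> (g c (\<Phi> x) *v Z x)"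
    unfolding ginner_def
    by (rule dird_eqI)
      (rule bounded_bilinear.FDERIV[OF bounded_bilinear_inner dW
        bounded_bilinear.FDERIV[OF bounded_bilinear_matrix_vector dP dZ]])
  also have "\<dots> = ginner g c (\<Phi> x) (dird a W x) (Z x) + ginner g c (\<Phi> x) (W x) (dird a Z x)
      + dg (\<Phi> x) (dird a \<Phi> x) (W x) (Z x)"
    by (simp add: ginner_def dg_def inner_add_right)
  also have "\<dots> = ginner g c (\<Phi> x) (covd \<Phi> a W x) (Z x) + ginner g c (\<Phi> x) (W x) (covd \<Phi> a Z x)"
    unfolding ginner_Gam_compat[OF assms(1)] covd_def by simp
  finally show ?thesis .
qed

lemma dird_Gam:
  assumes "\<Phi> x \<in> U" "\<Phi> differentiable (at x)" "X differentiable (at x)" "W differentiable (at x)"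
  shows "dird a (\<lambda>x. Gam (\<Phi> x) (X x) (W x)) x =
    dGam (\<Phi> x) (dird a \<Phi> x) (X x) (W x) + Gam (\<Phi> x) (dird a X x) (W x) + Gam (\<Phi> x) (X x) (dird a W x)"
    and "(\<lambda>x. Gam (\<Phi> x) (X x) (W x)) differentiable (at x)"
proof -
  have dC: "((\<lambda>x. christoffel g c k i j (\<Phi> x)) has_derivative
      (\<lambda>v. dird (dird v \<Phi> x) (christoffel g c k i j) (\<Phi> x))) (at x)" for k i j
    by (rule has_derivative_compose[OF dird_works[OF assms(2)] dird_works[OF differentiable_christoffel[OF assms(1)]]])
  have dX: "((\<lambda>x. X x $ i) has_derivative (\<lambda>v. dird v X x $ i)) (at x)" for i
    by (rule bounded_linear.has_derivative[OF bounded_linear_vec_nth dird_works[OF assms(3)]])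
  have dW: "((\<lambda>x. W x $ i) has_derivative (\<lambda>v. dird v W x $ i)) (at x)" for i
    by (rule bounded_linear.has_derivative[OF bounded_linear_vec_nth dird_works[OF assms(4)]])
  have eq: "Gam (\<Phi> x) (X x) (W x) = (\<Sum>k\<in>UNIV. (\<Sum>i\<in>UNIV. \<Sum>j\<in>UNIV.
      christoffel g c k i j (\<Phi> x) * X x $ i * W x $ j) *\<^sub>R axis k 1)" for x
    by (simp add: Gam_def vec_eq_iff axis_def if_distrib cong: if_cong)
  have D: "((\<lambda>x. Gam (\<Phi> x) (X x) (W x)) has_derivative (\<lambda>v. \<Sum>k\<in>UNIV. (\<Sum>i\<in>UNIV. \<Sum>j\<in>UNIV.
       christoffel g c k i j (\<Phi> x) * X x $ i * dird v W x $ j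
       + (christoffel g c k i j (\<Phi> x) * dird v X x $ i
           + dird (dird v \<Phi> x) (christoffel g c k i j) (\<Phi> x) * X x $ i) * W x $ j) *\<^sub>R axis k 1)) (at x)"
    unfolding eq
    by (intro has_derivative_sum has_derivative_scaleR_left has_derivative_mult dC dX dW)
  then show "(\<lambda>x. Gam (\<Phi> x) (X x) (W x)) differentiable (at x)" by (rule differentiableI)
  show "dird a (\<lambda>x. Gam (\<Phi> x) (X x) (W x)) x =
    dGam (\<Phi> x) (dird a \<Phi> x) (X x) (W x) + Gam (\<Phi> x) (dird a X x) (W x) + Gam (\<Phi> x) (X x) (dird a W x)"
    unfolding dird_eqI[OF D]
    by (simp add: Gam_def dGam_def vec_eq_iff axis_def if_distrib sum.distrib algebra_simps cong: if_cong)
qed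

text \<open>Links the index definition of curvature with the form in which it comes out of commuting
  covariant derivatives. Each of the four terms is brought to the summation order \<open>k\<close>,
  \<open>i\<close>, \<open>j\<close> of \<open>curvature_op\<close>.\<close>

lemma curvature_op_eq:
  assumes "y \<in> U"
  shows "curvature_op g c y v w z =
    dGam y v w z - dGam y w v z + Gam y v (Gam y w z) - Gam y w (Gam y v z)"
proof -
  have lin: "dird u (christoffel g c l j k) y = (\<Sum>i\<in>UNIV. u $ i * pderiv_at i (christoffel g c l j k) y)" for u l j k
    using linear_sum[OF linear_dird[OF differentiable_christoffel[OF assms]], of "\<lambda>a. u $ a *\<^sub>R axis a 1" UNIV l j k]
      linear_scale[OF linear_dird[OF differentiable_christoffel[OF assms]]] basis_expansion[of u]
    by (simp add: scalar_mult_eq_scaleR pderiv_at_eq_dird)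
  have 1: "dGam y v w z $ l = (\<Sum>k\<in>UNIV. \<Sum>i\<in>UNIV. \<Sum>j\<in>UNIV.
      pderiv_at i (christoffel g c l j k) y * z $ k * v $ i * w $ j)" for l
  proof -
    have "dGam y v w z $ l = (\<Sum>j\<in>UNIV. \<Sum>k\<in>UNIV. \<Sum>i\<in>UNIV. pderiv_at i (christoffel g c l j k) y * z $ k * v $ i * w $ j)"
      by (simp add: dGam_def lin sum_distrib_right sum_distrib_left mult_ac)
    also have "\<dots> = (\<Sum>k\<in>UNIV. \<Sum>i\<in>UNIV. \<Sum>j\<in>UNIV. pderiv_at i (christoffel g c l j k) y * z $ k * v $ i * w $ j)"
      by (rule sum_swap3[symmetric])
    finally show ?thesis .
  qed
  have 2: "dGam y w v z $ l = (\<Sum>k\<in>UNIV. \<Sum>i\<in>UNIV. \<Sum>j\<in>UNIV.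
      pderiv_at j (christoffel g c l i k) y * z $ k * v $ i * w $ j)" for l
  proof -
    have "dGam y w v z $ l = (\<Sum>i\<in>UNIV. \<Sum>k\<in>UNIV. \<Sum>j\<in>UNIV. pderiv_at j (christoffel g c l i k) y * z $ k * v $ i * w $ j)"
      by (simp add: dGam_def lin sum_distrib_right sum_distrib_left mult_ac)
    also have "\<dots> = (\<Sum>k\<in>UNIV. \<Sum>i\<in>UNIV. \<Sum>j\<in>UNIV. pderiv_at j (christoffel g c l i k) y * z $ k * v $ i * w $ j)"
      by (rule sum.swap)
    finally show ?thesis .
  qed
  have 3: "Gam y v (Gam y w z) $ l = (\<Sum>k\<in>UNIV. \<Sum>i\<in>UNIV. \<Sum>j\<in>UNIV.
      (\<Sum>m\<in>UNIV. christoffel g c l i m y * christoffel g c m j k y) * z $ k * v $ i * w $ j)" for l v w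
  proof -
    have "Gam y v (Gam y w z) $ l = (\<Sum>i\<in>UNIV. \<Sum>m\<in>UNIV. \<Sum>j\<in>UNIV. \<Sum>k\<in>UNIV.
        christoffel g c l i m y * christoffel g c m j k y * z $ k * v $ i * w $ j)"
      by (simp add: Gam_def sum_distrib_right sum_distrib_left mult_ac)
    also have "\<dots> = (\<Sum>i\<in>UNIV. \<Sum>j\<in>UNIV. \<Sum>k\<in>UNIV. \<Sum>m\<in>UNIV.
        christoffel g c l i m y * christoffel g c m j k y * z $ k * v $ i * w $ j)"
      by (rule sum.cong[OF refl]) (rule sum_swap3[symmetric])
    also have "\<dots> = (\<Sum>k\<in>UNIV. \<Sum>i\<in>UNIV. \<Sum>j\<in>UNIV. \<Sum>m\<in>UNIV.
        christoffel g c l i m y * christoffel g c m j k y * z $ k * v $ i * w $ j)"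
      by (rule sum_swap3)
    finally show ?thesis by (simp add: sum_distrib_right)
  qed
  have 4: "Gam y w (Gam y v z) $ l = (\<Sum>k\<in>UNIV. \<Sum>i\<in>UNIV. \<Sum>j\<in>UNIV.
      (\<Sum>m\<in>UNIV. christoffel g c l j m y * christoffel g c m i k y) * z $ k * v $ i * w $ j)" for l
    unfolding 3 by (rule sum.cong[OF refl], subst sum.swap) (simp add: mult_ac)
  show ?thesis
    unfolding vec_eq_iff vector_add_component vector_minus_component 1 2 4 3[of v w]
    by (simp add: curvature_op_def riemann_coeff_def sum.distrib sum_subtractf algebra_simps)
qed

lemma curvature_op_scale:
  "curvature_op g c y (p *\<^sub>R v) w z = p *\<^sub>R curvature_op g c y v w z"
  "curvature_op g c y v (p *\<^sub>R w) z = p *\<^sub>R curvature_op g c y v w z"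
  "curvature_op g c y (v + v') w z = curvature_op g c y v w z + curvature_op g c y v' w z"
  "curvature_op g c y v (w + w') z = curvature_op g c y v w z + curvature_op g c y v w' z"
  by (auto simp: curvature_op_def vec_eq_iff sum_distrib_left sum.distrib algebra_simps)

lemma curvature_op_self: "y \<in> U \<Longrightarrow> curvature_op g c y v v z = 0"
  by (simp add: curvature_op_eq)

text \<open>The parameter directions \<open>a\<close> and \<open>b\<close> are constant, so there is
  no bracket term. After expansion by the product rule the second derivatives of \<Phi> and
  \<open>W\<close> cancel by symmetry, and the rest is \<open>curvature_op_eq\<close>.\<close>

lemma covd_commutator:
  fixes \<Phi> W :: "'b::real_normed_vector \<Rightarrow> real^'n"
  assumes "open V" "x \<in> V" "\<Phi> ` V \<subseteq> U" "smooth_on V \<Phi>" "smooth_on V W"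
  shows "covd \<Phi> a (covd \<Phi> b W) x - covd \<Phi> b (covd \<Phi> a W) x =
    curvature_op g c (\<Phi> x) (dird a \<Phi> x) (dird b \<Phi> x) (W x)"
proof -
  have y: "\<Phi> x \<in> U" using assms by auto
  have d: "\<Phi> differentiable (at x)" "dird u \<Phi> differentiable (at x)"
    "W differentiable (at x)" "dird u W differentiable (at x)" for u
    using assms smooth_on_dird smooth_on_differentiable by blast+
  have "dird u (covd \<Phi> v W) x = dird u (dird v W) x + (dGam (\<Phi> x) (dird u \<Phi> x) (dird v \<Phi> x) (W x)
      + Gam (\<Phi> x) (dird u (dird v \<Phi>) x) (W x) + Gam (\<Phi> x) (dird v \<Phi> x) (dird u W x))" for u v
    unfolding covd_def[abs_def] dird_Gam(1)[OF y d(1) d(2) d(3), symmetric]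
    by (rule dird_eqI) (intro has_derivative_add dird_works d dird_Gam(2) y)
  then show ?thesis
    using dird_commute[OF assms(1,4,2), of a b] dird_commute[OF assms(1,5,2), of a b]
    by (simp add: covd_def curvature_op_eq[OF y])
qed

text \<open>Symmetry of second derivatives together with symmetry of the Christoffel
  symbols.\<close>

lemma covd_torsion_free:
  assumes "open V" "x \<in> V" "\<Phi> ` V \<subseteq> U" "smooth_on V \<Phi>"
  shows "covd \<Phi> a (dird b \<Phi>) x = covd \<Phi> b (dird a \<Phi>) x"
  using dird_commute[OF assms(1,4,2), of a b] Gam_sym[of "\<Phi> x"] assms(2,3) by (auto simp: covd_def)

lemma covd_add:
  assumes "W differentiable (at x)" "Z differentiable (at x)"
  shows "covd \<Phi> a (\<lambda>x. W x + Z x) x = covd \<Phi> a W x + covd \<Phi> a Z x"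
  using dird_eqI[OF has_derivative_add[OF assms[THEN dird_works]], of a] by (simp add: covd_def)

lemma covd_scale:
  assumes "s differentiable (at x)" "W differentiable (at x)"
  shows "covd \<Phi> a (\<lambda>x. s x *\<^sub>R W x) x = s x *\<^sub>R covd \<Phi> a W x + dird a s x *\<^sub>R W x"
  using dird_eqI[OF has_derivative_scaleR[OF assms[THEN dird_works]], of a]
  by (simp add: covd_def scaleR_add_right)

lemma smooth_covd:
  assumes "open V" "\<Phi> ` V \<subseteq> U" "smooth_on V \<Phi>" "smooth_on V W"
  shows "smooth_on V (covd \<Phi> a W)"
  unfolding covd_def[abs_def] Gam_def
  by (intro smooth_on_add smooth_on_vec smooth_on_sum smooth_on_mult smooth_on_vec_nth smooth_on_dird
      smooth_on_compose[OF assms(1) open_U assms(2) smooth_christoffel assms(3)] assms)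

lemma smooth_ginner:
  assumes "open V" "\<Phi> ` V \<subseteq> U" "smooth_on V \<Phi>" "smooth_on V W" "smooth_on V Z"
  shows "smooth_on V (\<lambda>x. ginner g c (\<Phi> x) (W x) (Z x))"
  unfolding ginner_def
  by (intro smooth_on_inner smooth_on_bilinear[OF bounded_bilinear_matrix_vector]
      smooth_on_compose[OF assms(1) open_U assms(2) smooth_g assms(3)] assms)

end

section \<open>The Gauss equation in a Gram-Schmidt frame\<close>

text \<open>The components, in the directions \<open>a\<close> and \<open>b\<close>, of the connection form of the frame obtained
  from \<open>\<partial>\<^sub>a, \<partial>\<^sub>b\<close> by Gram-Schmidt, for the metric \<open>E da\<^sup>2 + 2 F da db + G db\<^sup>2\<close>
  (Liouville's formula for the Gauss curvature is its exterior derivative).\<close>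

definition conn1 :: "'b::real_normed_vector \<Rightarrow> 'b \<Rightarrow> ('b \<Rightarrow> real) \<Rightarrow> ('b \<Rightarrow> real) \<Rightarrow> ('b \<Rightarrow> real) \<Rightarrow> 'b \<Rightarrow> real" where
  "conn1 a b E F G x = (2 * E x * dird a F x - F x * dird a E x - E x * dird b E x) /
     (2 * E x * sqrt (E x * G x - (F x)\<^sup>2))"

definition conn2 :: "'b::real_normed_vector \<Rightarrow> 'b \<Rightarrow> ('b \<Rightarrow> real) \<Rightarrow> ('b \<Rightarrow> real) \<Rightarrow> ('b \<Rightarrow> real) \<Rightarrow> 'b \<Rightarrow> real" where
  "conn2 a b E F G x = (E x * dird a G x - F x * dird b E x) /
     (2 * E x * sqrt (E x * G x - (F x)\<^sup>2))"

locale surface_patch = metric_chart g c U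
  for g :: "('a, 'n::finite) metric" and c U +
  fixes V :: "'b::real_normed_vector set" and \<Phi> :: "'b \<Rightarrow> real^'n" and a b :: 'b
  assumes open_V: "open V" and \<Phi>_in: "\<Phi> ` V \<subseteq> U" and smooth_\<Phi>: "smooth_on V \<Phi>"
begin

abbreviation ip where "ip x v w \<equiv> ginner g c (\<Phi> x) v w"
abbreviation X1 where "X1 \<equiv> dird a \<Phi>"
abbreviation X2 where "X2 \<equiv> dird b \<Phi>"

definition E where "E x = ip x (X1 x) (X1 x)"
definition F where "F x = ip x (X1 x) (X2 x)"
definition G where "G x = ip x (X2 x) (X2 x)"
definition D where "D x = E x * G x - (F x)\<^sup>2"

definition e1 where "e1 x = inverse (sqrt (E x)) *\<^sub>R X1 x"
text \<open>The vector \<open>E X2 - F X1\<close> is orthogonal to \<open>X1\<close> and has squared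
  length \<open>E D\<close>, which gives the normalising factor.\<close>

definition e2 where "e2 x = inverse (sqrt (E x) * sqrt (D x)) *\<^sub>R (E x *\<^sub>R X2 x + (- F x) *\<^sub>R X1 x)"

definition nu where "nu x v = v - ip x v (e1 x) *\<^sub>R e1 x - ip x v (e2 x) *\<^sub>R e2 x"

lemma smooth_X: "smooth_on V X1" "smooth_on V X2"
  by (intro smooth_on_dird smooth_\<Phi>)+

lemma smooth_EFG: "smooth_on V E" "smooth_on V F" "smooth_on V G" "smooth_on V D"
proof -
  show *: "smooth_on V E" "smooth_on V F" "smooth_on V G"
    unfolding E_def[abs_def] F_def[abs_def] G_def[abs_def]
    by (intro smooth_ginner open_V \<Phi>_in smooth_\<Phi> smooth_X)+
  show "smooth_on V D"
    unfolding D_def[abs_def] power2_eq_square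
    by (intro smooth_on_diff smooth_on_mult * open_V)
qed

lemma \<Phi>_U: "x \<in> V \<Longrightarrow> \<Phi> x \<in> U" using \<Phi>_in by auto

lemma ip_commute: "x \<in> V \<Longrightarrow> ip x v w = ip x w v"
  by (rule ginner_commute[OF \<Phi>_U])

lemma ip_nonneg: "x \<in> V \<Longrightarrow> ip x v v \<ge> 0"
  by (cases "v = 0") (auto intro: less_imp_le pos_g \<Phi>_U)

lemma dird_ip:
  assumes "x \<in> V" "smooth_on V W" "smooth_on V Z"
  shows "dird u (\<lambda>x. ip x (W x) (Z x)) x = ip x (covd \<Phi> u W x) (Z x) + ip x (W x) (covd \<Phi> u Z x)"
  by (rule dird_ginner)
    (use assms \<Phi>_U smooth_\<Phi> smooth_on_differentiable in blast)+

lemma covd_X_sym: "x \<in> V \<Longrightarrow> covd \<Phi> b X1 x = covd \<Phi> a X2 x"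
  by (rule covd_torsion_free[OF open_V _ \<Phi>_in smooth_\<Phi>])

text \<open>Positivity of \<open>E\<close> and \<open>D\<close> says that \<open>X1\<close> and
  \<open>X2\<close> are independent, which Gram-Schmidt requires. It is a context assumption and not
  one of the locale because it is worded with definitions of the locale, and is verified later
  inside an interpretation.\<close>

context
  assumes pos: "\<And>x. x \<in> V \<Longrightarrow> E x > 0" "\<And>x. x \<in> V \<Longrightarrow> D x > 0"
begin

lemma smooth_coeff:
  "smooth_on V (\<lambda>x. inverse (sqrt (E x)))" "smooth_on V (\<lambda>x. inverse (sqrt (E x) * sqrt (D x)))"
  by (intro smooth_on_inverse smooth_on_mult smooth_on_sqrt smooth_EFG open_V pos; use pos in force)+

lemma smooth_e: "smooth_on V e1" "smooth_on V e2"
  unfolding e1_def[abs_def] e2_def[abs_def]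
  by (intro smooth_on_scaleR smooth_coeff smooth_on_add smooth_on_minus smooth_EFG smooth_X open_V)+

lemma orthonormal:
  assumes "x \<in> V"
  shows "ip x (e1 x) (e1 x) = 1" "ip x (e2 x) (e2 x) = 1" "ip x (e1 x) (e2 x) = 0" "ip x (e2 x) (e1 x) = 0"
proof -
  have p: "E x > 0" "D x > 0" using pos assms by auto
  have EFG: "ip x (X1 x) (X1 x) = E x" "ip x (X1 x) (X2 x) = F x" "ip x (X2 x) (X1 x) = F x" "ip x (X2 x) (X2 x) = G x"
    using ip_commute[OF assms] by (auto simp: E_def F_def G_def)
  have sq: "sqrt (E x) * sqrt (E x) = E x" "sqrt (D x) * sqrt (D x) = D x" using p by auto
  show "ip x (e1 x) (e1 x) = 1"
    using p sq by (simp add: e1_def EFG field_simps)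
  define k where "k = inverse (sqrt (E x) * sqrt (D x))"
  have "k * k = inverse (E x * D x)"
  proof -
    have "k * k = inverse ((sqrt (E x) * sqrt (D x)) * (sqrt (E x) * sqrt (D x)))"
      unfolding k_def by (rule inverse_mult_distrib[symmetric])
    also have "(sqrt (E x) * sqrt (D x)) * (sqrt (E x) * sqrt (D x)) = E x * D x"
      using sq by (metis mult.assoc mult.left_commute)
    finally show ?thesis .
  qed
  moreover have "ip x (e2 x) (e2 x) = (k * k) * (E x * D x)"
    unfolding e2_def k_def[symmetric] by (simp add: EFG D_def power2_eq_square algebra_simps)
  ultimately show "ip x (e2 x) (e2 x) = 1" using p by (simp add: field_simps)
  show "ip x (e1 x) (e2 x) = 0" "ip x (e2 x) (e1 x) = 0" by (simp_all add: e1_def e2_def EFG)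
qed

lemma X_frame:
  assumes "x \<in> V"
  shows "X1 x = sqrt (E x) *\<^sub>R e1 x" "X2 x = (F x / sqrt (E x)) *\<^sub>R e1 x + (sqrt (D x) / sqrt (E x)) *\<^sub>R e2 x"
proof -
  have p: "E x > 0" "D x > 0" using pos assms by auto
  have sq: "sqrt (E x) * sqrt (E x) = E x" using p by auto
  show 1: "X1 x = sqrt (E x) *\<^sub>R e1 x" using p by (simp add: e1_def)
  have "(sqrt (D x) / sqrt (E x)) *\<^sub>R e2 x = inverse (sqrt (E x) * sqrt (E x)) *\<^sub>R (E x *\<^sub>R X2 x + (- F x) *\<^sub>R X1 x)"
    using p by (simp add: e2_def field_simps)
  also have "\<dots> = X2 x - (F x / E x) *\<^sub>R X1 x"
    unfolding sq using p by (simp add: scaleR_diff_right divide_inverse mult.commute)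
  also have "(F x / E x) *\<^sub>R X1 x = (F x / sqrt (E x)) *\<^sub>R e1 x"
    using p sq by (simp add: e1_def divide_inverse mult.assoc flip: inverse_mult_distrib)
  finally show "X2 x = (F x / sqrt (E x)) *\<^sub>R e1 x + (sqrt (D x) / sqrt (E x)) *\<^sub>R e2 x" by simp
qed

lemma ip_X1_e2: "x \<in> V \<Longrightarrow> ip x (X1 x) (e2 x) = 0"
  by (simp add: X_frame orthonormal)

lemma nu_linear:
  "nu x (v + w) = nu x v + nu x w" "nu x (r *\<^sub>R v) = r *\<^sub>R nu x v" "nu x (v - w) = nu x v - nu x w"
  by (simp_all add: nu_def algebra_simps)

lemma nu_tangent: "x \<in> V \<Longrightarrow> nu x (e1 x) = 0" "x \<in> V \<Longrightarrow> nu x (e2 x) = 0"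
  "x \<in> V \<Longrightarrow> nu x (X1 x) = 0" "x \<in> V \<Longrightarrow> nu x (X2 x) = 0"
proof -
  show *: "nu x (e1 x) = 0" "nu x (e2 x) = 0" if "x \<in> V" for x
    using that by (simp_all add: nu_def orthonormal)
  show "x \<in> V \<Longrightarrow> nu x (X1 x) = 0" "x \<in> V \<Longrightarrow> nu x (X2 x) = 0"
    by (simp_all add: X_frame nu_linear *)
qed

section \<open>The connection form of the frame and the curvature inequality\<close>

definition conn where "conn u x = ip x (covd \<Phi> u e1 x) (e2 x)"

text \<open>Obtained by differentiating the constant inner products of the frame vectors.\<close>

lemma covd_e_orth:
  assumes "x \<in> V"
  shows "ip x (covd \<Phi> u e1 x) (e1 x) = 0" "ip x (covd \<Phi> u e2 x) (e2 x) = 0"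
    "conn u x = - ip x (e1 x) (covd \<Phi> u e2 x)"
proof -
  have z: "dird u (\<lambda>x. ip x (e1 x) (e1 x)) x = 0" "dird u (\<lambda>x. ip x (e2 x) (e2 x)) x = 0"
    "dird u (\<lambda>x. ip x (e1 x) (e2 x)) x = 0"
    using dird_cong_open[OF open_V assms orthonormal(1)] dird_cong_open[OF open_V assms orthonormal(2)]
      dird_cong_open[OF open_V assms orthonormal(3)] by simp_all
  show "ip x (covd \<Phi> u e1 x) (e1 x) = 0"
    using z(1) ip_commute[OF assms, of "e1 x"] by (simp add: dird_ip[OF assms] smooth_e)
  show "ip x (covd \<Phi> u e2 x) (e2 x) = 0"
    using z(2) ip_commute[OF assms, of "e2 x"] by (simp add: dird_ip[OF assms] smooth_e)
  show "conn u x = - ip x (e1 x) (covd \<Phi> u e2 x)"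
    using z(3) by (simp add: dird_ip[OF assms] smooth_e conn_def)
qed

text \<open>The derivatives of the Gram-Schmidt coefficients contribute only multiples of
  \<open>X1\<close> and \<open>X2\<close>. They stay unspecified, since they vanish under the later
  uses: \<open>X1\<close> is orthogonal to \<open>e2\<close>, and \<open>nu\<close> kills
  both.\<close>

lemma covd_e:
  assumes "x \<in> V"
  shows "\<exists>r. covd \<Phi> u e1 x = inverse (sqrt (E x)) *\<^sub>R covd \<Phi> u X1 x + r *\<^sub>R X1 x"
    and "\<exists>r s. covd \<Phi> u e2 x = inverse (sqrt (E x) * sqrt (D x)) *\<^sub>R
        (E x *\<^sub>R covd \<Phi> u X2 x - F x *\<^sub>R covd \<Phi> u X1 x) + r *\<^sub>R X1 x + s *\<^sub>R X2 x"
proof -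
  note d = smooth_on_differentiable[OF _ assms]
  have F': "smooth_on V (\<lambda>x. - F x)" by (intro smooth_on_minus open_V smooth_EFG)
  show "\<exists>r. covd \<Phi> u e1 x = inverse (sqrt (E x)) *\<^sub>R covd \<Phi> u X1 x + r *\<^sub>R X1 x"
    unfolding e1_def[abs_def] covd_scale[OF d[OF smooth_coeff(1)] d[OF smooth_X(1)]] by blast
  have sm: "smooth_on V (\<lambda>x. E x *\<^sub>R X2 x)" "smooth_on V (\<lambda>x. (- F x) *\<^sub>R X1 x)"
    "smooth_on V (\<lambda>x. E x *\<^sub>R X2 x + (- F x) *\<^sub>R X1 x)"
    by (intro smooth_on_scaleR smooth_on_add smooth_EFG smooth_X F' open_V)+
  have "covd \<Phi> u e2 x = inverse (sqrt (E x) * sqrt (D x)) *\<^sub>R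
      (E x *\<^sub>R covd \<Phi> u X2 x - F x *\<^sub>R covd \<Phi> u X1 x)
      + (inverse (sqrt (E x) * sqrt (D x)) * dird u (\<lambda>x. - F x) x - dird u (\<lambda>x. inverse (sqrt (E x) * sqrt (D x))) x * F x) *\<^sub>R X1 x
      + (inverse (sqrt (E x) * sqrt (D x)) * dird u E x + dird u (\<lambda>x. inverse (sqrt (E x) * sqrt (D x))) x * E x) *\<^sub>R X2 x"
    unfolding e2_def[abs_def] covd_scale[OF d[OF smooth_coeff(2)] d[OF sm(3)]]
      covd_add[OF d[OF sm(1)] d[OF sm(2)]] covd_scale[OF d[OF smooth_EFG(1)] d[OF smooth_X(2)]]
      covd_scale[OF d[OF F'] d[OF smooth_X(1)]]
    by (simp add: algebra_simps)
  then show "\<exists>r s. covd \<Phi> u e2 x = inverse (sqrt (E x) * sqrt (D x)) *\<^sub>R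
        (E x *\<^sub>R covd \<Phi> u X2 x - F x *\<^sub>R covd \<Phi> u X1 x) + r *\<^sub>R X1 x + s *\<^sub>R X2 x" by blast
qed

text \<open>The form is intrinsic. Derivatives of \<open>E\<close>, \<open>F\<close>,
  \<open>G\<close> are sums of products such as \<open><D X1, X2>\<close> by metric compatibility,
  and \<open>covd_X_sym\<close> exchanges \<open>D_b X1\<close> with \<open>D_a X2\<close>, so the
  products in the form can be solved for.\<close>

lemma conn_eq:
  assumes "x \<in> V"
  shows "conn a x = conn1 a b E F G x" "conn b x = conn2 a b E F G x"
proof -
  have p: "E x > 0" "D x > 0" using pos assms by auto
  have sq: "sqrt (E x) * sqrt (E x) = E x" using p by auto
  have conn: "conn u x = (E x * ip x (covd \<Phi> u X1 x) (X2 x) - F x * ip x (covd \<Phi> u X1 x) (X1 x)) / (E x * sqrt (D x))" for u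
  proof -
    obtain r where r: "covd \<Phi> u e1 x = inverse (sqrt (E x)) *\<^sub>R covd \<Phi> u X1 x + r *\<^sub>R X1 x"
      using covd_e(1)[OF assms] by blast
    have "conn u x = inverse (sqrt (E x)) * ip x (covd \<Phi> u X1 x) (e2 x)"
      unfolding conn_def r by (simp add: ip_X1_e2 assms)
    also have "\<dots> = inverse (sqrt (E x) * sqrt (E x) * sqrt (D x)) *
        (E x * ip x (covd \<Phi> u X1 x) (X2 x) - F x * ip x (covd \<Phi> u X1 x) (X1 x))"
      unfolding e2_def ginner_linear by (simp add: inverse_mult_distrib mult.assoc del: real_sqrt_mult_self)
    finally show ?thesis unfolding sq by (simp add: divide_inverse mult.commute)
  qed
  have dE: "dird u E x = 2 * ip x (covd \<Phi> u X1 x) (X1 x)" for u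
    using dird_ip[OF assms smooth_X(1) smooth_X(1), of u] ip_commute[OF assms, of "X1 x"]
    by (simp add: E_def[abs_def])
  have dF: "dird u F x = ip x (covd \<Phi> u X1 x) (X2 x) + ip x (X1 x) (covd \<Phi> u X2 x)" for u
    using dird_ip[OF assms smooth_X, of u] by (simp add: F_def[abs_def])
  have dG: "dird u G x = 2 * ip x (covd \<Phi> u X2 x) (X2 x)" for u
    using dird_ip[OF assms smooth_X(2) smooth_X(2), of u] ip_commute[OF assms, of "X2 x"]
    by (simp add: G_def[abs_def])
  note s = covd_X_sym[OF assms]
  show "conn a x = conn1 a b E F G x"
    unfolding conn conn1_def dE dF D_def[symmetric] s ip_commute[OF assms, of "X1 x"]
    using p by (simp add: field_simps)
  show "conn b x = conn2 a b E F G x"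
    unfolding conn conn2_def dE dG D_def[symmetric] s
    using p by (simp add: field_simps)
qed

text \<open>The left side is the Gauss curvature times \<open>sqrt D\<close>. It splits into a
  sectional curvature times \<open>sqrt D\<close> and a term in the second fundamental form, which
  minimality makes nonpositive. The hypothesis \<open>minimal\<close> says that the trace of the
  second covariant derivative, multiplied by \<open>D\<close> to clear the inverse metric, is
  tangent.\<close>

lemma gauss_inequality:
  assumes "x \<in> V"
    and sec: "\<And>v w. v \<noteq> w \<Longrightarrow> independent {v, w} \<Longrightarrow> sectional_curvature g c (\<Phi> x) v w \<le> 1"
    and minimal: "E x *\<^sub>R covd \<Phi> b X2 x - F x *\<^sub>R covd \<Phi> a X2 x - F x *\<^sub>R covd \<Phi> b X1 x
      + G x *\<^sub>R covd \<Phi> a X1 x = \<alpha> *\<^sub>R X1 x + \<beta> *\<^sub>R X2 x"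
  shows "dird b (conn1 a b E F G) x - dird a (conn2 a b E F G) x \<le> sqrt (D x)"
proof -
  have p: "E x > 0" "D x > 0" using pos assms by auto
  have sq: "sqrt (E x) * sqrt (E x) = E x" "sqrt (D x) * sqrt (D x) = D x" using p by auto
  note ipc = ip_commute[OF assms(1)]
  have sc: "smooth_on V (covd \<Phi> u e2)" for u
    by (intro smooth_covd open_V \<Phi>_in smooth_\<Phi> smooth_e)
  \<comment> \<open>The form is rewritten as \<open>- <e1, D e2>\<close> before differentiating, so
    that both second covariant derivatives fall on \<open>e2\<close> and combine to the curvature
    operator applied to \<open>e2\<close>.\<close>
  have dconn: "dird v (conn u) x = - (ip x (covd \<Phi> v e1 x) (covd \<Phi> u e2 x) + ip x (e1 x) (covd \<Phi> v (covd \<Phi> u e2) x))" for u v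
  proof -
    have "dird v (conn u) x = dird v (\<lambda>x. - ip x (e1 x) (covd \<Phi> u e2 x)) x"
      by (rule dird_cong_open[OF open_V assms(1)]) (rule covd_e_orth(3))
    also have "\<dots> = - dird v (\<lambda>x. ip x (e1 x) (covd \<Phi> u e2 x)) x"
      by (rule dird_linear[OF bounded_linear_minus[OF bounded_linear_ident]])
        (intro smooth_on_differentiable[OF _ assms(1)] smooth_ginner open_V \<Phi>_in smooth_\<Phi> smooth_e sc)
    finally show ?thesis by (simp add: dird_ip[OF assms(1) smooth_e(1) sc])
  qed
  have "dird b (conn1 a b E F G) x = dird b (conn a) x" "dird a (conn2 a b E F G) x = dird a (conn b) x"
    by (rule dird_cong_open[OF open_V assms(1)]; simp add: conn_eq)+
  then have "dird b (conn1 a b E F G) x - dird a (conn2 a b E F G) x =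
      ip x (e1 x) (covd \<Phi> a (covd \<Phi> b e2) x - covd \<Phi> b (covd \<Phi> a e2) x)
      + (ip x (covd \<Phi> a e1 x) (covd \<Phi> b e2 x) - ip x (covd \<Phi> b e1 x) (covd \<Phi> a e2 x))"
    by (simp add: dconn)
  moreover have "ip x (e1 x) (covd \<Phi> a (covd \<Phi> b e2) x - covd \<Phi> b (covd \<Phi> a e2) x) \<le> sqrt (D x)"
  proof -
    have "covd \<Phi> a (covd \<Phi> b e2) x - covd \<Phi> b (covd \<Phi> a e2) x = curvature_op g c (\<Phi> x) (X1 x) (X2 x) (e2 x)"
      by (rule covd_commutator[OF open_V assms(1) \<Phi>_in smooth_\<Phi> smooth_e(2)])
    \<comment> \<open>The \<open>e1\<close> part of \<open>X2\<close> drops out by antisymmetry, and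
      \<open>sqrt E\<close> cancels between the coefficients of \<open>e1\<close> in
      \<open>X1\<close> and \<open>e2\<close> in \<open>X2\<close>.\<close>
    also have "\<dots> = sqrt (D x) *\<^sub>R curvature_op g c (\<Phi> x) (e1 x) (e2 x) (e2 x)"
      unfolding X_frame[OF assms(1)] curvature_op_scale curvature_op_self[OF \<Phi>_U[OF assms(1)]]
      using p by simp
    finally have "ip x (e1 x) (covd \<Phi> a (covd \<Phi> b e2) x - covd \<Phi> b (covd \<Phi> a e2) x)
        = sqrt (D x) * ip x (curvature_op g c (\<Phi> x) (e1 x) (e2 x) (e2 x)) (e1 x)"
      by (simp add: ipc[of "e1 x"])
    moreover have "ip x (curvature_op g c (\<Phi> x) (e1 x) (e2 x) (e2 x)) (e1 x) = sectional_curvature g c (\<Phi> x) (e1 x) (e2 x)"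
      by (simp add: sectional_curvature_def orthonormal[OF assms(1)])
    moreover have "e1 x \<noteq> e2 x" using orthonormal[OF assms(1)] by auto
    moreover have "independent {e1 x, e2 x}"
    proof -
      have "e2 x \<noteq> 0" using orthonormal(2)[OF assms(1)] by auto
      moreover have "e1 x \<notin> span {e2 x}"
      proof
        assume "e1 x \<in> span {e2 x}"
        then obtain k where "e1 x = k *\<^sub>R e2 x" by (auto simp: span_singleton)
        then have "ip x (e1 x) (e1 x) = k * ip x (e2 x) (e1 x)" by (metis ginner_linear(3))
        then show False using orthonormal[OF assms(1)] by simp
      qed
      ultimately show ?thesis by (simp add: independent_insert)
    qed
    ultimately show ?thesis using sec[of "e1 x" "e2 x"] p
      by (metis mult_left_le order_less_imp_le real_sqrt_gt_zero)
  qed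
  moreover have "ip x (covd \<Phi> a e1 x) (covd \<Phi> b e2 x) - ip x (covd \<Phi> b e1 x) (covd \<Phi> a e2 x) \<le> 0"
  proof -
    \<comment> \<open>With \<open>B\<^sub>i\<^sub>j\<close> the second fundamental form, the difference is a positive multiple of
      \<open>\<langle>B\<^sub>1\<^sub>1, B\<^sub>2\<^sub>2\<rangle> - |B\<^sub>1\<^sub>2|\<^sup>2\<close>, and minimality gives
      \<open>4 E G \<langle>B\<^sub>1\<^sub>1, B\<^sub>2\<^sub>2\<rangle> \<le> |E B\<^sub>2\<^sub>2 + G B\<^sub>1\<^sub>1|\<^sup>2 = 4 F\<^sup>2 |B\<^sub>1\<^sub>2|\<^sup>2\<close>.\<close>
    define B where "B u W = nu x (covd \<Phi> u W x)" for u W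
    \<comment> \<open>The tangential part of \<open>D e1\<close> lies along \<open>e2\<close> and
      that of \<open>D e2\<close> along \<open>e1\<close>, so they are orthogonal and only the
      normal parts contribute.\<close>
    have nu_ip: "ip x (covd \<Phi> u e1 x) (covd \<Phi> v e2 x) = ip x (B u e1) (B v e2)" for u v
    proof -
      have "B u e1 = covd \<Phi> u e1 x - ip x (covd \<Phi> u e1 x) (e2 x) *\<^sub>R e2 x"
        "B v e2 = covd \<Phi> v e2 x - ip x (covd \<Phi> v e2 x) (e1 x) *\<^sub>R e1 x"
        by (simp_all add: B_def nu_def covd_e_orth(1,2)[OF assms(1)])
      moreover have "ip x (e2 x) (covd \<Phi> v e2 x) = 0"
        using ipc covd_e_orth(2)[OF assms(1)] by simp
      ultimately show ?thesis
        by (simp add: orthonormal[OF assms(1)] covd_e_orth(1,2)[OF assms(1)])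
    qed
    have B1: "B u e1 = inverse (sqrt (E x)) *\<^sub>R B u X1" for u
      using covd_e(1)[OF assms(1), of u] by (auto simp: B_def nu_linear nu_tangent[OF assms(1)])
    have B2: "B u e2 = inverse (sqrt (E x) * sqrt (D x)) *\<^sub>R (E x *\<^sub>R B u X2 - F x *\<^sub>R B u X1)" for u
      using covd_e(2)[OF assms(1), of u] by (auto simp: B_def nu_linear nu_tangent[OF assms(1)])
    have sym: "B b X1 = B a X2" by (simp add: B_def covd_X_sym[OF assms(1)])
    have eq: "ip x (covd \<Phi> a e1 x) (covd \<Phi> b e2 x) - ip x (covd \<Phi> b e1 x) (covd \<Phi> a e2 x)
       = inverse (sqrt (E x)) * inverse (sqrt (E x) * sqrt (D x)) * (E x * (ip x (B a X1) (B b X2) - ip x (B a X2) (B a X2)))"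
      unfolding nu_ip B1 B2 sym
      by (simp add: ipc[of "B a X2" "B a X1"] algebra_simps)
    have "nu x (E x *\<^sub>R covd \<Phi> b X2 x - F x *\<^sub>R covd \<Phi> a X2 x - F x *\<^sub>R covd \<Phi> b X1 x + G x *\<^sub>R covd \<Phi> a X1 x) = 0"
      unfolding minimal by (simp add: nu_linear nu_tangent[OF assms(1)])
    then have "E x *\<^sub>R B b X2 - F x *\<^sub>R B a X2 - F x *\<^sub>R B a X2 + G x *\<^sub>R B a X1 = 0"
      unfolding nu_linear B_def[symmetric] sym .
    then have "E x *\<^sub>R B b X2 + G x *\<^sub>R B a X1 = (2 * F x) *\<^sub>R B a X2"
      unfolding mult_2 scaleR_add_left by (simp add: algebra_simps)
    then have "ip x (E x *\<^sub>R B b X2 + G x *\<^sub>R B a X1) (E x *\<^sub>R B b X2 + G x *\<^sub>R B a X1)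
        = 4 * (F x)\<^sup>2 * ip x (B a X2) (B a X2)"
      by (simp add: power2_eq_square)
    moreover have "0 \<le> ip x (E x *\<^sub>R B b X2 - G x *\<^sub>R B a X1) (E x *\<^sub>R B b X2 - G x *\<^sub>R B a X1)"
      by (rule ip_nonneg[OF assms(1)])
    ultimately have "4 * E x * G x * ip x (B a X1) (B b X2) \<le> 4 * (F x)\<^sup>2 * ip x (B a X2) (B a X2)"
      by (simp add: algebra_simps ipc[of "B b X2" "B a X1"])
    also have "\<dots> \<le> 4 * E x * G x * ip x (B a X2) (B a X2)"
      using p ip_nonneg[OF assms(1)] by (intro mult_right_mono) (auto simp: D_def)
    finally have "E x * G x * ip x (B a X1) (B b X2) \<le> E x * G x * ip x (B a X2) (B a X2)" by simp
    moreover have "E x * G x > 0" using p zero_le_power2[of "F x"] unfolding D_def by linarith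
    ultimately have "ip x (B a X1) (B b X2) - ip x (B a X2) (B a X2) \<le> 0"
      by (simp only: diff_le_0_iff_le mult_le_cancel_left_pos)
    then show ?thesis unfolding eq using p by (intro mult_nonneg_nonpos) (auto intro: mult_nonneg_nonpos)
  qed
  ultimately show ?thesis by linarith
qed

end

end

section \<open>Minimal surfaces in an arbitrary parametrisation\<close>

lemma vec2_expansion: "(v :: real^2) = v $ 1 *\<^sub>R axis 1 1 + v $ 2 *\<^sub>R axis 2 1"
  by (simp add: vec_eq_iff forall_2 axis_def)

lemma dird_vec2:
  fixes F :: "real^2 \<Rightarrow> 'b::real_normed_vector"
  assumes "F differentiable (at y)"
  shows "dird v F y = v $ 1 *\<^sub>R dird (axis 1 1) F y + v $ 2 *\<^sub>R dird (axis 2 1) F y"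
  using linear_add[OF linear_dird[OF assms]] linear_scale[OF linear_dird[OF assms]]
  by (subst vec2_expansion[of v]) simp

lemma matrix_inv_2:
  fixes A :: "real^2^2"
  assumes "det A \<noteq> 0"
  shows "matrix_inv A $ 1 $ 1 = A $ 2 $ 2 / det A" "matrix_inv A $ 1 $ 2 = - A $ 1 $ 2 / det A"
    "matrix_inv A $ 2 $ 1 = - A $ 2 $ 1 / det A" "matrix_inv A $ 2 $ 2 = A $ 1 $ 1 / det A"
proof -
  define B :: "real^2^2" where
    "B = (\<chi> i j. if i = 1 then (if j = 1 then A $ 2 $ 2 / det A else - A $ 1 $ 2 / det A)
                   else (if j = 1 then - A $ 2 $ 1 / det A else A $ 1 $ 1 / det A))"
  have "A $ 1 $ 1 * A $ 2 $ 2 - A $ 1 $ 2 * A $ 2 $ 1 \<noteq> 0" using assms by (simp add: det_2)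
  then have AB: "A ** B = mat 1"
    by (simp add: vec_eq_iff forall_2 matrix_matrix_mult_def sum_2 B_def mat_def det_2 divide_simps)
  then have BA: "B ** A = mat 1" by (simp add: matrix_left_right_inverse)
  have "\<exists>C. A ** C = mat 1 \<and> C ** A = mat 1" using AB BA by blast
  then have "A ** matrix_inv A = mat 1" unfolding matrix_inv_def by (rule someI2_ex) auto
  then have "matrix_inv A = B" using BA
    by (metis matrix_mul_assoc matrix_mul_lid matrix_mul_rid)
  then show "matrix_inv A $ 1 $ 1 = A $ 2 $ 2 / det A" "matrix_inv A $ 1 $ 2 = - A $ 1 $ 2 / det A"
    "matrix_inv A $ 2 $ 1 = - A $ 2 $ 1 / det A" "matrix_inv A $ 2 $ 2 = A $ 1 $ 1 / det A"
    by (simp_all add: B_def)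
qed

lemma change_basis_2:
  fixes y z :: "'v::real_vector"
  assumes "p1 * q2 - p2 * q1 \<noteq> 0"
  shows "\<exists>\<alpha> \<beta>. s *\<^sub>R y + t *\<^sub>R z = \<alpha> *\<^sub>R (p1 *\<^sub>R y + p2 *\<^sub>R z) + \<beta> *\<^sub>R (q1 *\<^sub>R y + q2 *\<^sub>R z)"
proof (intro exI)
  define J where "J = p1 * q2 - p2 * q1"
  have J: "J \<noteq> 0" using assms by (simp add: J_def)
  \<comment> \<open>Cramer's rule with determinant \<open>J\<close>.\<close>
  let ?a = "(s * q2 - t * q1) / J" and ?b = "(t * p1 - s * p2) / J"
  have "(s * q2 - t * q1) * p1 + (t * p1 - s * p2) * q1 = s * J"
    "(s * q2 - t * q1) * p2 + (t * p1 - s * p2) * q2 = t * J"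
    by (simp_all add: J_def algebra_simps)
  then have ab: "?a * p1 + ?b * q1 = s" "?a * p2 + ?b * q2 = t"
    using J by (simp_all add: add_divide_distrib[symmetric])
  have "?a *\<^sub>R (p1 *\<^sub>R y + p2 *\<^sub>R z) + ?b *\<^sub>R (q1 *\<^sub>R y + q2 *\<^sub>R z) =
      (?a * p1 + ?b * q1) *\<^sub>R y + (?a * p2 + ?b * q2) *\<^sub>R z"
    by (simp only: scaleR_add_left scaleR_add_right scaleR_scaleR add_ac)
  then show "s *\<^sub>R y + t *\<^sub>R z = ?a *\<^sub>R (p1 *\<^sub>R y + p2 *\<^sub>R z) + ?b *\<^sub>R (q1 *\<^sub>R y + q2 *\<^sub>R z)"
    unfolding ab by (rule sym)
qed

text \<open>With \<open_placeholder> omitted: this is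
  \<open>det (P^T m P) = (det P)^2 det m\<close>, where \<open>P\<close> has the columns
  \<open>p\<close> and \<open>q\<close>.\<close>

lemma gram_det_2:
  fixes p q :: "real^2" and m :: "real^2^2"
  assumes "m $ 2 $ 1 = m $ 1 $ 2"
  shows "(p \<bullet> (m *v p)) * (q \<bullet> (m *v q)) - (p \<bullet> (m *v q))\<^sup>2 = (p $ 1 * q $ 2 - p $ 2 * q $ 1)\<^sup>2 * det m"
  by (simp add: det_2 inner_vec_def matrix_vector_mult_def sum_2 assms power2_eq_square algebra_simps)

lemma conn_cong:
  assumes "open V" "x \<in> V" "\<And>z. z \<in> V \<Longrightarrow> E z = E' z" "\<And>z. z \<in> V \<Longrightarrow> F z = F' z" "\<And>z. z \<in> V \<Longrightarrow> G z = G' z"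
  shows "conn1 a b E F G x = conn1 a b E' F' G' x" "conn2 a b E F G x = conn2 a b E' F' G' x"
  using dird_cong_open[OF assms(1,2,3)] dird_cong_open[OF assms(1,2,4)] dird_cong_open[OF assms(1,2,5)]
    assms(2-5) by (simp_all add: conn1_def conn2_def)

context metric_chart
begin

lemma covd_compose:
  assumes "\<psi> differentiable (at x)" "F differentiable (at (\<psi> x))" "W differentiable (at (\<psi> x))"
  shows "covd (\<lambda>x. F (\<psi> x)) u (\<lambda>x. W (\<psi> x)) x = covd F (dird u \<psi> x) W (\<psi> x)"
  unfolding covd_def dird_compose[OF assms(1,2)] dird_compose[OF assms(1,3)] ..

lemma covd_vec2:
  fixes F W :: "real^2 \<Rightarrow> real^'n"
  assumes "F differentiable (at y)" "W differentiable (at y)"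
  shows "covd F v W y = v $ 1 *\<^sub>R covd F (axis 1 1) W y + v $ 2 *\<^sub>R covd F (axis 2 1) W y"
  unfolding covd_def dird_vec2[OF assms(1), of v] dird_vec2[OF assms(2), of v]
  by (simp add: algebra_simps)

lemma covd_cong_open:
  assumes "open V" "x \<in> V" "\<And>y. y \<in> V \<Longrightarrow> W y = Z y"
  shows "covd \<Phi> u W x = covd \<Phi> u Z x"
  using dird_cong_open[OF assms] assms(2,3) by (simp add: covd_def)

text \<open>Minimality is given in chart coordinates, whereas the inequality is wanted in polar
  ones. Under reparametrisation the second covariant derivative transforms as a bilinear form, up to
  terms with second derivatives of \<psi>, and those are tangent to the surface.\<close>

lemma hessian_reparam:
  fixes F :: "real^2 \<Rightarrow> real^'n" and \<psi> :: "'b::real_normed_vector \<Rightarrow> real^2"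
  assumes V: "open V" "x \<in> V" "smooth_on V \<psi>" and W: "\<psi> ` V \<subseteq> W" "smooth_on W F"
  shows "covd (\<lambda>x. F (\<psi> x)) u (dird v (\<lambda>x. F (\<psi> x))) x =
     (dird u \<psi> x $ 1 * dird v \<psi> x $ 1) *\<^sub>R covd F (axis 1 1) (dird (axis 1 1) F) (\<psi> x)
   + (dird u \<psi> x $ 1 * dird v \<psi> x $ 2) *\<^sub>R covd F (axis 1 1) (dird (axis 2 1) F) (\<psi> x)
   + (dird u \<psi> x $ 2 * dird v \<psi> x $ 1) *\<^sub>R covd F (axis 2 1) (dird (axis 1 1) F) (\<psi> x)
   + (dird u \<psi> x $ 2 * dird v \<psi> x $ 2) *\<^sub>R covd F (axis 2 1) (dird (axis 2 1) F) (\<psi> x)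
   + dird u (dird v \<psi>) x $ 1 *\<^sub>R dird (axis 1 1) F (\<psi> x)
   + dird u (dird v \<psi>) x $ 2 *\<^sub>R dird (axis 2 1) F (\<psi> x)"
proof -
  have d\<psi>: "\<psi> differentiable (at z)" "dird v \<psi> differentiable (at z)" if "z \<in> V" for z v
    using V smooth_on_dird smooth_on_differentiable that by blast+
  have dF: "F differentiable (at (\<psi> z))" "dird w F differentiable (at (\<psi> z))" if "z \<in> V" for z w
    using W smooth_on_dird smooth_on_differentiable that by blast+
  define Y where "Y i x = dird (axis i 1) F (\<psi> x)" for i x
  define s where "s i x = dird v \<psi> x $ i" for i x
  have dY: "Y i differentiable (at x)" for i
    unfolding Y_def[abs_def] using differentiable_chain_at[OF d\<psi>(1)[OF V(2)] dF(2)[OF V(2)]] by (simp add: o_def)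
  have ds: "s i differentiable (at x)" "dird u (s i) x = dird u (dird v \<psi>) x $ i" for i
    unfolding s_def[abs_def]
    using bounded_linear.has_derivative[OF bounded_linear_vec_nth dird_works[OF d\<psi>(2)[OF V(2)]]]
      dird_linear[OF bounded_linear_vec_nth d\<psi>(2)[OF V(2)]] by (auto intro: differentiableI)
  have dsY: "(\<lambda>x. s i x *\<^sub>R Y i x) differentiable (at x)" for i
    by (rule differentiable_scaleR[OF ds(1) dY])
  have cY: "covd (\<lambda>x. F (\<psi> x)) u (Y i) x = dird u \<psi> x $ 1 *\<^sub>R covd F (axis 1 1) (dird (axis i 1) F) (\<psi> x)
      + dird u \<psi> x $ 2 *\<^sub>R covd F (axis 2 1) (dird (axis i 1) F) (\<psi> x)" for i
    unfolding Y_def[abs_def] covd_compose[OF d\<psi>(1)[OF V(2)] dF[OF V(2)]]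
    by (rule covd_vec2[OF dF[OF V(2)]])
  have "covd (\<lambda>x. F (\<psi> x)) u (dird v (\<lambda>x. F (\<psi> x))) x =
      covd (\<lambda>x. F (\<psi> x)) u (\<lambda>x. s 1 x *\<^sub>R Y 1 x + s 2 x *\<^sub>R Y 2 x) x"
  proof (rule covd_cong_open[OF V(1,2)])
    fix z assume z: "z \<in> V"
    show "dird v (\<lambda>x. F (\<psi> x)) z = s 1 z *\<^sub>R Y 1 z + s 2 z *\<^sub>R Y 2 z"
      unfolding s_def Y_def dird_compose[OF d\<psi>(1)[OF z] dF(1)[OF z]] by (rule dird_vec2[OF dF(1)[OF z]])
  qed
  also have "\<dots> = s 1 x *\<^sub>R covd (\<lambda>x. F (\<psi> x)) u (Y 1) x + dird u (s 1) x *\<^sub>R Y 1 x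
      + (s 2 x *\<^sub>R covd (\<lambda>x. F (\<psi> x)) u (Y 2) x + dird u (s 2) x *\<^sub>R Y 2 x)"
    by (simp only: covd_add[OF dsY dsY] covd_scale[OF ds(1) dY])
  finally show ?thesis
    unfolding ds(2) cY by (simp add: s_def Y_def scaleR_add_right mult.commute)
qed

lemma ambient_deriv_eq:
  "ambient_deriv g c' c f i j y = covd (local_rep c' c f) (axis i 1) (dird (axis j 1) (local_rep c' c f)) y"
  by (simp add: ambient_deriv_def covd_def Let_def pderiv_at_eq_dird Gam_def)

lemma first_fundamental_form_nth:
  "first_fundamental_form g c' c f y $ i $ j = ginner g c (local_rep c' c f y)
     (dird (axis i 1) (local_rep c' c f) y) (dird (axis j 1) (local_rep c' c f) y)"
  by (simp add: first_fundamental_form_def pderiv_at_eq_dird)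

lemma first_fundamental_form_ginner:
  assumes "local_rep c' c f differentiable (at y)"
  shows "v \<bullet> (first_fundamental_form g c' c f y *v (w :: real^2)) = ginner g c (local_rep c' c f y)
     (dird v (local_rep c' c f) y) (dird w (local_rep c' c f) y)"
  unfolding dird_vec2[OF assms, of v] dird_vec2[OF assms, of w]
  by (simp add: inner_vec_def sum_2 matrix_vector_mult_def first_fundamental_form_nth algebra_simps)

text \<open>Multiplying the mean curvature by twice \<open>det h\<close> turns the inverse of
  \<open>h\<close> into cofactors. Since \<open>normal_part\<close> changes a vector only by a
  tangent one, the same combination of the unprojected derivatives is tangent.\<close>

lemma minimal_tangent:
  fixes c' :: "('b, 2) chart"
  assumes "mean_curvature g c' c f y = 0" "det (first_fundamental_form g c' c f y) \<noteq> 0"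
    "local_rep c' c f y \<in> U"
  defines "h \<equiv> first_fundamental_form g c' c f y"
  shows "\<exists>\<alpha> \<beta>. h $ 2 $ 2 *\<^sub>R ambient_deriv g c' c f 1 1 y - h $ 1 $ 2 *\<^sub>R ambient_deriv g c' c f 1 2 y
      - h $ 1 $ 2 *\<^sub>R ambient_deriv g c' c f 2 1 y + h $ 1 $ 1 *\<^sub>R ambient_deriv g c' c f 2 2 y =
      \<alpha> *\<^sub>R dird (axis 1 1) (local_rep c' c f) y + \<beta> *\<^sub>R dird (axis 2 1) (local_rep c' c f) y"
proof -
  define A where "A i j = ambient_deriv g c' c f i j y" for i j
  define Y where "Y i = dird (axis i 1) (local_rep c' c f) y" for i :: 2
  define k where "k = det h"
  have k: "k \<noteq> 0" using assms by (simp add: k_def)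
  have h21: "h $ 2 $ 1 = h $ 1 $ 2"
    unfolding h_def first_fundamental_form_nth by (rule ginner_commute[OF assms(3)])
  have "\<exists>\<alpha> \<beta>. normal_part g c' c f y v = v - (\<alpha> *\<^sub>R Y 1 + \<beta> *\<^sub>R Y 2)" for v
  proof -
    have "normal_part g c' c f y v = v - ((\<Sum>k\<in>UNIV. matrix_inv h $ k $ 1 * ginner g c (local_rep c' c f y) v (Y k)) *\<^sub>R Y 1
      + (\<Sum>k\<in>UNIV. matrix_inv h $ k $ 2 * ginner g c (local_rep c' c f y) v (Y k)) *\<^sub>R Y 2)"
      by (simp add: normal_part_def h_def Y_def pderiv_at_eq_dird sum_2 scaleR_add_left)
    then show ?thesis by blast
  qed
  then obtain \<alpha> \<beta> where N: "normal_part g c' c f y v = v - (\<alpha> v *\<^sub>R Y 1 + \<beta> v *\<^sub>R Y 2)" for v by metis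
  have H: "(h $ 2 $ 2 / k) *\<^sub>R normal_part g c' c f y (A 1 1) + (- h $ 1 $ 2 / k) *\<^sub>R normal_part g c' c f y (A 1 2)
    + ((- h $ 1 $ 2 / k) *\<^sub>R normal_part g c' c f y (A 2 1) + (h $ 1 $ 1 / k) *\<^sub>R normal_part g c' c f y (A 2 2)) = 0"
    using assms(1) matrix_inv_2[of h] k
    by (simp add: mean_curvature_def second_fundamental_form_def sum_2 h_def[symmetric] A_def[symmetric] k_def[symmetric] h21)
  have "k *\<^sub>R ((h $ 2 $ 2 / k) *\<^sub>R normal_part g c' c f y (A 1 1) + (- h $ 1 $ 2 / k) *\<^sub>R normal_part g c' c f y (A 1 2)
    + ((- h $ 1 $ 2 / k) *\<^sub>R normal_part g c' c f y (A 2 1) + (h $ 1 $ 1 / k) *\<^sub>R normal_part g c' c f y (A 2 2))) = 0"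
    unfolding H by simp
  then have "h $ 2 $ 2 *\<^sub>R normal_part g c' c f y (A 1 1) - h $ 1 $ 2 *\<^sub>R normal_part g c' c f y (A 1 2)
    - h $ 1 $ 2 *\<^sub>R normal_part g c' c f y (A 2 1) + h $ 1 $ 1 *\<^sub>R normal_part g c' c f y (A 2 2) = 0"
    using k by (simp add: scaleR_add_right scaleR_diff_right algebra_simps)
  then have "h $ 2 $ 2 *\<^sub>R A 1 1 - h $ 1 $ 2 *\<^sub>R A 1 2 - h $ 1 $ 2 *\<^sub>R A 2 1 + h $ 1 $ 1 *\<^sub>R A 2 2 =
    (h $ 2 $ 2 * \<alpha> (A 1 1) - h $ 1 $ 2 * \<alpha> (A 1 2) - h $ 1 $ 2 * \<alpha> (A 2 1) + h $ 1 $ 1 * \<alpha> (A 2 2)) *\<^sub>R Y 1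
    + (h $ 2 $ 2 * \<beta> (A 1 1) - h $ 1 $ 2 * \<beta> (A 1 2) - h $ 1 $ 2 * \<beta> (A 2 1) + h $ 1 $ 1 * \<beta> (A 2 2)) *\<^sub>R Y 2"
    unfolding N by (simp add: algebra_simps)
  then show ?thesis unfolding A_def Y_def by blast
qed

text \<open>Entry by entry the identity \<open>P adj (P^T m P) P^T = (det P)^2 adj m\<close>, with
  \<open>p\<close> and \<open>q\<close> the columns of \<open>P\<close>. It makes the cleared trace
  in the minimality condition independent of the parametrisation up to a factor.\<close>

lemma cross_quadratic:
  fixes A B C D :: "real^'n" and p q h :: "real^2" and m :: "real^2^2"
  assumes "m $ 2 $ 1 = m $ 1 $ 2"
  defines "e \<equiv> p \<bullet> (m *v p)" and "f \<equiv> p \<bullet> (m *v q)" and "k \<equiv> q \<bullet> (m *v q)"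
  shows "(e * (q $ 1 * q $ 1) - f * (p $ 1 * q $ 1) - f * (q $ 1 * p $ 1) + k * (p $ 1 * p $ 1)) = (p $ 1 * q $ 2 - p $ 2 * q $ 1)\<^sup>2 * m $ 2 $ 2"
    "(e * (q $ 1 * q $ 2) - f * (p $ 1 * q $ 2) - f * (q $ 1 * p $ 2) + k * (p $ 1 * p $ 2)) = - (p $ 1 * q $ 2 - p $ 2 * q $ 1)\<^sup>2 * m $ 1 $ 2"
    "(e * (q $ 2 * q $ 1) - f * (p $ 2 * q $ 1) - f * (q $ 2 * p $ 1) + k * (p $ 2 * p $ 1)) = - (p $ 1 * q $ 2 - p $ 2 * q $ 1)\<^sup>2 * m $ 1 $ 2"
    "(e * (q $ 2 * q $ 2) - f * (p $ 2 * q $ 2) - f * (q $ 2 * p $ 2) + k * (p $ 2 * p $ 2)) = (p $ 1 * q $ 2 - p $ 2 * q $ 1)\<^sup>2 * m $ 1 $ 1"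
  using assms(1)
  by (simp_all add: e_def f_def k_def inner_vec_def matrix_vector_mult_def sum_2 power2_eq_square algebra_simps)

text \<open>Minimality and the curvature bound enter only at the point \<open>x\<close>;
  independence of the tangent vectors is required on all of \<open>V\<close>, because the frame is
  differentiated there.\<close>

lemma gauss_inequality_reparam:
  fixes c' :: "('b, 2) chart" and \<psi> :: "'e::real_normed_vector \<Rightarrow> real^2" and f a b
  defines "F \<equiv> local_rep c' c f"
  defines "h \<equiv> (\<lambda>x. first_fundamental_form g c' c f (\<psi> x))"
  defines "e \<equiv> (\<lambda>x. dird a \<psi> x \<bullet> (h x *v dird a \<psi> x))"
    and "k \<equiv> (\<lambda>x. dird a \<psi> x \<bullet> (h x *v dird b \<psi> x))"
    and "l \<equiv> (\<lambda>x. dird b \<psi> x \<bullet> (h x *v dird b \<psi> x))"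
  assumes V: "open V" "x \<in> V" "smooth_on V \<psi>" and W: "open W" "\<psi> ` V \<subseteq> W" "smooth_on W F" "F ` W \<subseteq> U"
    and inj: "\<And>y. y \<in> W \<Longrightarrow> inj (frechet_derivative F (at y))"
    and minimal: "mean_curvature g c' c f (\<psi> x) = 0"
    and jac: "\<And>x. x \<in> V \<Longrightarrow> dird a \<psi> x $ 1 * dird b \<psi> x $ 2 - dird a \<psi> x $ 2 * dird b \<psi> x $ 1 \<noteq> 0"
    and sec: "\<And>v w. v \<noteq> w \<Longrightarrow> independent {v, w} \<Longrightarrow> sectional_curvature g c (F (\<psi> x)) v w \<le> 1"
  shows "dird b (conn1 a b e k l) x - dird a (conn2 a b e k l) x \<le> sqrt (e x * l x - (k x)\<^sup>2)"
proof -
  define \<Phi> where "\<Phi> x = F (\<psi> x)" for x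
  have s\<Phi>: "smooth_on V \<Phi>"
    unfolding \<Phi>_def[abs_def] by (rule smooth_on_compose[OF V(1) W(1) W(2) W(3) V(3)])
  interpret S: surface_patch g c U V \<Phi> a b
    by unfold_locales (use V W s\<Phi> in \<open>auto simp: \<Phi>_def\<close>)
  have dF: "F differentiable (at (\<psi> z))" if "z \<in> V" for z
    using W that smooth_on_differentiable by blast
  have d\<psi>: "\<psi> differentiable (at z)" if "z \<in> V" for z
    using V that smooth_on_differentiable by blast
  have d\<Phi>: "dird u \<Phi> z = dird (dird u \<psi> z) F (\<psi> z)" if "z \<in> V" for u z
    unfolding \<Phi>_def[abs_def] by (rule dird_compose[OF d\<psi>[OF that] dF[OF that]])
  have h_ginner: "v \<bullet> (h z *v w) = S.ip z (dird v F (\<psi> z)) (dird w F (\<psi> z))" if "z \<in> V" for v w z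
    unfolding h_def \<Phi>_def
    using first_fundamental_form_ginner[of c' f "\<psi> z" v w] dF[OF that] unfolding F_def .
  have EFG: "S.E z = e z" "S.F z = k z" "S.G z = l z" if "z \<in> V" for z
    unfolding S.E_def S.F_def S.G_def e_def k_def l_def h_ginner[OF that] d\<Phi>[OF that] by auto
  have nz: "dird v F (\<psi> z) \<noteq> 0" if "z \<in> V" "v \<noteq> 0" for v z
  proof
    assume "dird v F (\<psi> z) = 0"
    then have "frechet_derivative F (at (\<psi> z)) v = frechet_derivative F (at (\<psi> z)) 0"
      using linear_0[OF linear_dird[OF dF[OF that(1)]]] by (simp add: dird_def)
    then show False using injD[OF inj[of "\<psi> z"]] W(2) that by blast
  qed
  have posE: "S.E z > 0" if "z \<in> V" for z
  proof -
    have "dird a \<psi> z \<noteq> 0" using jac[OF that] by auto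
    then show ?thesis
      unfolding S.E_def d\<Phi>[OF that] by (intro pos_g S.\<Phi>_U that nz)
  qed
  have posD: "S.D z > 0" if "z \<in> V" for z
  proof -
    let ?p = "dird a \<psi> z" and ?q = "dird b \<psi> z"
    \<comment> \<open>The unnormalised second Gram-Schmidt vector: the squared length of its image
      is \<open>E D\<close>, so \<open>D\<close> is positive once this vector is nonzero.\<close>
    let ?v = "S.E z *\<^sub>R ?q - S.F z *\<^sub>R ?p"
    have eq: "S.E z * (?p $ 1 * ?q $ 2 - ?p $ 2 * ?q $ 1) = ?p $ 1 * ?v $ 2 - ?p $ 2 * ?v $ 1"
      by (simp add: algebra_simps)
    have "?v \<noteq> 0"
    proof
      assume v: "?v = 0"
      have "S.E z * (?p $ 1 * ?q $ 2 - ?p $ 2 * ?q $ 1) = 0" unfolding eq v by simp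
      then show False using jac[OF that] posE[OF that] by auto
    qed
    then have "0 < S.ip z (dird ?v F (\<psi> z)) (dird ?v F (\<psi> z))"
      by (intro pos_g S.\<Phi>_U that nz)
    also have "dird ?v F (\<psi> z) = S.E z *\<^sub>R S.X2 z - S.F z *\<^sub>R S.X1 z"
      unfolding d\<Phi>[OF that] linear_diff[OF linear_dird[OF dF[OF that]]]
        linear_scale[OF linear_dird[OF dF[OF that]]] ..
    also have "S.ip z (S.E z *\<^sub>R S.X2 z - S.F z *\<^sub>R S.X1 z) (S.E z *\<^sub>R S.X2 z - S.F z *\<^sub>R S.X1 z) = S.E z * S.D z"
      using S.ip_commute[OF that, of "S.X2 z" "S.X1 z"]
      by (simp add: S.D_def S.E_def S.F_def S.G_def power2_eq_square algebra_simps)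
    finally show ?thesis using posE[OF that] by (simp add: zero_less_mult_iff)
  qed
  let ?p = "dird a \<psi> x" and ?q = "dird b \<psi> x"
  let ?J = "?p $ 1 * ?q $ 2 - ?p $ 2 * ?q $ 1"
  have J: "?J \<noteq> 0" by (rule jac[OF V(2)])
  have hsym: "h x $ 2 $ 1 = h x $ 1 $ 2"
    unfolding h_def first_fundamental_form_nth F_def[symmetric]
    using ginner_commute[OF S.\<Phi>_U[OF V(2)]] by (simp add: \<Phi>_def)
  have "S.D x = ?J\<^sup>2 * det (h x)"
    unfolding S.D_def EFG[OF V(2)] e_def k_def l_def by (rule gram_det_2[OF hsym])
  then have "det (h x) \<noteq> 0" using posD[OF V(2)] by auto
  then obtain \<alpha> \<beta> where ab: "h x $ 2 $ 2 *\<^sub>R ambient_deriv g c' c f 1 1 (\<psi> x) - h x $ 1 $ 2 *\<^sub>R ambient_deriv g c' c f 1 2 (\<psi> x)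
      - h x $ 1 $ 2 *\<^sub>R ambient_deriv g c' c f 2 1 (\<psi> x) + h x $ 1 $ 1 *\<^sub>R ambient_deriv g c' c f 2 2 (\<psi> x) =
      \<alpha> *\<^sub>R dird (axis 1 1) F (\<psi> x) + \<beta> *\<^sub>R dird (axis 2 1) F (\<psi> x)"
    using minimal_tangent[OF minimal] S.\<Phi>_U[OF V(2)] unfolding h_def F_def \<Phi>_def by blast
  define A where "A i j = ambient_deriv g c' c f i j (\<psi> x)" for i j
  define Y where "Y i = dird (axis i 1) F (\<psi> x)" for i :: 2
  have hess: "covd \<Phi> u (dird v \<Phi>) x =
     (dird u \<psi> x $ 1 * dird v \<psi> x $ 1) *\<^sub>R A 1 1 + (dird u \<psi> x $ 1 * dird v \<psi> x $ 2) *\<^sub>R A 1 2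
   + (dird u \<psi> x $ 2 * dird v \<psi> x $ 1) *\<^sub>R A 2 1 + (dird u \<psi> x $ 2 * dird v \<psi> x $ 2) *\<^sub>R A 2 2
   + dird u (dird v \<psi>) x $ 1 *\<^sub>R Y 1 + dird u (dird v \<psi>) x $ 2 *\<^sub>R Y 2" for u v
    unfolding \<Phi>_def[abs_def] A_def ambient_deriv_eq F_def[symmetric] Y_def
    by (rule hessian_reparam[OF V W(2,3)])
  \<comment> \<open>Collects the second derivatives of \<psi>; they enter only through tangent
    vectors.\<close>
  define T where "T i = e x * dird b (dird b \<psi>) x $ i - k x * dird a (dird b \<psi>) x $ i
      - k x * dird b (dird a \<psi>) x $ i + l x * dird a (dird a \<psi>) x $ i" for i
  have "e x *\<^sub>R covd \<Phi> b S.X2 x - k x *\<^sub>R covd \<Phi> a S.X2 x - k x *\<^sub>R covd \<Phi> b S.X1 x + l x *\<^sub>R covd \<Phi> a S.X1 x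
    = (e x * (?q $ 1 * ?q $ 1) - k x * (?p $ 1 * ?q $ 1) - k x * (?q $ 1 * ?p $ 1) + l x * (?p $ 1 * ?p $ 1)) *\<^sub>R A 1 1
    + (e x * (?q $ 1 * ?q $ 2) - k x * (?p $ 1 * ?q $ 2) - k x * (?q $ 1 * ?p $ 2) + l x * (?p $ 1 * ?p $ 2)) *\<^sub>R A 1 2
    + (e x * (?q $ 2 * ?q $ 1) - k x * (?p $ 2 * ?q $ 1) - k x * (?q $ 2 * ?p $ 1) + l x * (?p $ 2 * ?p $ 1)) *\<^sub>R A 2 1
    + (e x * (?q $ 2 * ?q $ 2) - k x * (?p $ 2 * ?q $ 2) - k x * (?q $ 2 * ?p $ 2) + l x * (?p $ 2 * ?p $ 2)) *\<^sub>R A 2 2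
    + T 1 *\<^sub>R Y 1 + T 2 *\<^sub>R Y 2"
    unfolding hess T_def
    by (simp only: scaleR_add_left scaleR_add_right scaleR_diff_left scaleR_diff_right scaleR_scaleR) simp
  also have "\<dots> = ?J\<^sup>2 *\<^sub>R (h x $ 2 $ 2 *\<^sub>R A 1 1 - h x $ 1 $ 2 *\<^sub>R A 1 2 - h x $ 1 $ 2 *\<^sub>R A 2 1 + h x $ 1 $ 1 *\<^sub>R A 2 2)
    + T 1 *\<^sub>R Y 1 + T 2 *\<^sub>R Y 2"
    unfolding e_def k_def l_def cross_quadratic[OF hsym]
    by (simp add: scaleR_add_right scaleR_diff_right)
  also have "\<dots> = (?J\<^sup>2 * \<alpha> + T 1) *\<^sub>R Y 1 + (?J\<^sup>2 * \<beta> + T 2) *\<^sub>R Y 2"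
    using ab unfolding A_def[symmetric] Y_def[symmetric] by (simp add: algebra_simps)
  finally have "\<exists>\<alpha> \<beta>. S.E x *\<^sub>R covd \<Phi> b S.X2 x - S.F x *\<^sub>R covd \<Phi> a S.X2 x - S.F x *\<^sub>R covd \<Phi> b S.X1 x
      + S.G x *\<^sub>R covd \<Phi> a S.X1 x = \<alpha> *\<^sub>R S.X1 x + \<beta> *\<^sub>R S.X2 x"
    using change_basis_2[OF J, of "?J\<^sup>2 * \<alpha> + T 1" "Y 1" "?J\<^sup>2 * \<beta> + T 2" "Y 2"]
    unfolding EFG[OF V(2)] d\<Phi>[OF V(2)] Y_def dird_vec2[OF dF[OF V(2)], of ?p] dird_vec2[OF dF[OF V(2)], of ?q]
    by simp
  then obtain \<alpha>' \<beta>' where min': "S.E x *\<^sub>R covd \<Phi> b S.X2 x - S.F x *\<^sub>R covd \<Phi> a S.X2 x - S.F x *\<^sub>R covd \<Phi> b S.X1 x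
      + S.G x *\<^sub>R covd \<Phi> a S.X1 x = \<alpha>' *\<^sub>R S.X1 x + \<beta>' *\<^sub>R S.X2 x" by blast
  have "dird b (conn1 a b S.E S.F S.G) x - dird a (conn2 a b S.E S.F S.G) x \<le> sqrt (S.D x)"
    by (rule S.gauss_inequality[OF posE posD V(2) _ min']) (use sec in \<open>auto simp: \<Phi>_def\<close>)
  also have "dird b (conn1 a b S.E S.F S.G) x = dird b (conn1 a b e k l) x"
    by (rule dird_cong_open[OF V(1,2)]) (rule conn_cong[OF V(1) _ EFG])
  also have "dird a (conn2 a b S.E S.F S.G) x = dird a (conn2 a b e k l) x"
    by (rule dird_cong_open[OF V(1,2)]) (rule conn_cong[OF V(1) _ EFG])
  finally show ?thesis by (simp add: S.D_def EFG V(2))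
qed

end

section \<open>Gauss-Bonnet for a disk in polar coordinates\<close>

definition e_rad :: "real \<Rightarrow> real^2" where "e_rad t = vector [cos t, sin t]"
definition e_ang :: "real \<Rightarrow> real^2" where "e_ang t = vector [- sin t, cos t]"
definition polar :: "real \<times> real \<Rightarrow> real^2" where "polar x = fst x *\<^sub>R e_rad (snd x)"

lemma e_nth [simp]: "e_rad t $ 1 = cos t" "e_rad t $ 2 = sin t" "e_ang t $ 1 = - sin t" "e_ang t $ 2 = cos t"
  by (simp_all add: e_rad_def e_ang_def)

lemma e_rad_axis: "e_rad t = cos t *\<^sub>R axis 1 1 + sin t *\<^sub>R axis 2 1"
  and e_ang_axis: "e_ang t = (- sin t) *\<^sub>R axis 1 1 + cos t *\<^sub>R axis 2 1"
  by (simp_all add: vec_eq_iff forall_2 axis_def)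

lemma e_nonzero: "e_rad t \<noteq> 0" "e_ang t \<noteq> 0"
proof -
  have "\<not> (cos t = 0 \<and> sin t = 0)"
  proof
    assume "cos t = 0 \<and> sin t = 0"
    then have "cos t * cos t + sin t * sin t = 0" by simp
    then show False by simp
  qed
  then show "e_rad t \<noteq> 0" "e_ang t \<noteq> 0" by (auto simp: vec_eq_iff forall_2)
qed

lemma e_deriv:
  assumes "(s has_derivative s') (at x)"
  shows "((\<lambda>x. e_rad (s x)) has_derivative (\<lambda>v. s' v *\<^sub>R e_ang (s x))) (at x)"
    "((\<lambda>x. e_ang (s x)) has_derivative (\<lambda>v. s' v *\<^sub>R - e_rad (s x))) (at x)"
  unfolding e_rad_axis e_ang_axis
  by (auto intro!: derivative_eq_intros assms simp: algebra_simps)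

lemma polar_deriv: "(polar has_derivative (\<lambda>v. fst v *\<^sub>R e_rad (snd x) + (fst x * snd v) *\<^sub>R e_ang (snd x))) (at x)"
  unfolding polar_def
  by (auto intro!: derivative_eq_intros e_deriv simp: algebra_simps)

lemma dird_polar: "dird (1, 0) polar x = e_rad (snd x)" "dird (0, 1) polar x = fst x *\<^sub>R e_ang (snd x)"
  using dird_eqI[OF polar_deriv, of "(1,0)" x] dird_eqI[OF polar_deriv, of "(0,1)" x] by simp_all

lemma smooth_fst: "smooth_on S (fst :: real \<times> real \<Rightarrow> real)" and smooth_snd: "smooth_on S (snd :: real \<times> real \<Rightarrow> real)"
  by (intro smooth_on_bounded_linear bounded_linear_fst bounded_linear_snd)+

lemma smooth_e:
  assumes "open S" shows "smooth_on S (\<lambda>x::real\<times>real. e_rad (snd x))" "smooth_on S (\<lambda>x::real\<times>real. e_ang (snd x))"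
proof -
  have sc: "smooth_on S (\<lambda>x::real\<times>real. sin (snd x))" "smooth_on S (\<lambda>x::real\<times>real. cos (snd x))"
    by (rule smooth_on_compose[OF assms open_UNIV _ _ smooth_snd];
        auto simp: smooth_on_def differentiable_upto_sin_cos)+
  show "smooth_on S (\<lambda>x::real\<times>real. e_rad (snd x))" "smooth_on S (\<lambda>x::real\<times>real. e_ang (snd x))"
    unfolding e_rad_axis e_ang_axis
    by (intro smooth_on_add smooth_on_scaleR smooth_on_minus smooth_on_const sc assms)+
qed

lemma smooth_polar: "open S \<Longrightarrow> smooth_on S polar"
  unfolding polar_def[abs_def] by (intro smooth_on_scaleR smooth_fst smooth_e) 

lemma dird_shift:
  assumes "f differentiable (at (x + c))"
  shows "dird v (\<lambda>x. f (x + c)) x = dird v f (x + c)"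
proof -
  have "((\<lambda>x. x + c) has_derivative (\<lambda>v. v)) (at x)" by (auto intro!: derivative_eq_intros)
  from dird_eqI[OF has_derivative_compose[OF this dird_works[OF assms]]] show ?thesis by simp
qed

lemma dird_slice:
  fixes f :: "real \<times> real \<Rightarrow> real"
  assumes "f differentiable (at (r, t))"
  shows "((\<lambda>r. f (r, t)) has_vector_derivative dird (1, 0) f (r, t)) (at r)"
    "((\<lambda>t. f (r, t)) has_vector_derivative dird (0, 1) f (r, t)) (at t)"
proof -
  have l: "dird (h, 0) f (r, t) = h *\<^sub>R dird (1, 0) f (r, t)" "dird (0, h) f (r, t) = h *\<^sub>R dird (0, 1) f (r, t)" for h
    using linear_scale[OF linear_dird[OF assms], of h "(1, 0)"]
      linear_scale[OF linear_dird[OF assms], of h "(0, 1)"] by simp_all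
  have "((\<lambda>r. (r, t)) has_derivative (\<lambda>h. (h, 0))) (at r)" by (auto intro!: derivative_eq_intros)
  from has_derivative_compose[OF this dird_works[OF assms]]
  show "((\<lambda>r. f (r, t)) has_vector_derivative dird (1, 0) f (r, t)) (at r)"
    unfolding has_vector_derivative_def l[symmetric] .
  have "((\<lambda>t. (r, t)) has_derivative (\<lambda>h. (0, h))) (at t)" by (auto intro!: derivative_eq_intros)
  from has_derivative_compose[OF this dird_works[OF assms]]
  show "((\<lambda>t. f (r, t)) has_vector_derivative dird (0, 1) f (r, t)) (at t)"
    unfolding has_vector_derivative_def l[symmetric] .
qed

text \<open>The metric lives on the whole plane, the image of a stereographic chart, although only
  the unit disk is integrated over. This provides smoothness across the boundary circle, where the
  form is evaluated.\<close>

locale disk_metric =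
  fixes h :: "real^2 \<Rightarrow> real^2^2"
  assumes smooth_h: "smooth_on UNIV h"
    and sym_h: "h u $ 2 $ 1 = h u $ 1 $ 2"
    and pos_h: "v \<noteq> 0 \<Longrightarrow> v \<bullet> (h u *v v) > 0"
begin

definition hE where "hE x = dird (1, 0) polar x \<bullet> (h (polar x) *v dird (1, 0) polar x)"
definition hF where "hF x = dird (1, 0) polar x \<bullet> (h (polar x) *v dird (0, 1) polar x)"
definition hG where "hG x = dird (0, 1) polar x \<bullet> (h (polar x) *v dird (0, 1) polar x)"
text \<open>The coefficients with respect to the Euclidean unit fields, that is \<open>hF\<close>
  and \<open>hG\<close> without their powers of \<open>r\<close>. Unlike those they keep a positive
  determinant with \<open>hE\<close> at the centre.\<close>

definition mF where "mF x = e_rad (snd x) \<bullet> (h (polar x) *v e_ang (snd x))"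
definition mG where "mG x = e_ang (snd x) \<bullet> (h (polar x) *v e_ang (snd x))"
definition conn_rad where "conn_rad = conn1 (1, 0) (0, 1) hE hF hG"
definition conn_ang where "conn_ang = conn2 (1, 0) (0, 1) hE hF hG"

lemma hE_eq: "hE x = e_rad (snd x) \<bullet> (h (polar x) *v e_rad (snd x))"
  and hF_eq: "hF x = fst x * mF x" and hG_eq: "hG x = (fst x)\<^sup>2 * mG x"
  by (simp_all add: hE_def hF_def hG_def mF_def mG_def dird_polar matrix_vector_mult_scaleR power2_eq_square)

lemma det_h: "hE x * mG x - (mF x)\<^sup>2 = det (h (polar x))"
  unfolding hE_eq mF_def mG_def gram_det_2[OF sym_h] by (simp add: power2_eq_square)

lemma hE_pos: "hE x > 0" unfolding hE_eq by (rule pos_h[OF e_nonzero(1)])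

lemma det_h_pos: "det (h u) > 0"
proof -
  let ?m = "h u"
  \<comment> \<open>Gram-Schmidt applied to the two axes: \<open>m11\<close> times the second minus
    \<open>m12\<close> times the first.\<close>
  let ?v = "vector [- ?m $ 1 $ 2, ?m $ 1 $ 1] :: real^2"
  have m: "?m $ 1 $ 1 > 0"
  proof -
    have "axis 1 1 \<bullet> (?m *v axis 1 1) > 0" by (rule pos_h) (simp add: axis_eq_0_iff)
    then show ?thesis by (simp add: inner_vec_def matrix_vector_mult_def axis_def sum_2)
  qed
  then have "?v \<noteq> 0" by (auto simp: vec_eq_iff forall_2)
  then have "0 < ?v \<bullet> (?m *v ?v)" by (rule pos_h)
  also have "\<dots> = ?m $ 1 $ 1 * det ?m"
    by (simp add: inner_vec_def matrix_vector_mult_def sum_2 det_2 sym_h algebra_simps)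
  finally show ?thesis using m by (simp add: zero_less_mult_iff)
qed

lemma disc: "hE x * hG x - (hF x)\<^sup>2 = (fst x)\<^sup>2 * det (h (polar x))"
  unfolding hF_eq hG_eq det_h[symmetric] by (simp add: power2_eq_square algebra_simps)

lemma sqrt_disc: "sqrt (hE x * hG x - (hF x)\<^sup>2) = \<bar>fst x\<bar> * sqrt (det (h (polar x)))"
  unfolding disc by (simp add: real_sqrt_mult)

lemma smooth_h_polar: "smooth_on UNIV (\<lambda>x. h (polar x))"
  by (rule smooth_on_compose[OF open_UNIV open_UNIV _ smooth_h smooth_polar]) auto

lemma smooth_m: "smooth_on UNIV hE" "smooth_on UNIV mF" "smooth_on UNIV mG"
  unfolding hE_eq[abs_def] mF_def[abs_def] mG_def[abs_def]
  by (intro smooth_on_inner smooth_on_bilinear[OF bounded_bilinear_matrix_vector] smooth_h_polar smooth_e open_UNIV)+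

lemma smooth_EFG: "smooth_on UNIV hE" "smooth_on UNIV hF" "smooth_on UNIV hG"
  unfolding hF_eq[abs_def] hG_eq[abs_def] power2_eq_square
  by (intro smooth_on_mult smooth_m smooth_fst open_UNIV)+

lemma smooth_det: "smooth_on UNIV (\<lambda>x. det (h (polar x)))"
  unfolding det_h[symmetric] power2_eq_square
  by (intro smooth_on_diff smooth_on_mult smooth_m open_UNIV)

lemma smooth_sqrt_det: "smooth_on UNIV (\<lambda>x. sqrt (det (h (polar x))))"
  by (intro smooth_on_sqrt smooth_det open_UNIV det_h_pos)

text \<open>The angle runs through all reals, so there is no seam; the closing up of the circle
  enters only as periodicity.\<close>

definition V where "V = {x :: real \<times> real. fst x > 0}"

lemma open_V: "open V"
  unfolding V_def by (intro open_Collect_less continuous_intros)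

lemma smooth_conn: "smooth_on V conn_rad" "smooth_on V conn_ang"
proof -
  have sV: "smooth_on V hE" "smooth_on V hF" "smooth_on V hG"
    using smooth_EFG by (auto intro: smooth_on_subset)
  have pos: "hE x * hG x - (hF x)\<^sup>2 > 0" if "x \<in> V" for x
    unfolding disc using det_h_pos that by (auto simp: V_def)
  have s: "smooth_on V (\<lambda>x. sqrt (hE x * hG x - (hF x)\<^sup>2))"
    by (intro smooth_on_sqrt pos open_V) (auto simp: power2_eq_square intro!: smooth_on_diff smooth_on_mult sV open_V)
  show "smooth_on V conn_rad" "smooth_on V conn_ang"
    unfolding conn_rad_def conn_ang_def conn1_def[abs_def] conn2_def[abs_def]
    by (intro smooth_on_divide smooth_on_diff smooth_on_mult smooth_on_const sV smooth_on_dird s open_V;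
        use pos hE_pos in \<open>force intro!: mult_pos_pos\<close>)+
qed

text \<open>The formula for \<open>conn_ang\<close> with the common factor \<open>r\<close> cancelled, so that it extends
  continuously to the centre \<open>r = 0\<close>.\<close>

definition conn_ext :: "real \<times> real \<Rightarrow> real" where
  "conn_ext x = (hE x * (2 * mG x + fst x * dird (1, 0) mG x) - mF x * dird (0, 1) hE x) /
     (2 * hE x * sqrt (det (h (polar x))))"

lemma continuous_conn_ext: "continuous_on S conn_ext"
proof -
  have "smooth_on UNIV conn_ext"
    unfolding conn_ext_def[abs_def]
    by (intro smooth_on_divide smooth_on_diff smooth_on_add smooth_on_mult smooth_on_const smooth_m smooth_on_dird
        smooth_sqrt_det smooth_fst open_UNIV) (use hE_pos det_h_pos in \<open>force intro!: mult_pos_pos\<close>)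
  then show ?thesis using smooth_on_continuous smooth_on_subset by blast
qed

lemma conn_ext_eq:
  assumes "x \<in> V" shows "conn_ang x = conn_ext x"
proof -
  have r: "fst x > 0" using assms by (simp add: V_def)
  have fst': "(fst has_derivative fst) (at x)" for x :: "real \<times> real"
    by (rule bounded_linear.has_derivative[OF bounded_linear_fst has_derivative_ident])
  have "dird (1, 0) hG x = 2 * fst x * mG x + (fst x)\<^sup>2 * dird (1, 0) mG x"
    unfolding hG_eq[abs_def] power2_eq_square
    by (rule trans[OF dird_eqI[OF has_derivative_mult[OF has_derivative_mult[OF fst' fst']
        smooth_on_has_derivative[OF smooth_m(3) UNIV_I]]]]) (simp add: algebra_simps)
  then have "conn_ang x = (fst x * (hE x * (2 * mG x + fst x * dird (1, 0) mG x) - mF x * dird (0, 1) hE x)) /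
      (fst x * (2 * hE x * sqrt (det (h (polar x)))))"
    unfolding conn_ang_def conn2_def sqrt_disc unfolding hF_eq using r by (simp add: power2_eq_square algebra_simps)
  then show ?thesis unfolding conn_ext_def using r by (simp add: mult_divide_mult_cancel_left)
qed

text \<open>At the centre the metric is a fixed inner product, and \<open>conn_ext (0, t)\<close> is
  the speed at which the direction \<open>e_rad t\<close> turns when angles are measured by it.
  Integrating the corresponding angle function gives one full turn, whatever the inner
  product.\<close>

lemma conn_ext_0_integral: "integral {0..2*pi} (\<lambda>t. conn_ext (0, t)) = 2 * pi"
proof -
  let ?m = "h 0"
  define s where "s = sqrt (det ?m)"
  have s: "s > 0" "s * s = det ?m" using det_h_pos[of 0] by (auto simp: s_def)
  define e where "e t = e_rad t \<bullet> (?m *v e_rad t)" for t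
  define n where "n t = e_rad t \<bullet> (?m *v e_ang t)" for t
  define l where "l t = e_ang t \<bullet> (?m *v e_ang t)" for t
  have n': "e_ang t \<bullet> (?m *v e_rad t) = n t" for t
    by (simp add: n_def inner_vec_def matrix_vector_mult_def sum_2 sym_h algebra_simps)
  have p0: "polar (0, t) = 0" for t by (simp add: polar_def)
  have e_pos: "e t > 0" for t unfolding e_def by (rule pos_h[OF e_nonzero(1)])
  have det: "e t * l t - n t * n t = s * s" for t
    using det_h[of "(0, t)"] unfolding s(2) by (simp add: e_def n_def l_def hE_eq mF_def mG_def p0 power2_eq_square)
  note mv = bounded_bilinear.FDERIV[OF bounded_bilinear_matrix_vector has_derivative_const]
  have de: "(e has_real_derivative 2 * n t) (at t)" for t
    unfolding e_def[abs_def] has_field_derivative_def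
    by (rule has_derivative_eq_rhs[OF has_derivative_inner[OF e_deriv(1)[OF has_derivative_ident]
        mv[OF e_deriv(1)[OF has_derivative_ident]]]])
      (simp add: fun_eq_iff matrix_vector_mult_scaleR n' n_def[symmetric] algebra_simps)
  have dn: "(n has_real_derivative l t - e t) (at t)" for t
    unfolding n_def[abs_def] has_field_derivative_def
    by (rule has_derivative_eq_rhs[OF has_derivative_inner[OF e_deriv(1)[OF has_derivative_ident]
        mv[OF e_deriv(2)[OF has_derivative_ident]]]])
      (simp add: fun_eq_iff matrix_vector_mult_scaleR l_def e_def algebra_simps
        bounded_bilinear.minus_right[OF bounded_bilinear_matrix_vector])
  \<comment> \<open>At \<open>r = 0\<close> the term with \<open>dird (1, 0) mG\<close> has the
    factor 0 and \<open>dird (0, 1) hE\<close> is \<open>2 * n t\<close>. So the numerator is twice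
    the determinant \<open>e l - n^2 = s^2\<close>, the same for every \<open>t\<close>.\<close>
  have ext: "conn_ext (0, t) = s / e t" for t
  proof -
    have "(\<lambda>t. hE (0, t)) = e" by (simp add: fun_eq_iff hE_eq e_def p0)
    then have "(e has_vector_derivative dird (0, 1) hE (0, t)) (at t)"
      using dird_slice(2)[OF smooth_on_differentiable[OF smooth_m(1) UNIV_I], of 0 t] by simp
    then have "dird (0, 1) hE (0, t) = 2 * n t"
      using de[of t] by (metis has_real_derivative_iff_has_vector_derivative vector_derivative_at)
    then have "conn_ext (0, t) = (2 * (e t * l t - n t * n t)) / (2 * e t * s)"
      by (simp add: conn_ext_def hE_eq mF_def mG_def p0 e_def n_def l_def s_def algebra_simps)
    then show ?thesis unfolding det using s(1) e_pos[of t] by simp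
  qed
  \<comment> \<open>\<open>A t\<close> is the polar angle of \<open>S e\<^sub>t\<close> for the positive square root \<open>S\<close> of \<open>?m\<close>,
    which is proportional to \<open>?m + s I\<close>.\<close>
  define A where "A t = t + arctan (n t / (e t + s))" for t
  have dA: "(A has_real_derivative s / e t) (at t)" for t
  proof -
    have M: "e t + s > 0" using e_pos[of t] s by simp
    have "(A has_real_derivative 1 + (((l t - e t) * (e t + s) - n t * (2 * n t)) / ((e t + s) * (e t + s))) / (1 + (n t / (e t + s))\<^sup>2)) (at t)"
    proof -
      have "((\<lambda>t. e t + s) has_real_derivative 2 * n t) (at t)"
        using DERIV_add[OF de DERIV_const] by simp
      then have "((\<lambda>t. n t / (e t + s)) has_real_derivative
          ((l t - e t) * (e t + s) - n t * (2 * n t)) / ((e t + s) * (e t + s))) (at t)"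
        by (rule DERIV_divide[OF dn]) (use M in simp)
      from DERIV_add[OF DERIV_ident DERIV_chain2[OF DERIV_arctan this]]
      show ?thesis unfolding A_def[abs_def] by (simp only: divide_inverse mult.commute)
    qed
    also have "1 + (((l t - e t) * (e t + s) - n t * (2 * n t)) / ((e t + s) * (e t + s))) / (1 + (n t / (e t + s))\<^sup>2) = s / e t"
    proof -
      \<comment> \<open>Follows from \<open>e l - n^2 = s^2\<close>. The factor
        \<open>e + l + 2 s\<close> found here reappears in the numerator and cancels.\<close>
      have N: "(e t + s) * (e t + s) + n t * n t = e t * (e t + l t + 2 * s)"
        using det[of t] by (simp add: algebra_simps)
      have P: "e t + l t + 2 * s > 0"
      proof -
        have "e t * l t = s * s + n t * n t" using det[of t] by simp
        also have "\<dots> > 0" using s(1) by (simp add: add_pos_nonneg)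
        finally have "l t > 0" using e_pos[of t] by (simp add: zero_less_mult_iff)
        then show ?thesis using e_pos[of t] s by simp
      qed
      have "1 + (n t / (e t + s))\<^sup>2 = ((e t + s) * (e t + s) + n t * n t) / ((e t + s) * (e t + s))"
        using M by (simp add: power2_eq_square add_divide_distrib)
      then have "(((l t - e t) * (e t + s) - n t * (2 * n t)) / ((e t + s) * (e t + s))) / (1 + (n t / (e t + s))\<^sup>2)
          = ((l t - e t) * (e t + s) - n t * (2 * n t)) / (e t * (e t + l t + 2 * s))"
        using M by (simp add: N)
      also have "1 + \<dots> = (e t * (e t + l t + 2 * s) + ((l t - e t) * (e t + s) - n t * (2 * n t))) / (e t * (e t + l t + 2 * s))"
        using e_pos[of t] P by (simp add: add_divide_distrib)
      also have "e t * (e t + l t + 2 * s) + ((l t - e t) * (e t + s) - n t * (2 * n t)) = s * (e t + l t + 2 * s)"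
        using det[of t] by (simp add: algebra_simps)
      also have "s * (e t + l t + 2 * s) / (e t * (e t + l t + 2 * s)) = s / e t" using P by simp
      finally show ?thesis .
    qed
    finally show ?thesis .
  qed
  have "((\<lambda>t. s / e t) has_integral (A (2*pi) - A 0)) {0..2*pi}"
    by (rule fundamental_theorem_of_calculus)
      (use dA in \<open>auto simp: has_real_derivative_iff_has_vector_derivative[symmetric] intro: DERIV_subset\<close>)
  \<comment> \<open>The arctan term is the deviation of the turned vector from
    \<open>e_rad t\<close>, below a right angle since \<open>e + s > 0\<close>. It is periodic, so
    only the summand \<open>t\<close> contributes.\<close>
  moreover have "A (2*pi) - A 0 = 2 * pi"
    by (simp add: A_def n_def e_def e_rad_axis e_ang_axis)
  ultimately show ?thesis unfolding ext by (simp add: integral_unique)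
qed

lemma periodic: "dird v polar (x + (0, 2*pi)) = dird v polar x" "polar (x + (0, 2*pi)) = polar x"
proof -
  have e: "e_rad (t + 2*pi) = e_rad t" for t by (simp add: e_rad_axis)
  show p: "polar (x + (0, 2*pi)) = polar x" for x by (simp add: polar_def e)
  have "polar differentiable (at x)" for x using polar_deriv by (rule differentiableI)
  from dird_shift[of polar x "(0, 2*pi)" v, OF this]
  show "dird v polar (x + (0, 2*pi)) = dird v polar x" unfolding p by simp
qed

lemma conn_rad_periodic: "conn_rad (r, 2*pi) = conn_rad (r, 0)"
proof -
  have p: "hE (x + (0, 2*pi)) = hE x" "hF (x + (0, 2*pi)) = hF x" "hG (x + (0, 2*pi)) = hG x" for x
    by (simp_all add: hE_def hF_def hG_def periodic)
  have d: "dird v f (x + (0, 2*pi)) = dird v f x" if "smooth_on UNIV f" "\<And>x. f (x + (0, 2*pi)) = f x"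
    for v x and f :: "real \<times> real \<Rightarrow> real"
    using dird_shift[of f x "(0, 2*pi)" v, OF smooth_on_differentiable[OF that(1) UNIV_I]] unfolding that(2) by simp
  have "conn_rad ((r, 0) + (0, 2*pi)) = conn_rad (r, 0)"
    unfolding conn_rad_def conn1_def by (simp only: p d smooth_EFG)
  then show ?thesis by simp
qed

text \<open>Green's theorem on a rectangle in the \<open>(r, t)\<close> plane, by iterated
  integration and the fundamental theorem of calculus. The sides \<open>t = 0\<close> and
  \<open>t = 2 pi\<close> cancel by periodicity. The radius \<open>r\<close> stays positive because
  \<open>conn_rad\<close> and \<open>conn_ang\<close> are singular at the centre.\<close>

lemma integral_annulus:
  assumes r: "0 < r" "r \<le> 1"
    and ineq: "\<And>x. x \<in> V \<Longrightarrow> dird (0, 1) conn_rad x - dird (1, 0) conn_ang x \<le> sqrt (hE x * hG x - (hF x)\<^sup>2)"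
  shows "integral {0..2*pi} (\<lambda>t. conn_ext (r, t)) - integral {0..2*pi} (\<lambda>t. conn_ext (1, t))
    \<le> integral (cbox (r, 0) (1, 2*pi)) (\<lambda>x. fst x * sqrt (det (h (polar x))))"
proof -
  let ?B = "cbox (r, 0) (1, 2*pi)"
  have B: "?B \<subseteq> V" using r by (auto simp: V_def cbox_Pair_eq)
  have inV: "(a, b) \<in> V" if "a \<in> {r..1}" for a b using that r by (auto simp: V_def)
  have c: "continuous_on ?B (dird (0, 1) conn_rad)" "continuous_on ?B (dird (1, 0) conn_ang)"
    using smooth_on_continuous[OF smooth_on_dird[OF smooth_conn(1)]]
      smooth_on_continuous[OF smooth_on_dird[OF smooth_conn(2)]] B continuous_on_subset by blast+
  have c3: "continuous_on ?B (\<lambda>x. fst x * sqrt (det (h (polar x))))"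
    by (intro continuous_on_mult continuous_on_fst continuous_on_id
        continuous_on_subset[OF smooth_on_continuous[OF smooth_sqrt_det]] subset_UNIV)
  have 1: "integral ?B (dird (0, 1) conn_rad) = 0"
  proof -
    have "integral {0..2*pi} (\<lambda>t. dird (0, 1) conn_rad (a, t)) = 0" if "a \<in> {r..1}" for a
    proof -
      have "((\<lambda>t. dird (0, 1) conn_rad (a, t)) has_integral (conn_rad (a, 2*pi) - conn_rad (a, 0))) {0..2*pi}"
        by (rule fundamental_theorem_of_calculus)
          (auto intro!: has_vector_derivative_at_within dird_slice smooth_on_differentiable[OF smooth_conn(1)] inV[OF that])
      then show ?thesis by (simp add: conn_rad_periodic integral_unique)
    qed
    then have "integral {r..1} (\<lambda>a. integral {0..2*pi} (\<lambda>t. dird (0, 1) conn_rad (a, t))) = integral {r..1} (\<lambda>a. 0)"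
      by (rule integral_cong)
    then show ?thesis
      unfolding integral_prod_continuous[OF c(1)] by simp
  qed
  have 2: "integral ?B (dird (1, 0) conn_ang) = integral {0..2*pi} (\<lambda>t. conn_ext (1, t)) - integral {0..2*pi} (\<lambda>t. conn_ext (r, t))"
  proof -
    have "integral ?B (dird (1, 0) conn_ang) = integral {r..1} (\<lambda>a. integral {0..2*pi} (\<lambda>t. dird (1, 0) conn_ang (a, t)))"
      unfolding integral_prod_continuous[OF c(2)] by simp
    also have "\<dots> = integral {0..2*pi} (\<lambda>t. integral {r..1} (\<lambda>a. dird (1, 0) conn_ang (a, t)))"
      using integral_swap_continuous[of r 0 1 "2*pi" "\<lambda>a t. dird (1, 0) conn_ang (a, t)"] c(2) by simp
    also have "\<dots> = integral {0..2*pi} (\<lambda>t. conn_ext (1, t) - conn_ext (r, t))"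
    proof (rule integral_cong)
      fix t
      have "((\<lambda>a. dird (1, 0) conn_ang (a, t)) has_integral (conn_ang (1, t) - conn_ang (r, t))) {r..1}"
        by (rule fundamental_theorem_of_calculus[OF r(2)])
          (auto intro!: has_vector_derivative_at_within dird_slice smooth_on_differentiable[OF smooth_conn(2)] inV)
      then show "integral {r..1} (\<lambda>a. dird (1, 0) conn_ang (a, t)) = conn_ext (1, t) - conn_ext (r, t)"
        using r conn_ext_eq[OF inV] by (simp add: integral_unique)
    qed
    also have "\<dots> = integral {0..2*pi} (\<lambda>t. conn_ext (1, t)) - integral {0..2*pi} (\<lambda>t. conn_ext (r, t))"
      by (rule integral_diff; rule integrable_continuous_interval; rule continuous_on_compose2[OF continuous_conn_ext])
        (auto intro!: continuous_intros)
    finally show ?thesis .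
  qed
  have "integral ?B (\<lambda>x. dird (0, 1) conn_rad x - dird (1, 0) conn_ang x)
      \<le> integral ?B (\<lambda>x. fst x * sqrt (det (h (polar x))))"
  proof (rule integral_le)
    show "dird (0, 1) conn_rad x - dird (1, 0) conn_ang x \<le> fst x * sqrt (det (h (polar x)))" if "x \<in> ?B" for x
      using ineq[of x] B that unfolding sqrt_disc by (auto simp: V_def)
  qed (intro integrable_continuous continuous_on_diff c c3)+
  also have "integral ?B (\<lambda>x. dird (0, 1) conn_rad x - dird (1, 0) conn_ang x)
      = integral ?B (dird (0, 1) conn_rad) - integral ?B (dird (1, 0) conn_ang)"
    by (intro integral_diff integrable_continuous c)
  finally show ?thesis unfolding 1 2 by simp
qed

end

section \<open>Integration in polar coordinates\<close>

lemma vector2_eq: "vector [a, b] = a *\<^sub>R axis 1 1 + b *\<^sub>R (axis 2 1 :: real^2)"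
  by (simp add: vec_eq_iff forall_2 axis_def)

lemma Basis_real2: "(Basis :: (real^2) set) = {axis 1 1, axis 2 1}"
  by (auto simp: Basis_vec_def UNIV_2)

lemma axis_12: "axis 1 1 \<noteq> (axis 2 1 :: real^2)"
  by (simp add: axis_eq_axis)

text \<open>Iterated integrals live on pairs of reals, the area on \<open>real^2\<close>; agreement
  on boxes identifies the two Lebesgue measures.\<close>

lemma lborel_real2: "distr lborel borel (\<lambda>x. vector [fst x, snd x] :: real^2) = lborel"
proof (rule lborel_eqI[symmetric])
  let ?T = "\<lambda>x :: real \<times> real. vector [fst x, snd x] :: real^2"
  have [measurable]: "?T \<in> borel_measurable borel"
    unfolding vector2_eq by (intro borel_measurable_continuous_onI continuous_intros)
  fix l u :: "real^2" assume le: "\<And>b. b \<in> Basis \<Longrightarrow> l \<bullet> b \<le> u \<bullet> b"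
  have le': "l $ 1 \<le> u $ 1" "l $ 2 \<le> u $ 2"
    using le[of "axis 1 1"] le[of "axis 2 1"] by (auto simp: Basis_real2 inner_axis)
  have eq: "?T -` box l u = box (l $ 1) (u $ 1) \<times> box (l $ 2) (u $ 2)"
    by (auto simp: mem_box_cart forall_2)
  have "emeasure (distr lborel borel ?T) (box l u) = emeasure lborel (box (l $ 1) (u $ 1) \<times> box (l $ 2) (u $ 2))"
    by (subst emeasure_distr) (auto simp: eq)
  also have "\<dots> = emeasure (lborel \<Otimes>\<^sub>M lborel) (box (l $ 1) (u $ 1) \<times> box (l $ 2) (u $ 2))"
    by (simp add: lborel_prod)
  also have "\<dots> = emeasure lborel (box (l $ 1) (u $ 1)) * emeasure lborel (box (l $ 2) (u $ 2))"
    by (rule lborel.emeasure_pair_measure_Times) auto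
  also have "\<dots> = ennreal (u $ 1 - l $ 1) * ennreal (u $ 2 - l $ 2)"
    using le' by (simp add: box_real)
  also have "\<dots> = (\<Prod>b\<in>Basis. (u - l) \<bullet> b)"
    using le' axis_12 by (simp add: Basis_real2 inner_axis ennreal_mult)
  finally show "emeasure (distr lborel borel ?T) (box l u) = (\<Prod>b\<in>Basis. (u - l) \<bullet> b)" .
qed simp

lemma integral_real2:
  fixes \<phi> :: "real^2 \<Rightarrow> real"
  assumes "continuous_on UNIV \<phi>"
  shows "integral (cbox a b) \<phi> = integral (cbox (a $ 1, a $ 2) (b $ 1, b $ 2)) (\<lambda>x. \<phi> (vector [fst x, snd x]))"
proof -
  let ?T = "\<lambda>x :: real \<times> real. vector [fst x, snd x] :: real^2"
  have T: "?T \<in> borel_measurable lborel" "continuous_on UNIV ?T"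
    unfolding vector2_eq by (auto intro!: borel_measurable_continuous_onI continuous_intros)
  have ct: "continuous_on UNIV (\<lambda>x. \<phi> (?T x))" by (rule continuous_on_compose2[OF assms T(2)]) auto
  have m: "\<phi> \<in> borel_measurable borel" by (rule borel_measurable_continuous_onI[OF assms])
  have "integral (cbox a b) \<phi> = (LINT y:cbox a b|lborel. \<phi> y)"
    by (rule set_borel_integral_eq_integral(2)[symmetric], unfold set_integrable_def, rule borel_integrable_compact)
      (auto intro: continuous_on_subset[OF assms])
  also have "\<dots> = (LINT y|distr lborel borel ?T. indicator (cbox a b) y *\<^sub>R \<phi> y)"
    unfolding lborel_real2 set_lebesgue_integral_def ..
  also have "\<dots> = (LINT x|lborel. indicator (cbox a b) (?T x) *\<^sub>R \<phi> (?T x))"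
    using T(1) m by (intro integral_distr) auto
  also have "\<dots> = (LINT x:cbox (a $ 1, a $ 2) (b $ 1, b $ 2)|lborel. \<phi> (?T x))"
    unfolding set_lebesgue_integral_def
    by (intro Bochner_Integration.integral_cong)
      (auto simp: indicator_def mem_box_cart forall_2 cbox_Pair_eq)
  also have "\<dots> = integral (cbox (a $ 1, a $ 2) (b $ 1, b $ 2)) (\<lambda>x. \<phi> (?T x))"
    by (rule set_borel_integral_eq_integral(2), unfold set_integrable_def, rule borel_integrable_compact)
      (auto intro: continuous_on_subset[OF ct])
  finally show ?thesis .
qed

section \<open>Change of variables to polar coordinates\<close>

lemma norm_polar: "norm (polar x) = \<bar>fst x\<bar>"
proof -
  have "norm (e_rad t) = 1" for t
    by (simp add: norm_eq_sqrt_inner inner_vec_def sum_2)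
  then show ?thesis by (simp add: polar_def)
qed

lemma polar_inj:
  assumes "polar (r, t) = polar (r', t')" "0 < r" "0 < r'" "0 < t" "t < 2 * pi" "0 < t'" "t' < 2 * pi"
  shows "r = r' \<and> t = t'"
proof -
  have r: "r = r'" using norm_polar[of "(r, t)"] norm_polar[of "(r', t')"] assms by simp
  then have "e_rad t = e_rad t'" using assms by (simp add: polar_def)
  then have "sin t = sin t' \<and> cos t = cos t'" by (metis e_nth(1,2))
  then obtain n :: int where n: "t = t' + 2 * pi * n" unfolding sin_cos_eq_iff by auto
  then have "\<bar>2 * pi * real_of_int n\<bar> < 2 * pi" using assms by linarith
  then have "2 * pi * \<bar>real_of_int n\<bar> < 2 * pi * 1" by (simp add: abs_mult)
  then have "\<bar>real_of_int n\<bar> < 1" by (subst (asm) mult_less_cancel_left_pos) auto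
  then have "n = 0" by linarith
  then show ?thesis using n r by simp
qed

text \<open>A lower bound for the area suffices. The image of the open rectangle omits a slit and
  the inner disk, and this only makes the right side larger.\<close>

lemma integral_polar_le:
  fixes w :: "real^2 \<Rightarrow> real"
  assumes w: "continuous_on UNIV w" "\<And>u. w u \<ge> 0" and r: "0 < r" "r < 1"
  shows "ennreal (integral (cbox (r, 0) (1, 2 * pi)) (\<lambda>x. fst x * w (polar x))) \<le> (\<integral>\<^sup>+u\<in>ball 0 1. ennreal (w u) \<partial>lborel)"
proof -
  define a b :: "real^2" where "a = vector [r, 0]" and "b = vector [1, 2 * pi]"
  \<comment> \<open>The open rectangle: with angles strictly between 0 and 2 pi the polar map is
    injective.\<close>
  let ?S = "box a b"
  define P :: "real^2 \<Rightarrow> real^2" where "P y = polar (y $ 1, y $ 2)" for y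
  define P' where "P' y v = v $ 1 *\<^sub>R e_rad (y $ 2) + (y $ 1 * v $ 2) *\<^sub>R e_ang (y $ 2)" for y v :: "real^2"
  \<comment> \<open>A copy of \<open>w\<close> with values in \<open>real^1\<close>, the form of
    integrand that the change of variables theorem takes.\<close>
  define wv :: "real^2 \<Rightarrow> real^1" where "wv u = w u *\<^sub>R vec 1" for u
  have S: "0 < y $ 1" "r < y $ 1" "y $ 1 < 1" "0 < y $ 2" "y $ 2 < 2 * pi" if "y \<in> ?S" for y
    using that r by (auto simp: mem_box_cart forall_2 a_def b_def)
  have dP: "(P has_derivative P' y) (at y)" for y
  proof -
    have "((\<lambda>y::real^2. (y $ 1, y $ 2)) has_derivative (\<lambda>v. (v $ 1, v $ 2))) (at y)"
      by (intro has_derivative_Pair bounded_linear.has_derivative[OF bounded_linear_vec_nth has_derivative_ident])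
    from has_derivative_compose[OF this polar_deriv] show ?thesis
      by (simp add: P_def[abs_def] P'_def[abs_def])
  qed
  have det: "det (matrix (P' y)) = y $ 1" for y
  proof -
    have "det (matrix (P' y)) = y $ 1 * (cos (y $ 2) * cos (y $ 2)) + y $ 1 * (sin (y $ 2) * sin (y $ 2))"
      by (simp add: det_2 matrix_def P'_def axis_def algebra_simps)
    then show ?thesis unfolding distrib_left[symmetric] by simp
  qed
  have inj: "inj_on P ?S"
  proof (rule inj_onI)
    fix x y assume "x \<in> ?S" "y \<in> ?S" "P x = P y"
    then show "x = y" using polar_inj[of "x $ 1" "x $ 2" "y $ 1" "y $ 2"] S[of x] S[of y]
      by (simp add: P_def vec_eq_iff forall_2)
  qed
  have cP: "continuous_on UNIV P"
    using dP by (intro continuous_at_imp_continuous_on ballI has_derivative_continuous) auto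
  have cwP: "continuous_on UNIV (\<lambda>y. w (P y))"
    by (rule continuous_on_compose2[OF w(1) cP]) auto
  have c\<phi>: "continuous_on A (\<lambda>y. \<bar>y $ 1\<bar> *\<^sub>R wv (P y))" for A
    unfolding wv_def by (intro continuous_intros continuous_on_subset[OF cwP]) auto
  let ?\<phi> = "\<lambda>y. \<bar>det (matrix (P' y))\<bar> *\<^sub>R wv (P y)"
  have "?\<phi> absolutely_integrable_on cbox a b"
    unfolding det by (intro absolutely_integrable_continuous c\<phi>)
  then have "?\<phi> absolutely_integrable_on ?S"
    by (rule set_integrable_subset) (auto simp: box_subset_cbox)
  then have cov: "wv absolutely_integrable_on (P ` ?S)" "integral (P ` ?S) wv = integral ?S ?\<phi>"
    using has_absolute_integral_change_of_variables[OF _ _ inj, of P' wv "integral ?S ?\<phi>"] dP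
    by (auto intro: has_derivative_at_withinI)
  have wI: "wv integrable_on (P ` ?S)" using cov(1) by (rule set_lebesgue_integral_eq_integral(1))
  have w1: "(\<lambda>u. wv u $ 1) = w" by (simp add: wv_def)
  define I where "I = integral (P ` ?S) w"
  have "(w has_integral I) (P ` ?S)"
    using integrable_linear[OF wI bounded_linear_vec_nth[of 1]] unfolding o_def w1 I_def by (rule integrable_integral)
  then have nn: "(\<integral>\<^sup>+u. ennreal (w u) * indicator (P ` ?S) u \<partial>lborel) = ennreal I"
    by (intro nn_integral_has_integral_lebesgue' w)
  have "I = integral ?S ?\<phi> $ 1"
    using integral_component_eq_cart[OF wI, of 1] unfolding w1 I_def cov(2) .
  also have "\<dots> = integral (cbox a b) ?\<phi> $ 1" by (simp add: integral_open_interval)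
  also have "\<dots> = integral (cbox a b) (\<lambda>y. ?\<phi> y $ 1)"
    by (rule integral_component_eq_cart[symmetric]) (unfold det, intro integrable_continuous c\<phi>)
  also have "\<dots> = integral (cbox a b) (\<lambda>y. \<bar>y $ 1\<bar> * w (P y))"
    by (simp add: det wv_def)
  also have "\<dots> = integral (cbox (r, 0) (1, 2 * pi)) (\<lambda>x. \<bar>fst x\<bar> * w (polar x))"
  proof -
    have "continuous_on UNIV (\<lambda>y. \<bar>y $ 1\<bar> * w (P y))" by (intro continuous_intros cwP)
    from integral_real2[OF this, of a b] show ?thesis
      by (simp add: a_def b_def P_def)
  qed
  also have "\<dots> = integral (cbox (r, 0) (1, 2 * pi)) (\<lambda>x. fst x * w (polar x))"
    by (rule integral_cong) (use r in \<open>auto simp: cbox_Pair_eq\<close>)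
  finally have I: "I = integral (cbox (r, 0) (1, 2 * pi)) (\<lambda>x. fst x * w (polar x))" .
  have "P ` ?S \<subseteq> ball 0 1" using S(1,3) by (fastforce simp: P_def norm_polar)
  then have "(\<integral>\<^sup>+u. ennreal (w u) * indicator (P ` ?S) u \<partial>lborel) \<le> (\<integral>\<^sup>+u\<in>ball 0 1. ennreal (w u) \<partial>lborel)"
    by (intro nn_integral_mono mult_left_mono) (auto simp: indicator_def)
  then show ?thesis unfolding nn I .
qed

text \<open>The annulus inequality in the limit of inner radius 0: \<open>conn_ext\<close> is
  continuous up to the centre, so the inner boundary integrals tend to the one at radius 0, which is
  2 pi.\<close>

lemma (in disk_metric) gauss_bonnet_disk:
  assumes ineq: "\<And>x. x \<in> V \<Longrightarrow> dird (0, 1) conn_rad x - dird (1, 0) conn_ang x \<le> sqrt (hE x * hG x - (hF x)\<^sup>2)"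
  shows "ennreal (2 * pi - integral {0..2*pi} (\<lambda>t. conn_ext (1, t))) \<le> (\<integral>\<^sup>+u\<in>ball 0 1. ennreal (sqrt (det (h u))) \<partial>lborel)"
proof -
  define J where "J r = integral {0..2*pi} (\<lambda>t. conn_ext (r, t))" for r
  let ?A = "\<integral>\<^sup>+u\<in>ball 0 1. ennreal (sqrt (det (h u))) \<partial>lborel"
  have le: "ennreal (J r - J 1) \<le> ?A" if "0 < r" "r < 1" for r
  proof -
    have "smooth_on UNIV (\<lambda>u. h u $ 1 $ 1 * h u $ 2 $ 2 - h u $ 1 $ 2 * h u $ 2 $ 1)"
      by (intro smooth_on_diff smooth_on_mult smooth_on_vec_nth smooth_h open_UNIV)
    then have "continuous_on UNIV (\<lambda>u. sqrt (det (h u)))"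
      unfolding det_2 by (intro continuous_intros smooth_on_continuous)
    from integral_polar_le[OF this _ that] have
      "ennreal (integral (cbox (r, 0) (1, 2 * pi)) (\<lambda>x. fst x * sqrt (det (h (polar x))))) \<le> ?A"
      using det_h_pos by (simp add: less_imp_le)
    moreover have "J r - J 1 \<le> integral (cbox (r, 0) (1, 2 * pi)) (\<lambda>x. fst x * sqrt (det (h (polar x))))"
      unfolding J_def using that by (intro integral_annulus ineq) auto
    ultimately show ?thesis by (meson ennreal_leI order_trans)
  qed
  show ?thesis
  \<comment> \<open>The limit is taken among real numbers, so infinite area is split off
    first.\<close>
  proof (cases "?A = top")
    case False
    define a where "a = enn2real ?A"
    have A: "?A = ennreal a" "a \<ge> 0" using False by (simp_all add: a_def less_top)
    have "continuous_on {0..1} (\<lambda>r. integral (cbox 0 (2*pi)) (\<lambda>t. conn_ext (r, t)))"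
      by (rule integral_continuous_on_param) (use continuous_conn_ext in \<open>simp add: case_prod_eta\<close>)
    then have "(J \<longlongrightarrow> J 0) (at 0 within {0..1})"
      unfolding continuous_on_def J_def by simp
    then have "(J \<longlongrightarrow> J 0) (at_right 0)"
      by (simp add: at_within_Icc_at_right)
    then have "((\<lambda>r. J r - J 1) \<longlongrightarrow> J 0 - J 1) (at_right 0)" by (intro tendsto_intros)
    moreover have "\<forall>\<^sub>F r in at_right 0. J r - J 1 \<le> a"
      using eventually_at_right_real[of 0 1]
    proof (rule eventually_mono)
      fix r :: real assume "r \<in> {0<..<1}"
      then have "ennreal (J r - J 1) \<le> ?A" by (intro le) auto
      then show "J r - J 1 \<le> a" unfolding A(1) using A(2) by (simp add: ennreal_le_iff)
    qed simp
    ultimately have "J 0 - J 1 \<le> a"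
      by (rule tendsto_upperbound) simp
    then show ?thesis
      unfolding A(1) J_def conn_ext_0_integral by (rule ennreal_leI)
  qed simp
qed

section \<open>Stereographic charts\<close>

definition stereo_inv :: "real \<Rightarrow> real^2 \<Rightarrow> real^3" where
  "stereo_inv s u = vector [2 * u $ 1 / (u \<bullet> u + 1), 2 * u $ 2 / (u \<bullet> u + 1), s * (u \<bullet> u - 1) / (u \<bullet> u + 1)]"

lemma inner_real2: "(u :: real^2) \<bullet> v = u $ 1 * v $ 1 + u $ 2 * v $ 2"
  by (simp add: inner_vec_def sum_2)

lemma in_sphere3: "(p :: real^3) \<in> sphere 0 1 \<longleftrightarrow> (p $ 1)\<^sup>2 + (p $ 2)\<^sup>2 + (p $ 3)\<^sup>2 = 1"
  by (simp add: norm_eq_sqrt_inner inner_vec_def sum_3 power2_eq_square)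

lemma stereo_facts:
  assumes s: "s = 1 \<or> s = -1"
  shows stereo_inv_in: "stereo_inv s u \<in> chart_dom (stereographic_chart s)"
    and stereo_right: "coord (stereographic_chart s) (stereo_inv s u) = u"
    and stereo_left: "p \<in> chart_dom (stereographic_chart s) \<Longrightarrow> stereo_inv s (coord (stereographic_chart s) p) = p"
proof -
  have ss: "s * s = 1" using s by auto
  have n: "u \<bullet> u + 1 > 0" by (simp add: add_nonneg_pos)
  let ?n = "u \<bullet> u + 1"
  have "s * (s * (u \<bullet> u - 1) / ?n) = (u \<bullet> u - 1) / ?n" using ss by (simp add: mult.assoc[symmetric])
  then have w: "1 - s * (stereo_inv s u $ 3) = 2 / ?n"
    using n by (simp add: stereo_inv_def field_simps)
  have "(2 * u $ 1)\<^sup>2 + (2 * u $ 2)\<^sup>2 + (s * (u \<bullet> u - 1))\<^sup>2 = ?n\<^sup>2"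
    using ss by (simp add: power_mult_distrib power2_eq_square[of s] inner_real2) (simp add: power2_eq_square algebra_simps)
  then have "((2 * u $ 1)\<^sup>2 + (2 * u $ 2)\<^sup>2 + (s * (u \<bullet> u - 1))\<^sup>2) / ?n\<^sup>2 = 1" using n by simp
  then have "stereo_inv s u \<in> sphere 0 1"
    unfolding in_sphere3 by (simp add: stereo_inv_def power_divide add_divide_distrib)
  moreover have "stereo_inv s u \<noteq> axis 3 s"
  proof
    assume "stereo_inv s u = axis 3 s"
    then have "1 - s * (stereo_inv s u $ 3) = 0" using ss by (simp add: axis_def)
    then show False using w n by simp
  qed
  ultimately show "stereo_inv s u \<in> chart_dom (stereographic_chart s)"
    by (simp add: stereographic_chart_def)
  have "coord (stereographic_chart s) (stereo_inv s u) = vector [stereo_inv s u $ 1 / (2 / ?n), stereo_inv s u $ 2 / (2 / ?n)]"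
    by (simp add: stereographic_chart_def w)
  also have "\<dots> = u" using n by (simp add: vec_eq_iff forall_2 stereo_inv_def)
  finally show "coord (stereographic_chart s) (stereo_inv s u) = u" .
  assume "p \<in> chart_dom (stereographic_chart s)"
  then have p: "(p $ 1)\<^sup>2 + (p $ 2)\<^sup>2 + (p $ 3)\<^sup>2 = 1" "p \<noteq> axis 3 s"
    unfolding stereographic_chart_def using in_sphere3[of p] by auto
  define w where "w = 1 - s * p $ 3"
  have "w \<noteq> 0"
  proof
    assume "w = 0"
    then have "s * (s * p $ 3) = s * 1" by (simp add: w_def)
    then have p3: "p $ 3 = s" using ss by (simp add: mult.assoc[symmetric])
    then have "(p $ 1)\<^sup>2 + (p $ 2)\<^sup>2 = 0" using p(1) ss by (simp add: power2_eq_square)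
    then have "p $ 1 = 0" "p $ 2 = 0" by (simp_all add: sum_power2_eq_zero_iff)
    then have "p = axis 3 s" using p3 by (simp add: vec_eq_iff forall_3 axis_def)
    then show False using p(2) by simp
  qed
  define v :: "real^2" where "v = vector [p $ 1 / w, p $ 2 / w]"
  have c: "coord (stereographic_chart s) p = v" by (simp add: stereographic_chart_def v_def w_def)
  have "v \<bullet> v = ((p $ 1)\<^sup>2 + (p $ 2)\<^sup>2) / (w * w)"
    by (simp add: v_def inner_real2 add_divide_distrib power2_eq_square)
  also have "(p $ 1)\<^sup>2 + (p $ 2)\<^sup>2 = (1 + s * p $ 3) * w"
    using p(1) ss by (simp add: w_def algebra_simps power2_eq_square)
      (metis (no_types, opaque_lifting) mult.left_commute mult.right_neutral mult.assoc)
  finally have vv: "v \<bullet> v = (1 + s * p $ 3) / w" using \<open>w \<noteq> 0\<close> by simp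
  have v1: "v \<bullet> v + 1 = 2 / w" "v \<bullet> v - 1 = 2 * s * p $ 3 / w"
    using \<open>w \<noteq> 0\<close> unfolding vv by (simp_all add: field_simps) (simp_all add: w_def)
  have "stereo_inv s v $ 1 = p $ 1" "stereo_inv s v $ 2 = p $ 2" "stereo_inv s v $ 3 = p $ 3"
    unfolding stereo_inv_def v1 using \<open>w \<noteq> 0\<close> ss by (simp_all add: v_def mult.assoc[symmetric])
  then show "stereo_inv s (coord (stereographic_chart s) p) = p"
    unfolding c by (simp add: vec_eq_iff forall_3)
qed

lemma chart_inv_stereo:
  assumes "s = 1 \<or> s = -1" shows "chart_inv (stereographic_chart s) = stereo_inv s"
proof
  fix u
  show "chart_inv (stereographic_chart s) u = stereo_inv s u"
    unfolding chart_inv_def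
  proof (rule inv_into_f_eq)
    show "inj_on (coord (stereographic_chart s)) (chart_dom (stereographic_chart s))"
      by (rule inj_on_inverseI[where g="stereo_inv s"]) (rule stereo_left[OF assms])
  qed (rule stereo_inv_in[OF assms] stereo_right[OF assms])+
qed

lemma chart_img_stereo: "s = 1 \<or> s = -1 \<Longrightarrow> chart_img (stereographic_chart s) = UNIV"
  unfolding chart_img_def using stereo_inv_in stereo_right by (metis UNIV_eq_I imageI)

lemma continuous_stereo_inv: "continuous_on UNIV (stereo_inv s)"
proof -
  have "stereo_inv s u = (2 * u $ 1 / (u \<bullet> u + 1)) *\<^sub>R axis 1 1 + (2 * u $ 2 / (u \<bullet> u + 1)) *\<^sub>R axis 2 1
      + (s * (u \<bullet> u - 1) / (u \<bullet> u + 1)) *\<^sub>R axis 3 1" for u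
    by (simp add: stereo_inv_def vec_eq_iff forall_3 axis_def)
  then have eq: "stereo_inv s = (\<lambda>u. (2 * u $ 1 / (u \<bullet> u + 1)) *\<^sub>R axis 1 1 + (2 * u $ 2 / (u \<bullet> u + 1)) *\<^sub>R axis 2 1
      + (s * (u \<bullet> u - 1) / (u \<bullet> u + 1)) *\<^sub>R axis 3 1)" by (rule ext)
  have "(u :: real^2) \<bullet> u + 1 \<noteq> 0" for u
    using inner_ge_zero[of u] by linarith
  then show ?thesis unfolding eq by (intro continuous_intros) auto
qed

lemma stereo_inv_antipodal_chart:
  assumes "r > 0" shows "stereo_inv (- s) (polar (r, t)) = stereo_inv s (polar (1 / r, t))"
proof -
  have pp: "polar (r, t) \<bullet> polar (r, t) = r * r" for r
    by (simp add: polar_def inner_real2 algebra_simps) (simp add: distrib_left[symmetric])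
  have n: "r * r + 1 \<noteq> 0" using assms by (metis add_pos_pos mult_pos_pos less_irrefl zero_less_one)
  have r: "1 / r * (1 / r) + 1 = (r * r + 1) / (r * r)" "1 / r * (1 / r) - 1 = (1 - r * r) / (r * r)"
    using assms by (simp_all add: field_simps)
  show ?thesis
    unfolding vec_eq_iff forall_3 stereo_inv_def pp r
    using assms n by (simp add: polar_def divide_simps) (simp add: algebra_simps)
qed

text \<open>The open unit disk parametrises the open hemisphere away from the projection pole, so
  the two disks have disjoint images on the sphere.\<close>

lemma stereo_inv_ball: "u \<in> ball 0 1 \<Longrightarrow> s * s = 1 \<Longrightarrow> s * stereo_inv s u $ 3 < 0"
proof -
  assume u: "u \<in> ball 0 1" and s: "s * s = 1"
  have "u \<bullet> u < 1" using u by (simp add: norm_eq_sqrt_inner)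
  moreover have "s * stereo_inv s u $ 3 = (s * s) * (u \<bullet> u - 1) / (u \<bullet> u + 1)"
    by (simp add: stereo_inv_def)
  ultimately show ?thesis
    using s inner_ge_zero[of u] by (simp add: divide_neg_pos add_nonneg_pos del: inner_ge_zero)
qed

section \<open>The induced metric of a minimal sphere\<close>

text \<open>\<open>ennreal\<close> sends negative numbers to 0, so for summands of unknown sign only
  an inequality holds; it has the direction required for adding the bounds of the two disks.\<close>

lemma ennreal_add_le: "ennreal (a + b) \<le> ennreal a + ennreal b"
proof -
  have "ennreal (a + b) \<le> ennreal (max 0 a + max 0 b)" by (rule ennreal_leI) auto
  also have "\<dots> = ennreal a + ennreal b" by (subst ennreal_plus) (auto simp: max_def ennreal_neg)
  finally show ?thesis .
qed

locale minimal_sphere =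
  fixes M :: "'a topology" and A :: "('a, 3) chart set" and g :: "('a, 3) metric" and f :: "real^3 \<Rightarrow> 'a"
  assumes complete: "complete_riemannian_manifold M A g"
    and curv: "sectional_curvature_between A g 0 1"
    and minimal: "minimal_immersion sphere2 sphere2_atlas M A g f"
begin

lemma manifold: "smooth_manifold M A" and metric: "riemannian_metric A g"
  using complete by (auto simp: complete_riemannian_manifold_def riemannian_manifold_def)

lemma immersion: "immersion sphere2 sphere2_atlas M A f"
  using minimal by (simp add: minimal_immersion_def)

lemma metric_chart: "d \<in> A \<Longrightarrow> metric_chart g d (chart_img d)"
  using manifold metric
  by unfold_locales (auto simp: smooth_manifold_def is_chart_def riemannian_metric_def)

abbreviation c where "c s \<equiv> stereographic_chart s"

definition W where "W s d = {u. f (stereo_inv s u) \<in> chart_dom d}"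

lemma c_in: "s = 1 \<or> s = -1 \<Longrightarrow> c s \<in> sphere2_atlas"
  by (auto simp: sphere2_atlas_def)

lemma W_eq:
  assumes s: "s = 1 \<or> s = -1"
  shows "coord (c s) ` (chart_dom (c s) \<inter> f -` chart_dom d) = W s d"
proof (intro equalityI subsetI)
  fix u assume "u \<in> W s d"
  then show "u \<in> coord (c s) ` (chart_dom (c s) \<inter> f -` chart_dom d)"
    using stereo_inv_in[OF s, of u] stereo_right[OF s, of u] by (intro image_eqI[of _ _ "stereo_inv s u"]) (auto simp: W_def)
qed (use stereo_left[OF s] in \<open>auto simp: W_def\<close>)

lemma sphere_stereo: "s = 1 \<or> s = -1 \<Longrightarrow> stereo_inv s u \<in> sphere 0 1"
  using stereo_inv_in[of s u] by (simp add: stereographic_chart_def)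

lemma open_W:
  assumes s: "s = 1 \<or> s = -1" and d: "d \<in> A"
  shows "open (W s d)"
proof -
  have "continuous_map euclidean sphere2 (stereo_inv s)"
    using continuous_stereo_inv sphere_stereo[OF s]
    by (auto simp: continuous_map_in_subtopology)
  moreover have "continuous_map sphere2 M f"
    using immersion by (simp add: immersion_def smooth_map_def)
  ultimately have "continuous_map euclidean M (f \<circ> stereo_inv s)" by (rule continuous_map_compose)
  moreover have "openin M (chart_dom d)"
    using manifold d by (auto simp: smooth_manifold_def is_chart_def)
  ultimately have "openin euclidean {u \<in> topspace euclidean. (f \<circ> stereo_inv s) u \<in> chart_dom d}"
    by (rule openin_continuous_map_preimage)
  then show ?thesis by (simp add: W_def)
qed

lemma smooth_rep:
  assumes s: "s = 1 \<or> s = -1" and d: "d \<in> A"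
  shows "smooth_on (W s d) (local_rep (c s) d f)"
  using immersion d c_in[OF s] unfolding immersion_def smooth_map_def W_eq[OF s, symmetric] by blast

lemma rep_in:
  assumes s: "s = 1 \<or> s = -1"
  shows "local_rep (c s) d f ` W s d \<subseteq> chart_img d"
  by (auto simp: local_rep_def chart_inv_stereo[OF s] W_def chart_img_def)

lemma rep_eq: "s = 1 \<or> s = -1 \<Longrightarrow> local_rep (c s) d f u = coord d (f (stereo_inv s u))"
  by (simp add: local_rep_def chart_inv_stereo)

lemma inj_rep:
  assumes s: "s = 1 \<or> s = -1" and d: "d \<in> A" and u: "u \<in> W s d"
  shows "inj (frechet_derivative (local_rep (c s) d f) (at u))"
proof -
  have "stereo_inv s u \<in> chart_dom (c s) \<inter> f -` chart_dom d"
    using u stereo_inv_in[OF s] by (simp add: W_def)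
  then have "inj (frechet_derivative (local_rep (c s) d f) (at (coord (c s) (stereo_inv s u))))"
    using immersion d c_in[OF s] unfolding immersion_def by blast
  then show ?thesis by (simp add: stereo_right[OF s])
qed

lemma mean_curvature_0:
  assumes s: "s = 1 \<or> s = -1" and d: "d \<in> A" and u: "u \<in> W s d"
  shows "mean_curvature g (c s) d f u = 0"
proof -
  have "stereo_inv s u \<in> chart_dom (c s) \<inter> f -` chart_dom d"
    using u stereo_inv_in[OF s] by (simp add: W_def)
  then have "mean_curvature g (c s) d f (coord (c s) (stereo_inv s u)) = 0"
    using minimal d c_in[OF s] unfolding minimal_immersion_def by blast
  then show ?thesis by (simp add: stereo_right[OF s])
qed

lemma ex_W:
  assumes s: "s = 1 \<or> s = -1" shows "\<exists>d\<in>A. u \<in> W s d"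
proof -
  have "continuous_map sphere2 M f"
    using immersion by (simp add: immersion_def smooth_map_def)
  then have "f (stereo_inv s u) \<in> topspace M"
    using continuous_map_image_subset_topspace sphere_stereo[OF s, of u] by fastforce
  then show ?thesis using manifold by (auto simp: smooth_manifold_def W_def)
qed

lemma inj_coord: "d \<in> A \<Longrightarrow> inj_on (coord d) (chart_dom d)"
proof -
  assume d: "d \<in> A"
  then have "openin M (chart_dom d)"
    "homeomorphic_map (subtopology M (chart_dom d)) (top_of_set (chart_img d)) (coord d)"
    using manifold by (auto simp: smooth_manifold_def is_chart_def)
  then show ?thesis
    using homeomorphic_imp_injective_map topspace_subtopology_subset openin_subset by metis
qed

text \<open>The chain rule for the transition map meets the transformation law of the metric. This
  tames the choice of target chart in \<open>induced_metric\<close>, which may vary wildly with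
  \<open>u\<close>: on each \<open>W s d\<close> the fixed chart \<open>d\<close> can be used
  instead.\<close>

lemma first_fundamental_form_indep:
  assumes s: "s = 1 \<or> s = -1" and d: "d \<in> A" "d' \<in> A" and u: "u \<in> W s d" "u \<in> W s d'"
  shows "first_fundamental_form g (c s) d f u = first_fundamental_form g (c s) d' f u"
proof -
  let ?F = "local_rep (c s) d f" and ?F' = "local_rep (c s) d' f"
  let ?p = "f (stereo_inv s u)"
  have p: "?p \<in> chart_dom d \<inter> chart_dom d'" using u by (auto simp: W_def)
  have "smooth_on (coord d ` (chart_dom d \<inter> chart_dom d')) (transition d d')"
    using manifold d by (auto simp: smooth_manifold_def)
  then have dT: "transition d d' differentiable (at (?F u))"
    using p by (intro smooth_on_differentiable) (auto simp: rep_eq[OF s])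
  have dF: "?F differentiable (at u)" using smooth_rep[OF s d(1)] u(1) smooth_on_differentiable by blast
  have "?F' v = transition d d' (?F v)" if "v \<in> W s d \<inter> W s d'" for v
    using that inv_into_f_f[OF inj_coord[OF d(1)]]
    by (simp add: rep_eq[OF s]) (simp add: local_rep_def chart_inv_def W_def)
  note T = this
  have D: "dird v ?F' u = frechet_derivative (transition d d') (at (?F u)) (dird v ?F u)" for v
  proof -
    have "dird v ?F' u = dird v (\<lambda>v. transition d d' (?F v)) u"
      by (rule dird_cong_open[OF open_Int[OF open_W[OF s d(1)] open_W[OF s d(2)]]]) (use u T in auto)
    also have "\<dots> = dird (dird v ?F u) (transition d d') (?F u)" by (rule dird_compose[OF dF dT])
    finally show ?thesis by (simp add: dird_def)
  qed
  have "ginner g d (coord d ?p) v w = ginner g d' (coord d' ?p)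
      (frechet_derivative (transition d d') (at (coord d ?p)) v) (frechet_derivative (transition d d') (at (coord d ?p)) w)" for v w
    using metric d p unfolding riemannian_metric_def Let_def by blast
  then show ?thesis
    by (simp add: first_fundamental_form_def pderiv_at_eq_dird D rep_eq[OF s])
qed

section \<open>The induced metric on the two coordinate planes\<close>

definition h where "h s = induced_metric A g f (c s)"

lemma h_eq:
  assumes s: "s = 1 \<or> s = -1" and d: "d \<in> A" "u \<in> W s d"
  shows "h s u = first_fundamental_form g (c s) d f u"
proof -
  let ?d = "SOME d. d \<in> A \<and> f (chart_inv (c s) u) \<in> chart_dom d"
  have "?d \<in> A \<and> f (chart_inv (c s) u) \<in> chart_dom ?d"
    by (rule someI[of _ d]) (use d in \<open>auto simp: W_def chart_inv_stereo[OF s]\<close>)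
  then have "?d \<in> A" "u \<in> W s ?d" by (auto simp: W_def chart_inv_stereo[OF s])
  then show ?thesis
    unfolding h_def induced_metric_def using first_fundamental_form_indep[OF s _ d(1) _ d(2)] by blast
qed

lemma h_ginner:
  assumes s: "s = 1 \<or> s = -1" and d: "d \<in> A" "u \<in> W s d"
  shows "v \<bullet> (h s u *v w) = ginner g d (local_rep (c s) d f u) (dird v (local_rep (c s) d f) u) (dird w (local_rep (c s) d f) u)"
proof -
  interpret metric_chart g d "chart_img d" by (rule metric_chart[OF d(1)])
  show ?thesis unfolding h_eq[OF s d]
    by (rule first_fundamental_form_ginner)
      (use smooth_rep[OF s d(1)] d(2) smooth_on_differentiable in blast)
qed

lemma disk_metric_h:
  assumes s: "s = 1 \<or> s = -1" shows "disk_metric (h s)"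
proof
  show "smooth_on UNIV (h s)"
  proof (rule smooth_on_local)
    fix u
    obtain d where d: "d \<in> A" "u \<in> W s d" using ex_W[OF s] by blast
    interpret metric_chart g d "chart_img d" by (rule metric_chart[OF d(1)])
    note o = open_W[OF s d(1)]
    have "smooth_on (W s d) (first_fundamental_form g (c s) d f)"
      unfolding first_fundamental_form_def[abs_def] pderiv_at_eq_dird
      by (intro smooth_on_vec smooth_ginner o rep_in[OF s] smooth_rep[OF s d(1)] smooth_on_dird)
    then have "smooth_on (W s d) (h s)"
      by (rule smooth_on_cong[OF o, rotated]) (simp add: h_eq[OF s d(1)])
    then show "\<exists>T. open T \<and> u \<in> T \<and> smooth_on T (h s)" using o d(2) by blast
  qed
next
  fix u
  obtain d where d: "d \<in> A" "u \<in> W s d" using ex_W[OF s] by blast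
  interpret metric_chart g d "chart_img d" by (rule metric_chart[OF d(1)])
  have U: "local_rep (c s) d f u \<in> chart_img d" using rep_in[OF s] d(2) by blast
  show "h s u $ 2 $ 1 = h s u $ 1 $ 2"
    unfolding h_eq[OF s d] first_fundamental_form_nth by (rule ginner_commute[OF U])
  fix v :: "real^2" assume "v \<noteq> 0"
  have dF: "local_rep (c s) d f differentiable (at u)"
    using smooth_rep[OF s d(1)] d(2) smooth_on_differentiable by blast
  have "dird v (local_rep (c s) d f) u \<noteq> 0"
  proof
    assume "dird v (local_rep (c s) d f) u = 0"
    then have "frechet_derivative (local_rep (c s) d f) (at u) v = frechet_derivative (local_rep (c s) d f) (at u) 0"
      using linear_0[OF linear_dird[OF dF]] by (simp add: dird_def)
    then show False using injD[OF inj_rep[OF s d]] \<open>v \<noteq> 0\<close> by blast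
  qed
  then show "v \<bullet> (h s u *v v) > 0"
    unfolding h_ginner[OF s d] by (rule pos_g[OF U])
qed

text \<open>The passage from local to global. Near \<open>polar x\<close> the coefficients of
  \<open>h s\<close> agree with those computed in one target chart \<open>d\<close>, on an open set,
  so their derivatives agree as well and the inequality in the chart carries over.\<close>

lemma curvature_bound:
  assumes s: "s = 1 \<or> s = -1" and x: "fst x > 0"
  shows "dird (0, 1) (disk_metric.conn_rad (h s)) x - dird (1, 0) (disk_metric.conn_ang (h s)) x
    \<le> sqrt (disk_metric.hE (h s) x * disk_metric.hG (h s) x - (disk_metric.hF (h s) x)\<^sup>2)"
proof -
  interpret H: disk_metric "h s" by (rule disk_metric_h[OF s])
  obtain d where d: "d \<in> A" "polar x \<in> W s d" using ex_W[OF s] by blast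
  interpret metric_chart g d "chart_img d" by (rule metric_chart[OF d(1)])
  let ?V = "H.V \<inter> polar -` W s d"
  have "continuous_on UNIV polar" by (rule smooth_on_continuous[OF smooth_polar[OF open_UNIV]])
  then have oV: "open ?V"
    using open_W[OF s d(1)] H.open_V by (auto intro: open_vimage)
  have xV: "x \<in> ?V" using x d(2) by (simp add: H.V_def)
  let ?h = "\<lambda>x. first_fundamental_form g (c s) d f (polar x)"
  let ?e = "\<lambda>x. dird (1, 0) polar x \<bullet> (?h x *v dird (1, 0) polar x)"
  let ?k = "\<lambda>x. dird (1, 0) polar x \<bullet> (?h x *v dird (0, 1) polar x)"
  let ?l = "\<lambda>x. dird (0, 1) polar x \<bullet> (?h x *v dird (0, 1) polar x)"
  have eq: "H.hE z = ?e z" "H.hF z = ?k z" "H.hG z = ?l z" if "z \<in> ?V" for z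
    using that by (simp_all add: H.hE_def H.hF_def H.hG_def h_eq[OF s d(1)])
  have "dird (0, 1) (conn1 (1, 0) (0, 1) ?e ?k ?l) x - dird (1, 0) (conn2 (1, 0) (0, 1) ?e ?k ?l) x
      \<le> sqrt (?e x * ?l x - (?k x)\<^sup>2)"
  proof (rule gauss_inequality_reparam[OF oV xV smooth_polar[OF oV] open_W[OF s d(1)] _
        smooth_rep[OF s d(1)] rep_in[OF s] inj_rep[OF s d(1)] mean_curvature_0[OF s d]])
    show "polar ` ?V \<subseteq> W s d" by auto
    show "dird (1, 0) polar z $ 1 * dird (0, 1) polar z $ 2 - dird (1, 0) polar z $ 2 * dird (0, 1) polar z $ 1 \<noteq> 0"
      if "z \<in> ?V" for z
    proof -
      have "dird (1, 0) polar z $ 1 * dird (0, 1) polar z $ 2 - dird (1, 0) polar z $ 2 * dird (0, 1) polar z $ 1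
        = fst z * (cos (snd z) * cos (snd z)) + fst z * (sin (snd z) * sin (snd z))"
        by (simp add: dird_polar)
      then show ?thesis unfolding distrib_left[symmetric] using that by (simp add: H.V_def)
    qed
    show "sectional_curvature g d (local_rep (c s) d f (polar x)) v w \<le> 1"
      if "v \<noteq> w" "independent {v, w}" for v w
      using curv d that rep_in[OF s, of d] unfolding sectional_curvature_between_def by blast
  qed
  moreover have "dird (0, 1) H.conn_rad x = dird (0, 1) (conn1 (1, 0) (0, 1) ?e ?k ?l) x"
    unfolding H.conn_rad_def
    by (rule dird_cong_open[OF oV xV]) (rule conn_cong(1)[OF oV _ eq])
  moreover have "dird (1, 0) H.conn_ang x = dird (1, 0) (conn2 (1, 0) (0, 1) ?e ?k ?l) x"
    unfolding H.conn_ang_def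
    by (rule dird_cong_open[OF oV xV]) (rule conn_cong(2)[OF oV _ eq])
  ultimately show ?thesis using eq[OF xV] by simp
qed

text \<open>Composing with \<open>r -> 1/r\<close> multiplies the radial derivative of the surface
  by \<open>- 1 / r^2\<close> and leaves the angular one alone; each radial factor in
  \<open>hE\<close>, \<open>hF\<close>, \<open>hG\<close> contributes this once. The two
  stereographic parametrisations are compared after mapping into a common target chart.\<close>

lemma metric_inversion:
  assumes s: "s = 1 \<or> s = -1" and x: "r > 0"
  shows "disk_metric.hE (h (- s)) (r, t) = disk_metric.hE (h s) (1 / r, t) / r ^ 4"
    "disk_metric.hF (h (- s)) (r, t) = - disk_metric.hF (h s) (1 / r, t) / r\<^sup>2"
    "disk_metric.hG (h (- s)) (r, t) = disk_metric.hG (h s) (1 / r, t)"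
proof -
  have s': "- s = 1 \<or> - s = -1" using s by auto
  interpret H1: disk_metric "h s" by (rule disk_metric_h[OF s])
  interpret H2: disk_metric "h (- s)" by (rule disk_metric_h[OF s'])
  define inv where "inv = (\<lambda>x :: real \<times> real. (1 / fst x, snd x))"
  define \<Phi> where "\<Phi> s d x = local_rep (c s) d f (polar x)" for s x and d :: "('a, 3) chart"
  have \<Phi>_inv: "\<Phi> (- s) d x = \<Phi> s d (inv x)" if "x \<in> H1.V" for d x
    unfolding \<Phi>_def rep_eq[OF s] rep_eq[OF s'] inv_def
    using stereo_inv_antipodal_chart[of "fst x" s "snd x"] that by (simp add: H1.V_def)
  obtain d where d: "d \<in> A" "polar (r, t) \<in> W (- s) d" using ex_W[OF s'] by blast
  have d1: "polar (inv (r, t)) \<in> W s d"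
    using d(2) stereo_inv_antipodal_chart[OF x, of s t] by (simp add: W_def inv_def)
  interpret metric_chart g d "chart_img d" by (rule metric_chart[OF d(1)])
  have dpol: "polar differentiable (at z)" for z using polar_deriv by (rule differentiableI)
  have drep: "local_rep (c q) d f differentiable (at u)" if "q = 1 \<or> q = -1" "u \<in> W q d" for q u
    using smooth_rep[OF that(1) d(1)] that(2) smooth_on_differentiable by blast
  have d\<Phi>: "dird v (\<Phi> q d) z = dird (dird v polar z) (local_rep (c q) d f) (polar z)"
    "\<Phi> q d differentiable (at z)"
    if "q = 1 \<or> q = -1" "polar z \<in> W q d" for q z v
    unfolding \<Phi>_def[abs_def] using dird_compose[OF dpol drep[OF that]]
      differentiable_chain_at[OF dpol drep[OF that]] by (auto simp: o_def)
  have gin: "dird v polar z \<bullet> (h q (polar z) *v dird w polar z) =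
      ginner g d (\<Phi> q d z) (dird v (\<Phi> q d) z) (dird w (\<Phi> q d) z)"
    if "q = 1 \<or> q = -1" "polar z \<in> W q d" for q z v w
    unfolding h_ginner[OF that(1) d(1) that(2)] d\<Phi>(1)[OF that] by (simp add: \<Phi>_def)
  have dinv: "(inv has_derivative (\<lambda>v. (- fst v / r\<^sup>2, snd v))) (at (r, t))"
    unfolding inv_def using x
    by (auto intro!: derivative_eq_intros simp: power2_eq_square divide_simps)
  have xV: "(r, t) \<in> H1.V" using x by (simp add: H1.V_def)
  have dird_inv: "dird v (\<Phi> (- s) d) (r, t) = dird (- fst v / r\<^sup>2, snd v) (\<Phi> s d) (inv (r, t))" for v
  proof -
    have "dird v (\<Phi> (- s) d) (r, t) = dird v (\<lambda>x. \<Phi> s d (inv x)) (r, t)"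
      by (rule dird_cong_open[OF H1.open_V xV]) (rule \<Phi>_inv)
    also have "\<dots> = dird (dird v inv (r, t)) (\<Phi> s d) (inv (r, t))"
      by (rule dird_compose[OF differentiableI[OF dinv] d\<Phi>(2)[OF s d1]])
    finally show ?thesis unfolding dird_eqI[OF dinv] .
  qed
  have 1: "dird (1, 0) (\<Phi> (- s) d) (r, t) = (- 1 / r\<^sup>2) *\<^sub>R dird (1, 0) (\<Phi> s d) (inv (r, t))"
    unfolding dird_inv linear_scale[OF linear_dird[OF d\<Phi>(2)[OF s d1]], symmetric] by simp
  have 2: "dird (0, 1) (\<Phi> (- s) d) (r, t) = dird (0, 1) (\<Phi> s d) (inv (r, t))"
    unfolding dird_inv by simp
  have inv: "inv (r, t) = (1 / r, t)" by (simp add: inv_def)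
  show "H2.hE (r, t) = H1.hE (1 / r, t) / r ^ 4"
    unfolding inv[symmetric] H1.hE_def H2.hE_def gin[OF s' d(2)] gin[OF s d1] 1 2 \<Phi>_inv[OF xV] ginner_linear
    by (simp add: power2_eq_square power4_eq_xxxx)
  show "H2.hF (r, t) = - H1.hF (1 / r, t) / r\<^sup>2"
    unfolding inv[symmetric] H1.hF_def H2.hF_def gin[OF s' d(2)] gin[OF s d1] 1 2 \<Phi>_inv[OF xV] ginner_linear
    by simp
  show "H2.hG (r, t) = H1.hG (1 / r, t)"
    unfolding inv[symmetric] H1.hG_def H2.hG_def gin[OF s' d(2)] gin[OF s d1] 1 2 \<Phi>_inv[OF xV] ..
qed

text \<open>At \<open>r = 1\<close> the values of \<open>hE\<close> and \<open>hG\<close> and the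
  angular derivative of \<open>hE\<close> agree for both disks, while \<open>hF\<close> and the
  radial derivative of \<open>hG\<close> change sign. Thus both terms in the numerator of
  \<open>conn2\<close> change sign, and its denominator does not.\<close>

lemma boundary_cancel:
  assumes s: "s = 1 \<or> s = -1"
  shows "disk_metric.conn_ext (h (- s)) (1, t) = - disk_metric.conn_ext (h s) (1, t)"
proof -
  have s': "- s = 1 \<or> - s = -1" using s by auto
  interpret H1: disk_metric "h s" by (rule disk_metric_h[OF s])
  interpret H2: disk_metric "h (- s)" by (rule disk_metric_h[OF s'])
  note at1 = metric_inversion[OF s zero_less_one, simplified]
  have E: "dird (0, 1) H2.hE (1, t) = dird (0, 1) H1.hE (1, t)"
    using dird_slice(2)[where r=1 and t=t, OF smooth_on_differentiable[OF H1.smooth_EFG(1) UNIV_I]]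
      dird_slice(2)[where r=1 and t=t, OF smooth_on_differentiable[OF H2.smooth_EFG(1) UNIV_I]]
    unfolding at1 by (rule vector_derivative_unique_at[rotated])
  have G: "dird (1, 0) H2.hG (1, t) = - dird (1, 0) H1.hG (1, t)"
  proof -
    have "((\<lambda>r. H1.hG (r, t)) has_real_derivative dird (1, 0) H1.hG (1, t)) (at (1 / 1))"
      using dird_slice(1)[where r=1 and t=t, OF smooth_on_differentiable[OF H1.smooth_EFG(3) UNIV_I]]
      by (simp add: has_real_derivative_iff_has_vector_derivative)
    moreover have "((\<lambda>r::real. 1 / r) has_real_derivative - 1) (at 1)"
      by (auto intro!: derivative_eq_intros)
    ultimately have "((\<lambda>r. H1.hG (1 / r, t)) has_real_derivative dird (1, 0) H1.hG (1, t) * - 1) (at 1)"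
      by (rule DERIV_chain2)
    then have "((\<lambda>r. H2.hG (r, t)) has_real_derivative - dird (1, 0) H1.hG (1, t)) (at 1)"
      by (simp, elim has_field_derivative_transform_within_open[where S="{0<..}"])
        (auto simp: metric_inversion(3)[OF s])
    then show ?thesis
      using dird_slice(1)[where r=1 and t=t, OF smooth_on_differentiable[OF H2.smooth_EFG(3) UNIV_I]]
      unfolding has_real_derivative_iff_has_vector_derivative by (rule vector_derivative_unique_at[rotated])
  qed
  have V: "(1, t) \<in> H1.V" "(1, t) \<in> H2.V" by (simp_all add: H1.V_def H2.V_def)
  show ?thesis
    unfolding H1.conn_ext_eq[OF V(1), symmetric] H2.conn_ext_eq[OF V(2), symmetric]
      H1.conn_ang_def H2.conn_ang_def conn2_def at1 E G
    by (simp add: minus_divide_left)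
qed

text \<open>The two open disks form one admissible family in the supremum that defines the volume;
  omitting the equator is harmless for a lower bound.\<close>

lemma area_ge: "ennreal (4 * pi) \<le> riemannian_volume sphere2_atlas (induced_metric A g f)"
proof -
  interpret H1: disk_metric "h 1" by (rule disk_metric_h) simp
  interpret H2: disk_metric "h (- 1)" by (rule disk_metric_h) simp
  define B where "B = ball (0 :: real^2) 1"
  let ?area = "\<lambda>s. \<integral>\<^sup>+u\<in>B. ennreal (sqrt (det (h s u))) \<partial>lborel"
  define J where "J = integral {0..2*pi} (\<lambda>t. H1.conn_ext (1, t))"
  have "ennreal (2 * pi - J) \<le> ?area 1"
    unfolding J_def B_def by (rule H1.gauss_bonnet_disk) (rule curvature_bound, auto simp: H1.V_def)
  moreover have "ennreal (2 * pi + J) \<le> ?area (-1)"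
  proof -
    have "integral {0..2*pi} (\<lambda>t. H2.conn_ext (1, t)) = - J"
      unfolding J_def using boundary_cancel[of 1] by simp
    then show ?thesis
      using H2.gauss_bonnet_disk curvature_bound[of "-1"] by (simp add: H2.V_def B_def)
  qed
  ultimately have "ennreal ((2 * pi - J) + (2 * pi + J)) \<le> ?area 1 + ?area (-1)"
    by (rule order_trans[OF ennreal_add_le add_mono])
  then have le: "ennreal (4 * pi) \<le> ?area 1 + ?area (-1)" by simp
  let ?P = "{(c 1, B), (c (-1), B)}"
  have ne: "c 1 \<noteq> c (-1)"
  proof
    assume "c 1 = c (-1)"
    then have "chart_dom (c 1) = chart_dom (c (-1))" by simp
    moreover have "axis 3 (-1) \<in> sphere (0 :: real^3) 1" unfolding in_sphere3 by (simp add: axis_def)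
    then have "axis 3 (-1) \<in> chart_dom (c 1)" "axis 3 (-1) \<notin> chart_dom (c (-1))"
      by (simp_all add: stereographic_chart_def axis_eq_axis)
    ultimately show False by simp
  qed
  have disj: "chart_inv (c 1) ` B \<inter> chart_inv (c (-1)) ` B = {}"
    using stereo_inv_ball[of _ 1] stereo_inv_ball[of _ "-1"]
    by (fastforce simp: chart_inv_stereo B_def)
  have P: "?P \<in> {P. finite P \<and> (\<forall>(c, B)\<in>P. c \<in> sphere2_atlas \<and> B \<in> sets borel \<and> B \<subseteq> chart_img c) \<and>
                  disjoint_family_on (\<lambda>(c, B). chart_inv c ` B) P}"
    using disj ne by (auto simp: c_in chart_img_stereo B_def disjoint_family_on_def)
  have "?area 1 + ?area (-1) = (\<Sum>(c, B)\<in>?P. \<integral>\<^sup>+u\<in>B. ennreal (sqrt (det (induced_metric A g f c u))) \<partial>lborel)"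
    using ne by (simp add: h_def)
  also have "\<dots> \<le> riemannian_volume sphere2_atlas (induced_metric A g f)"
    unfolding riemannian_volume_def by (rule SUP_upper[OF P])
  finally show ?thesis using le by (rule order_trans[rotated])
qed

end

theorem mainTheorem3:
  fixes M :: "'a topology" and A :: "('a, 3) chart set" and g :: "('a, 3) metric"
    and f :: "real^3 \<Rightarrow> 'a"
  assumes "complete_riemannian_manifold M A g"
    and "sectional_curvature_between A g 0 1"
    and "minimal_immersion sphere2 sphere2_atlas M A g f"
  shows "riemannian_volume sphere2_atlas (induced_metric A g f) \<ge> ennreal (4 * pi)"
proof -
  interpret minimal_sphere M A g f by unfold_locales fact+
  show ?thesis by (rule area_ge)
qed

end
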